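(* Let $p\in(0,1)$ be fixed and let $m\geqslant 5$ be a fixed integer. Then with high probability $$ n+\frac{n}{4(m-1)\log_{\frac{1}{1-p}} n}(1-o(1))\leqslant\mathrm{sat}\left(G\left(n,p\right),C_m\right)\leqslant n + \frac{n}{2\log_{\frac{1}{1-p}} n}(1+o(1)). $$
   Context: $G(n,p)$ is the binomial random graph on vertex set $[n]=\{1,\dots,n\}$ in which each pair of vertices is adjacent independently with probability $p$. A property holds with high probability (whp) if its probability tends to $1$ as $n\to\infty$; the $o(1)$ terms denote functions of $n$ tending to $0$ as $n\to\infty$. $C_m$ is the cycle on $m$ vertices. For graphs $F$ and $G$, a spanning subgraph $H\subseteq G$ is $F$-saturated in $G$ if $H$ contains no copy of $F$ but adding to $H$ any edge of $G$ not in $H$ creates a copy of $F$; $\mathrm{sat}(G,F)$ is the minimum number of edges of an $F$-saturated graph in $G$. *)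

theory Defs
  imports "HOL-Probability.Probability"
begin

text \<open>Graphs on vertex set [n] = {1..n} are represented by their edge sets,
  edges being 2-element sets of vertices.\<close>

definition all_pairs :: "nat \<Rightarrow> nat set set" where
  "all_pairs n = {e. \<exists>i j. 1 \<le> i \<and> i < j \<and> j \<le> n \<and> e = {i, j}}"

definition gnp :: "nat \<Rightarrow> real \<Rightarrow> nat set set pmf" where
  "gnp n p = map_pmf (\<lambda>f. {e \<in> all_pairs n. f e})
                (Pi_pmf (all_pairs n) False (\<lambda>_. bernoulli_pmf p))"

definition has_cycle :: "nat \<Rightarrow> nat set set \<Rightarrow> bool" where
  "has_cycle m H \<longleftrightarrow> (\<exists>vs. length vs = m \<and> distinct vs \<and>
      (\<forall>i<m. {vs ! i, vs ! ((i + 1) mod m)} \<in> H))"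

definition cycle_saturated :: "nat \<Rightarrow> nat set set \<Rightarrow> nat set set \<Rightarrow> bool" where
  "cycle_saturated m G H \<longleftrightarrow> H \<subseteq> G \<and> \<not> has_cycle m H \<and>
      (\<forall>e \<in> G - H. has_cycle m (insert e H))"

definition sat_cycle :: "nat set set \<Rightarrow> nat \<Rightarrow> nat" where
  "sat_cycle G m = Min (card ` {H. cycle_saturated m G H})"

end

theory Submission
  imports Defs "HOL-Real_Asymp.Real_Asymp" "HOL-Library.Ramsey"
begin

text \<open>
  Let \<open>L\<close> be the logarithm of \<open>n\<close> to the base \<open>1 / (1 - p)\<close>.

  Lower bound. If \<open>H\<close> is saturated in \<open>G\<close>, every edge of \<open>G\<close> outside \<open>H\<close> joins two vertices connected in
  \<open>H\<close> by a path with \<open>m\<close> vertices, so all pairs not so connected are non-edges of \<open>G\<close>. There are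
  only \<open>n^(n + o(n))\<close> graphs with \<open>n + O(n / L)\<close> edges, so with high probability each of them that is
  saturated has at most \<open>(1 + o(1)) n L\<close> unconnected pairs. In particular some vertex \<open>r\<close> is
  connected to all but \<open>O(L)\<close> vertices, so a breadth-first tree from \<open>r\<close> has depth at most \<open>m - 1\<close> up
  to \<open>O(L)\<close> vertices. If \<open>H\<close> has \<open>n + k\<close> edges, the ancestors of the endpoints of the non-tree edges
  form a set \<open>A\<close> of about \<open>2 k (m - 1)\<close> vertices, and the rest of \<open>H\<close> consists of trees hanging off
  \<open>A\<close>. Nearly all vertices have height below \<open>(m - 1) / 2\<close> in these trees, and two of them in the same
  tree are unconnected. By convexity there are at least about \<open>n^2 / (4 k (m - 1))\<close> unconnected
  pairs, whence \<open>k \<ge> (1 - o(1)) n / (4 (m - 1) L)\<close>.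

  Upper bound. Take a clique on \<open>m - 2\<close> vertices, join about \<open>n / (2 L)\<close> further vertices, the centres, to
  the same two vertices of the clique, and attach all other vertices as leaves to the centres so that
  the leaves of each centre are independent in \<open>G\<close>. This graph is saturated and has
  \<open>n + (1 + o(1)) n / (2 L)\<close> edges. It exists because with high probability every set of order
  \<open>n / L\<close> contains an independent set of size \<open>(2 - o(1)) L\<close>, by the second moment method and the
  bounded difference inequality, so almost all leaves can be distributed greedily; the few remaining
  ones receive a centre each.
\<close>

section \<open>Random subsets and bounded differences\<close>

definition random_subset :: "'a set \<Rightarrow> real \<Rightarrow> 'a set pmf" where
  "random_subset E p = map_pmf (\<lambda>f. {e \<in> E. f e}) (Pi_pmf E False (\<lambda>_. bernoulli_pmf p))"

abbreviation expec :: "'a set \<Rightarrow> real \<Rightarrow> ('a set \<Rightarrow> real) \<Rightarrow> real" where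
  "expec E p f \<equiv> measure_pmf.expectation (random_subset E p) f"

lemma random_subset_empty: "random_subset {} p = return_pmf {}"
  by (simp add: random_subset_def)

lemma random_subset_insert:
  assumes "finite E" "e \<notin> E"
  shows "random_subset (insert e E) p =
    bernoulli_pmf p \<bind> (\<lambda>b. map_pmf (\<lambda>S. if b then insert e S else S) (random_subset E p))"
proof -
  have "random_subset (insert e E) p = map_pmf (\<lambda>(b, f). {x \<in> insert e E. (f(e := b)) x})
          (pair_pmf (bernoulli_pmf p) (Pi_pmf E False (\<lambda>_. bernoulli_pmf p)))"
    unfolding random_subset_def using assms
    by (subst Pi_pmf_insert) (auto simp: pmf.map_comp o_def case_prod_unfold)
  also have "\<dots> = map_pmf (\<lambda>(b, f). if b then insert e {x \<in> E. f x} else {x \<in> E. f x})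
          (pair_pmf (bernoulli_pmf p) (Pi_pmf E False (\<lambda>_. bernoulli_pmf p)))"
    using assms by (intro map_pmf_cong) (auto split: if_splits)
  also have "\<dots> = bernoulli_pmf p \<bind> (\<lambda>b. map_pmf (\<lambda>S. if b then insert e S else S) (random_subset E p))"
    by (simp add: random_subset_def pair_pmf_def map_pmf_def bind_assoc_pmf bind_return_pmf)
  finally show ?thesis .
qed

lemma set_pmf_random_subset_subset: "set_pmf (random_subset E p) \<subseteq> Pow E"
  by (auto simp: random_subset_def)

lemma finite_set_pmf_random_subset: "finite E \<Longrightarrow> finite (set_pmf (random_subset E p))"
  by (rule finite_subset[OF set_pmf_random_subset_subset]) simp

lemma integrable_random_subset [simp]:
  "finite E \<Longrightarrow> integrable (measure_pmf (random_subset E p)) (f :: _ \<Rightarrow> real)"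
  by (intro integrable_measure_pmf_finite finite_set_pmf_random_subset)

lemma expec_insert:
  assumes "finite E" "e \<notin> E" "0 \<le> p" "p \<le> 1"
  shows "expec (insert e E) p f = p * expec E p (\<lambda>S. f (insert e S)) + (1 - p) * expec E p f"
proof -
  have "expec (insert e E) p f = (\<Sum>b\<in>UNIV. pmf (bernoulli_pmf p) b *\<^sub>R
     measure_pmf.expectation (map_pmf (\<lambda>S. if b then insert e S else S) (random_subset E p)) f)"
    unfolding random_subset_insert[OF assms(1,2)]
    by (rule pmf_expectation_bind) (auto intro: finite_set_pmf_random_subset assms)
  then show ?thesis
    using assms by (simp add: UNIV_bool)
qed

lemma expec_mono:
  assumes "finite E" "\<And>S. S \<subseteq> E \<Longrightarrow> f S \<le> g S"
  shows "expec E p f \<le> expec E p g"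
  using assms set_pmf_random_subset_subset[of E p]
  by (intro integral_mono_AE) (auto simp: AE_measure_pmf_iff)

lemma expec_le_attained:
  assumes "finite E"
  obtains S where "S \<subseteq> E" "expec E p f \<le> f S"
proof -
  have "Max (f ` Pow E) \<in> f ` Pow E"
    using assms by (intro Max_in) auto
  then obtain S where S: "S \<subseteq> E" "f S = Max (f ` Pow E)" by auto
  have "expec E p f \<le> expec E p (\<lambda>_. f S)"
    using assms S by (intro expec_mono) auto
  then show ?thesis using that S by simp
qed

lemma prob_random_subset_mono:
  assumes "\<And>S. S \<subseteq> E \<Longrightarrow> S \<in> A \<Longrightarrow> S \<in> B"
  shows "measure_pmf.prob (random_subset E p) A \<le> measure_pmf.prob (random_subset E p) B"
  using assms set_pmf_random_subset_subset[of E p]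
  by (intro measure_pmf.finite_measure_mono_AE) (auto simp: AE_measure_pmf_iff)

lemma prob_UN_le_card_mult:
  assumes "finite I" "\<And>i. i \<in> I \<Longrightarrow> measure_pmf.prob M (A i) \<le> c"
  shows "measure_pmf.prob M (\<Union>i\<in>I. A i) \<le> real (card I) * c"
proof -
  have "measure_pmf.prob M (\<Union>i\<in>I. A i) \<le> (\<Sum>i\<in>I. measure_pmf.prob M (A i))"
    using assms(1) by (intro measure_UNION_le) auto
  also have "\<dots> \<le> real (card I) * c"
    using assms(2) by (rule sum_bounded_above)
  finally show ?thesis .
qed

lemma prob_random_subset_superset_disjoint:
  assumes "finite E" "A \<subseteq> E" "B \<subseteq> E" "A \<inter> B = {}" "0 \<le> p" "p \<le> 1"
  shows "measure_pmf.prob (random_subset E p) {S. A \<subseteq> S \<and> S \<inter> B = {}} = p ^ card A * (1 - p) ^ card B"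
proof -
  let ?F = "\<lambda>e. if e \<in> A then {True} else if e \<in> B then {False} else UNIV"
  have mem_F: "f e \<in> ?F e \<longleftrightarrow> (e \<in> A \<longrightarrow> f e) \<and> (e \<in> B \<longrightarrow> \<not> f e)" for f e
    using assms(4) by auto
  have "A \<subseteq> {e \<in> E. f e} \<and> {e \<in> E. f e} \<inter> B = {} \<longleftrightarrow> f \<in> Pi E ?F" for f
    using assms(2,3) unfolding Pi_iff mem_F by blast
  then have "measure_pmf.prob (random_subset E p) {S. A \<subseteq> S \<and> S \<inter> B = {}}
      = measure_pmf.prob (Pi_pmf E False (\<lambda>_. bernoulli_pmf p)) (Pi E ?F)"
    by (simp add: random_subset_def vimage_def)
  also have "\<dots> = (\<Prod>e\<in>E. measure_pmf.prob (bernoulli_pmf p) (?F e))"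
    using assms(1) by (rule measure_Pi_pmf_Pi)
  also have "\<dots> = (\<Prod>e\<in>E. (if e \<in> A then p else 1) * (if e \<in> B then 1 - p else 1))"
    using assms(4-6) by (intro prod.cong) (auto simp: measure_pmf_single)
  also have "\<dots> = p ^ card A * (1 - p) ^ card B"
    using assms(1-3) by (simp add: prod.distrib prod.If_cases Int_absorb1)
  finally show ?thesis .
qed

corollary prob_random_subset_superset:
  assumes "finite E" "A \<subseteq> E" "0 \<le> p" "p \<le> 1"
  shows "measure_pmf.prob (random_subset E p) {S. A \<subseteq> S} = p ^ card A"
  using prob_random_subset_superset_disjoint[of E A "{}" p] assms by simp

corollary prob_random_subset_disjoint:
  assumes "finite E" "B \<subseteq> E" "0 \<le> p" "p \<le> 1"
  shows "measure_pmf.prob (random_subset E p) {S. S \<inter> B = {}} = (1 - p) ^ card B"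
  using prob_random_subset_superset_disjoint[of E "{}" B p] assms by simp

lemma Hoeffding_two_point:
  fixes p u v l :: real
  assumes "0 \<le> p" "p \<le> 1"
  shows "p * exp (l * u) + (1 - p) * exp (l * v)
    \<le> exp (l * (p * u + (1 - p) * v) + l\<^sup>2 * (u - v)\<^sup>2 / 8)"
proof -
  have ordered: "q * exp (h + z) + (1 - q) * exp z \<le> exp (z + q * h + h\<^sup>2 / 8)"
    if "0 \<le> q" "q \<le> 1" "0 \<le> h" for q h z :: real
  proof -
    have pos: "0 < 1 + q * (exp h - 1)"
      using that by (smt (verit) exp_ge_zero mult_nonneg_nonneg one_le_exp_iff)
    have "ln (1 + q * (exp h - 1)) \<le> q * h + h\<^sup>2 / 8"
      using Hoeffdings_lemma_aux[of h q] that by (simp add: algebra_simps)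
    then have "1 + q * (exp h - 1) \<le> exp (q * h + h\<^sup>2 / 8)"
      using pos by (metis exp_le_cancel_iff exp_ln)
    then have "exp z * (1 + q * (exp h - 1)) \<le> exp z * exp (q * h + h\<^sup>2 / 8)"
      by (intro mult_left_mono) auto
    then show ?thesis by (simp add: algebra_simps exp_add)
  qed
  show ?thesis
  proof (cases "l * v \<le> l * u")
    case True
    then show ?thesis using ordered[of p "l * u - l * v" "l * v"] assms
      by (simp add: algebra_simps power2_eq_square)
  next
    case False
    then show ?thesis using ordered[of "1 - p" "l * v - l * u" "l * u"] assms
      by (simp add: algebra_simps power2_eq_square)
  qed
qed

definition bounded_differences :: "'a set \<Rightarrow> ('a \<Rightarrow> real) \<Rightarrow> ('a set \<Rightarrow> real) \<Rightarrow> bool" where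
  "bounded_differences E c f \<longleftrightarrow> (\<forall>e\<in>E. \<forall>S\<subseteq>E. e \<notin> S \<longrightarrow> \<bar>f (insert e S) - f S\<bar> \<le> c e)"

lemma bounded_differencesI:
  "(\<And>e S. e \<in> E \<Longrightarrow> S \<subseteq> E \<Longrightarrow> e \<notin> S \<Longrightarrow> \<bar>f (insert e S) - f S\<bar> \<le> c e) \<Longrightarrow> bounded_differences E c f"
  by (simp add: bounded_differences_def)

lemma bounded_differencesD:
  "bounded_differences E c f \<Longrightarrow> e \<in> E \<Longrightarrow> S \<subseteq> E \<Longrightarrow> e \<notin> S \<Longrightarrow> \<bar>f (insert e S) - f S\<bar> \<le> c e"
  by (simp add: bounded_differences_def)

lemma bounded_differences_subset:
  "bounded_differences E c f \<Longrightarrow> E' \<subseteq> E \<Longrightarrow> bounded_differences E' c f"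
  unfolding bounded_differences_def by blast

lemma bounded_differences_compose_insert:
  assumes "bounded_differences (insert e E) c f" "e \<notin> E"
  shows "bounded_differences E c (\<lambda>S. f (insert e S))"
proof (rule bounded_differencesI)
  fix e' S assume "e' \<in> E" "S \<subseteq> E" "e' \<notin> S"
  then show "\<bar>f (insert e (insert e' S)) - f (insert e S)\<bar> \<le> c e'"
    using assms bounded_differencesD[of "insert e E" c f e' "insert e S"]
    by (auto simp: insert_commute)
qed

lemma expec_insert_bounded_difference:
  assumes "finite E" "e \<notin> E" "bounded_differences (insert e E) c f"
  shows "\<bar>expec E p (\<lambda>S. f (insert e S)) - expec E p f\<bar> \<le> c e"
proof -
  have "\<bar>f (insert e S) - f S\<bar> \<le> c e" if "S \<subseteq> E" for S
    using that assms by (intro bounded_differencesD[OF assms(3)]) auto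
  then have "\<bar>expec E p (\<lambda>S. f (insert e S) - f S)\<bar> \<le> expec E p (\<lambda>_. c e)"
    using assms(1) by (intro order_trans[OF integral_abs_bound] expec_mono) auto
  then show ?thesis using assms(1) by simp
qed

lemma expec_exp_le_of_bounded_differences:
  assumes "finite E" "0 \<le> p" "p \<le> 1" "bounded_differences E c f"
  shows "expec E p (\<lambda>S. exp (l * f S)) \<le> exp (l * expec E p f + l\<^sup>2 * (\<Sum>e\<in>E. (c e)\<^sup>2) / 8)"
  using assms
proof (induction E arbitrary: f rule: finite_induct)
  case empty
  then show ?case by (simp add: random_subset_empty)
next
  case (insert e E)
  define u where "u = expec E p (\<lambda>S. f (insert e S))"
  define v where "v = expec E p f"
  define k where "k = (\<Sum>e\<in>E. (c e)\<^sup>2)"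
  have with_e: "expec E p (\<lambda>S. exp (l * f (insert e S))) \<le> exp (l * u + l\<^sup>2 * k / 8)"
    unfolding u_def k_def
    using insert by (intro insert.IH bounded_differences_compose_insert) auto
  have without_e: "expec E p (\<lambda>S. exp (l * f S)) \<le> exp (l * v + l\<^sup>2 * k / 8)"
    unfolding v_def k_def
    using insert by (intro insert.IH bounded_differences_subset[OF insert.prems(3)]) auto
  have "\<bar>u - v\<bar> \<le> c e"
    unfolding u_def v_def using insert by (intro expec_insert_bounded_difference)
  then have uv: "(u - v)\<^sup>2 \<le> (c e)\<^sup>2" by (intro abs_le_square_iff[THEN iffD1]) auto
  have "expec (insert e E) p (\<lambda>S. exp (l * f S))
     = p * expec E p (\<lambda>S. exp (l * f (insert e S))) + (1 - p) * expec E p (\<lambda>S. exp (l * f S))"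
    using insert by (intro expec_insert) auto
  also have "\<dots> \<le> p * exp (l * u + l\<^sup>2 * k / 8) + (1 - p) * exp (l * v + l\<^sup>2 * k / 8)"
    using with_e without_e insert.prems by (intro add_mono mult_left_mono) auto
  also have "\<dots> = (p * exp (l * u) + (1 - p) * exp (l * v)) * exp (l\<^sup>2 * k / 8)"
    by (simp add: exp_add algebra_simps)
  also have "\<dots> \<le> exp (l * (p * u + (1 - p) * v) + l\<^sup>2 * (u - v)\<^sup>2 / 8) * exp (l\<^sup>2 * k / 8)"
    using insert.prems by (intro mult_right_mono Hoeffding_two_point) auto
  also have "\<dots> \<le> exp (l * (p * u + (1 - p) * v) + l\<^sup>2 * (c e)\<^sup>2 / 8) * exp (l\<^sup>2 * k / 8)"
    using uv by (intro mult_right_mono) (auto intro!: mult_left_mono)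
  also have "\<dots> = exp (l * expec (insert e E) p f + l\<^sup>2 * (\<Sum>e\<in>insert e E. (c e)\<^sup>2) / 8)"
    unfolding expec_insert[OF insert.hyps insert.prems(1,2)] sum.insert[OF insert.hyps] u_def v_def k_def
    by (simp add: exp_add[symmetric] algebra_simps add_divide_distrib)
  finally show ?case .
qed

theorem bounded_differences_lower_tail:
  assumes "finite E" "0 \<le> p" "p \<le> 1" "bounded_differences E c f"
    and "(\<Sum>e\<in>E. (c e)\<^sup>2) \<le> M" "0 < M" "0 \<le> t"
  shows "measure_pmf.prob (random_subset E p) {S. f S \<le> expec E p f - t} \<le> exp (- 2 * t\<^sup>2 / M)"
proof -
  define \<mu> where "\<mu> = expec E p f"
  define l where "l = - 4 * t / M"
  have l_nonpos: "l \<le> 0" using assms by (simp add: l_def)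
  have "measure_pmf.prob (random_subset E p) {S. f S \<le> \<mu> - t} = expec E p (indicator {S. f S \<le> \<mu> - t})"
    by simp
  also have "\<dots> \<le> expec E p (\<lambda>S. exp (l * f S) * exp (- l * (\<mu> - t)))"
  proof (rule expec_mono)
    fix S
    have "1 \<le> exp (l * f S) * exp (- l * (\<mu> - t))" if "f S \<le> \<mu> - t"
    proof -
      have "l * (\<mu> - t) \<le> l * f S" using l_nonpos that by (intro mult_left_mono_neg)
      then show ?thesis by (simp add: exp_add[symmetric] algebra_simps)
    qed
    then show "indicator {S. f S \<le> \<mu> - t} S \<le> exp (l * f S) * exp (- l * (\<mu> - t))"
      by (auto simp: indicator_def)
  qed (use assms in auto)
  also have "\<dots> = expec E p (\<lambda>S. exp (l * f S)) * exp (- l * (\<mu> - t))" by simp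
  also have "\<dots> \<le> exp (l * \<mu> + l\<^sup>2 * (\<Sum>e\<in>E. (c e)\<^sup>2) / 8) * exp (- l * (\<mu> - t))"
    unfolding \<mu>_def using assms by (intro mult_right_mono expec_exp_le_of_bounded_differences) auto
  also have "\<dots> = exp (l * t + l\<^sup>2 * (\<Sum>e\<in>E. (c e)\<^sup>2) / 8)"
    by (simp add: exp_add[symmetric] algebra_simps)
  also have "\<dots> \<le> exp (l * t + l\<^sup>2 * M / 8)"
    using assms by (auto intro!: mult_left_mono divide_right_mono)
  also have "l * t + l\<^sup>2 * M / 8 = - 2 * t\<^sup>2 / M"
    using assms by (simp add: l_def field_simps power2_eq_square)
  finally show ?thesis by (simp add: \<mu>_def)
qed

lemma expec_card_Collect:
  assumes "finite E" "finite K"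
  shows "expec E p (\<lambda>S. real (card {x \<in> K. P x S})) = (\<Sum>x\<in>K. measure_pmf.prob (random_subset E p) {S. P x S})"
proof -
  have "real (card {x \<in> K. P x S}) = (\<Sum>x\<in>K. indicator {S. P x S} S)" for S
    using assms(2) by (simp add: indicator_def sum.If_cases Int_def)
  then show ?thesis
    using assms(1) by (simp add: Bochner_Integration.integral_sum)
qed

lemma bounded_differences_card_contained:
  assumes "finite K" "disjoint_family_on F K"
  shows "bounded_differences E (indicator (\<Union>w\<in>K. F w)) (\<lambda>S. real (card {w \<in> K. F w \<subseteq> S}))"
proof (rule bounded_differencesI)
  fix e S
  define N where "N = {w \<in> K. F w \<subseteq> insert e S} - {w \<in> K. F w \<subseteq> S}"
  have "real (card {w \<in> K. F w \<subseteq> insert e S}) - real (card {w \<in> K. F w \<subseteq> S}) = real (card N)"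
    using assms(1) unfolding N_def
    by (subst card_Diff_subset) (auto intro!: of_nat_diff[symmetric] card_mono)
  moreover have "real (card N) \<le> indicator (\<Union>w\<in>K. F w) e"
  proof (cases "N = {}")
    case False
    then obtain w where "w \<in> N" by blast
    have in_F: "e \<in> F w'" if "w' \<in> N" for w' using that by (auto simp: N_def)
    have "w' = w" if "w' \<in> N" for w'
      using disjoint_family_onD[OF assms(2), of w w'] in_F[OF that] in_F[OF \<open>w \<in> N\<close>] that \<open>w \<in> N\<close>
      by (auto simp: N_def)
    then have "N \<subseteq> {w}" by blast
    moreover have "e \<in> (\<Union>w\<in>K. F w)" using in_F[OF \<open>w \<in> N\<close>] \<open>w \<in> N\<close> by (auto simp: N_def)
    ultimately show ?thesis using card_mono[of "{w}" N] by simp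
  qed simp
  ultimately show "\<bar>real (card {w \<in> K. F w \<subseteq> insert e S}) - real (card {w \<in> K. F w \<subseteq> S})\<bar>
      \<le> indicator (\<Union>w\<in>K. F w) e"
    by simp
qed

lemma prob_few_contained:
  assumes "finite E" "0 \<le> p" "p \<le> 1" "1 \<le> q"
    and "finite K" "K \<noteq> {}" "disjoint_family_on F K" "\<And>w. w \<in> K \<Longrightarrow> F w \<subseteq> E \<and> card (F w) = q"
  shows "measure_pmf.prob (random_subset E p) {S. real (card {w \<in> K. F w \<subseteq> S}) \<le> p ^ q / 2 * real (card K)}
    \<le> exp (- (p ^ (2 * q) * real (card K) / (2 * real q)))"
proof -
  define f where "f = (\<lambda>S. real (card {w \<in> K. F w \<subseteq> S}))"
  define k where "k = real (card K)"
  define E0 where "E0 = (\<Union>w\<in>K. F w)"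
  have k_pos: "0 < k" using assms by (simp add: k_def card_gt_0_iff)
  have "finite (F w)" if "w \<in> K" for w
    using that assms(1,8) finite_subset by blast
  then have "card E0 = (\<Sum>w\<in>K. card (F w))"
    unfolding E0_def using assms by (intro card_UN_disjoint') auto
  also have "\<dots> = card K * q" using assms(8) by simp
  finally have "real (card E0) = k * real q" by (simp add: k_def)
  moreover have "E0 \<subseteq> E" using assms(8) by (auto simp: E0_def)
  then have "(\<Sum>e\<in>E. (indicator E0 e)\<^sup>2) = (\<Sum>e\<in>E0. 1 :: real)"
    using assms(1) by (intro sum.mono_neutral_cong_right) auto
  ultimately have sum_squares: "(\<Sum>e\<in>E. (indicator E0 e)\<^sup>2) = k * real q" by simp
  have "expec E p f = (\<Sum>w\<in>K. p ^ q)"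
    unfolding f_def expec_card_Collect[OF assms(1,5)]
    using assms by (intro sum.cong) (simp_all add: prob_random_subset_superset)
  then have expec_f: "expec E p f = k * p ^ q" by (simp add: k_def)
  have "bounded_differences E (indicator E0) f"
    unfolding E0_def f_def using assms(5,7) by (rule bounded_differences_card_contained)
  then have "measure_pmf.prob (random_subset E p) {S. f S \<le> expec E p f - k * p ^ q / 2}
      \<le> exp (- 2 * (k * p ^ q / 2)\<^sup>2 / (k * real q))"
    using assms k_pos sum_squares by (intro bounded_differences_lower_tail) auto
  also have "expec E p f - k * p ^ q / 2 = p ^ q / 2 * k"
    by (simp add: expec_f)
  also have "- 2 * (k * p ^ q / 2)\<^sup>2 / (k * real q) = - (p ^ (2 * q) * k / (2 * real q))"
    using k_pos assms(4) by (simp add: power2_eq_square power_mult field_simps)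
  finally show ?thesis by (simp only: f_def k_def)
qed

section \<open>Independent sets in hypergraphs\<close>

lemma hypergraph_independent_subset:
  fixes R :: "'a set set"
  assumes "finite S" "finite R" "{} \<notin> R"
  obtains I where "I \<subseteq> S" "\<forall>e\<in>R. \<not> e \<subseteq> I" "card S \<le> card I + card {e \<in> R. e \<subseteq> S}"
proof -
  define B where "B = {e \<in> R. e \<subseteq> S}"
  have "finite B" using assms(2) by (simp add: B_def)
  define w where "w = (\<lambda>e :: 'a set. SOME v. v \<in> e)"
  have w: "w e \<in> e" if "e \<in> B" for e
    using that assms(3) some_in_eq[of e] by (auto simp: B_def w_def)
  define I where "I = S - w ` B"
  have "card S \<le> card (I \<union> w ` B)"
    using assms(1) \<open>finite B\<close> by (intro card_mono) (auto simp: I_def)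
  also have "\<dots> \<le> card I + card (w ` B)" by (rule card_Un_le)
  also have "card (w ` B) \<le> card B" using \<open>finite B\<close> by (rule card_image_le)
  finally have "card S \<le> card I + card {e \<in> R. e \<subseteq> S}" by (simp add: B_def)
  moreover have "\<not> e \<subseteq> I" if "e \<in> R" for e
  proof
    assume "e \<subseteq> I"
    then have "e \<in> B" using that by (auto simp: I_def B_def)
    then show False using w[of e] \<open>e \<subseteq> I\<close> by (auto simp: I_def)
  qed
  ultimately show ?thesis using that[of I] by (simp add: I_def)
qed

lemma hypergraph_independent_set_random:
  assumes "finite V" "\<And>e. e \<in> R \<Longrightarrow> e \<subseteq> V \<and> e \<noteq> {}" "0 \<le> q" "q \<le> 1"
  obtains I where "I \<subseteq> V" "\<forall>e\<in>R. \<not> e \<subseteq> I" "q * real (card V) - (\<Sum>e\<in>R. q ^ card e) \<le> real (card I)"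
proof -
  have finR: "finite R" using assms(1,2) by (intro finite_subset[of R "Pow V"]) auto
  define \<phi> where "\<phi> = (\<lambda>S. real (card {v \<in> V. {v} \<subseteq> S}) - real (card {e \<in> R. e \<subseteq> S}))"
  have "expec V q \<phi> = (\<Sum>v\<in>V. measure_pmf.prob (random_subset V q) {S. {v} \<subseteq> S})
      - (\<Sum>e\<in>R. measure_pmf.prob (random_subset V q) {S. e \<subseteq> S})"
    unfolding \<phi>_def using assms(1) finR
    by (subst Bochner_Integration.integral_diff) (simp_all add: expec_card_Collect del: insert_subset)
  also have "\<dots> = (\<Sum>v\<in>V. q ^ card {v}) - (\<Sum>e\<in>R. q ^ card e)"
    using assms by (intro arg_cong2[where f = "(-)"] sum.cong refl prob_random_subset_superset) auto
  finally have expec_\<phi>: "expec V q \<phi> = q * real (card V) - (\<Sum>e\<in>R. q ^ card e)" by simp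
  obtain S where S: "S \<subseteq> V" "expec V q \<phi> \<le> \<phi> S"
    using expec_le_attained[OF assms(1)] by blast
  have "finite S" using S(1) assms(1) finite_subset by blast
  then obtain I where I: "I \<subseteq> S" "\<forall>e\<in>R. \<not> e \<subseteq> I" "card S \<le> card I + card {e \<in> R. e \<subseteq> S}"
    using hypergraph_independent_subset[of S R] finR assms(2) by blast
  have "{v \<in> V. {v} \<subseteq> S} = S" using S(1) by auto
  then show ?thesis using that[of I] I S expec_\<phi> by (simp add: \<phi>_def)
qed

section \<open>Paths and cycles\<close>

definition nbrs :: "'a set set \<Rightarrow> 'a \<Rightarrow> 'a set" where
  "nbrs F v = {w. {v, w} \<in> F}"

lemma mem_nbrs [simp]: "w \<in> nbrs F v \<longleftrightarrow> {v, w} \<in> F"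
  by (simp add: nbrs_def)

lemma nbrs_subset: "F \<subseteq> [V]\<^bsup>2\<^esup> \<Longrightarrow> nbrs F v \<subseteq> V"
  by (auto simp: nbrs_def)

lemma sum_card_nbrs:
  assumes "finite V" "F \<subseteq> [V]\<^bsup>2\<^esup>"
  shows "(\<Sum>v\<in>V. card (nbrs F v)) = 2 * card F"
proof -
  have "finite F"
    using assms finite_imp_finite_nsets finite_subset by blast
  have "card (nbrs F v) = card {e \<in> F. v \<in> e}" for v
  proof (rule bij_betw_same_card[of "\<lambda>w. {v, w}"], rule bij_betwI')
    fix e assume "e \<in> {e \<in> F. v \<in> e}"
    then obtain a b where "e = {a, b}" "e \<in> F" "v = a \<or> v = b"
      using assms(2) by (auto elim!: nsets2_E)
    then show "\<exists>w\<in>nbrs F v. e = {v, w}" by (auto simp: insert_commute)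
  qed (auto simp: doubleton_eq_iff)
  then have "(\<Sum>v\<in>V. card (nbrs F v)) = (\<Sum>v\<in>V. card {e \<in> F. v \<in> e})" by simp
  also have "\<dots> = (\<Sum>e\<in>F. 2)"
  proof (rule sum_multicount_gen)
    show "\<forall>e\<in>F. card {v \<in> V. v \<in> e} = 2"
    proof
      fix e assume "e \<in> F"
      then have "{v \<in> V. v \<in> e} = e" "card e = 2" using assms(2) by (auto simp: nsets_def)
      then show "card {v \<in> V. v \<in> e} = 2" by simp
    qed
  qed (use assms(1) \<open>finite F\<close> in auto)
  finally show ?thesis by simp
qed

definition upath :: "'a set set \<Rightarrow> 'a list \<Rightarrow> bool" where
  "upath H vs \<longleftrightarrow> vs \<noteq> [] \<and> distinct vs \<and> successively (\<lambda>a b. {a, b} \<in> H) vs"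

definition ucycle :: "'a set set \<Rightarrow> 'a list \<Rightarrow> bool" where
  "ucycle H vs \<longleftrightarrow> upath H vs \<and> {last vs, hd vs} \<in> H"

definition joined :: "nat \<Rightarrow> 'a set set \<Rightarrow> 'a \<Rightarrow> 'a \<Rightarrow> bool" where
  "joined m H u v \<longleftrightarrow> (\<exists>vs. upath H vs \<and> length vs = m \<and> hd vs = u \<and> last vs = v)"

lemma upath_singleton [simp]: "upath H [v]"
  by (simp add: upath_def)

lemma upath_Cons: "upath H (v # vs) \<longleftrightarrow> vs = [] \<or> v \<notin> set vs \<and> {v, hd vs} \<in> H \<and> upath H vs"
  by (auto simp: upath_def successively_Cons)

lemma upath_append:
  "vs \<noteq> [] \<Longrightarrow> ws \<noteq> [] \<Longrightarrow>
    upath H (vs @ ws) \<longleftrightarrow> upath H vs \<and> upath H ws \<and> set vs \<inter> set ws = {} \<and> {last vs, hd ws} \<in> H"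
  by (auto simp: upath_def successively_append_iff)

lemma upath_rev: "upath H vs \<Longrightarrow> upath H (rev vs)"
  by (simp add: upath_def insert_commute)

lemma upath_mono: "upath H vs \<Longrightarrow> H \<subseteq> H' \<Longrightarrow> upath H' vs"
  by (auto simp: upath_def elim: successively_mono)

lemma joinedI: "upath H vs \<Longrightarrow> joined (length vs) H (hd vs) (last vs)"
  by (auto simp: joined_def)

lemma joined_sym: "joined m H u v \<longleftrightarrow> joined m H v u"
proof -
  have "joined m H b a" if "joined m H a b" for a b
    using that unfolding joined_def by (metis hd_rev last_rev length_rev upath_rev)
  then show ?thesis by blast
qed

lemma joined_neq:
  assumes "joined m H u v" "2 \<le> m"
  shows "u \<noteq> v"
proof -
  obtain vs where vs: "upath H vs" "length vs = m" "hd vs = u" "last vs = v"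
    using assms(1) by (auto simp: joined_def)
  then show ?thesis
    using assms(2) last_in_set[of "tl vs"] by (cases vs) (auto simp: upath_Cons split: if_splits)
qed

lemma upath_insert_endpoints:
  assumes "upath (insert {hd vs, last vs} H) vs" "3 \<le> length vs"
  shows "upath H vs"
proof -
  have vs: "vs \<noteq> []" "distinct vs" using assms(1) by (auto simp: upath_def)
  have "{vs ! i, vs ! Suc i} \<noteq> {hd vs, last vs}" if "Suc i < length vs" for i
    using vs that assms(2)
    by (auto simp: hd_conv_nth last_conv_nth doubleton_eq_iff nth_eq_iff_index_eq)
  then show ?thesis using assms(1) by (auto simp: upath_def successively_conv_nth)
qed

lemma ucycle_rotate:
  assumes "ucycle H (vs @ ws)" "vs \<noteq> []" "ws \<noteq> []"
  shows "ucycle H (ws @ vs)"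
  using assms by (auto simp: ucycle_def upath_append)

lemma ucycle_rotate_to:
  assumes "ucycle H vs" "x \<in> set vs"
  obtains ws where "ucycle H (x # ws)" "set (x # ws) = set vs" "length (x # ws) = length vs"
proof -
  obtain as bs where vs: "vs = as @ x # bs" using split_list[OF assms(2)] by blast
  have "ucycle H (x # bs @ as)"
    using ucycle_rotate[of H as "x # bs"] assms(1) by (cases "as = []") (auto simp: vs)
  then show ?thesis by (rule that) (auto simp: vs)
qed

lemma ucycle_insert_rotate_closing:
  assumes "ucycle (insert e H) vs" "\<not> ucycle H vs"
  obtains ws where "ucycle (insert e H) ws" "length ws = length vs" "{hd ws, last ws} = e"
proof (cases "{last vs, hd vs} = e")
  case True
  then show ?thesis using that[OF assms(1)] by (simp add: insert_commute)
next
  case False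
  then have "{last vs, hd vs} \<in> H" using assms(1) by (simp add: ucycle_def)
  then obtain i where i: "Suc i < length vs" "{vs ! i, vs ! Suc i} = e"
    using assms by (auto simp: ucycle_def upath_def successively_conv_nth)
  have "vs \<noteq> []" using i(1) by auto
  define ws where "ws = drop (Suc i) vs @ take (Suc i) vs"
  have "hd ws = vs ! Suc i" "last ws = vs ! i"
    using i(1) by (simp_all add: ws_def hd_drop_conv_nth take_Suc_conv_app_nth)
  moreover have "ucycle (insert e H) ws"
    using ucycle_rotate[of "insert e H" "take (Suc i) vs" "drop (Suc i) vs"] assms(1) i(1) \<open>vs \<noteq> []\<close>
    by (auto simp: ws_def)
  moreover have "length ws = length vs" using i(1) by (simp add: ws_def)
  ultimately show ?thesis
    using that[of ws] i(2) by (simp add: insert_commute)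
qed

lemma has_cycle_iff_ucycle:
  assumes "0 < m"
  shows "has_cycle m H \<longleftrightarrow> (\<exists>vs. length vs = m \<and> ucycle H vs)"
proof -
  have "i < m \<longleftrightarrow> Suc i < m \<or> i = m - 1" for i using assms by linarith
  then have split: "(\<forall>i<m. P i) \<longleftrightarrow> (\<forall>i. Suc i < m \<longrightarrow> P i) \<and> P (m - 1)" for P by metis
  have "(\<forall>i<m. {vs ! i, vs ! ((i + 1) mod m)} \<in> H) \<longleftrightarrow>
      successively (\<lambda>a b. {a, b} \<in> H) vs \<and> {last vs, hd vs} \<in> H" if "length vs = m" for vs
  proof -
    have "vs \<noteq> []" using that assms by auto
    then show ?thesis
      unfolding split using that assms by (simp add: successively_conv_nth hd_conv_nth last_conv_nth)
  qed
  then show ?thesis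
    using assms by (auto simp: has_cycle_def ucycle_def upath_def)
qed

theorem has_cycle_insert_iff:
  assumes "3 \<le> m"
  shows "has_cycle m (insert {u, v} H) \<longleftrightarrow> has_cycle m H \<or> joined m H u v"
proof
  assume "has_cycle m (insert {u, v} H)"
  then obtain vs where vs: "length vs = m" "ucycle (insert {u, v} H) vs"
    using assms by (auto simp: has_cycle_iff_ucycle)
  show "has_cycle m H \<or> joined m H u v"
  proof (cases "ucycle H vs")
    case True
    then show ?thesis using vs(1) assms by (auto simp: has_cycle_iff_ucycle)
  next
    case False
    then obtain ws where ws: "ucycle (insert {u, v} H) ws" "length ws = m" "{hd ws, last ws} = {u, v}"
      using ucycle_insert_rotate_closing[OF vs(2)] vs(1) by metis
    then have "upath H ws"
      using upath_insert_endpoints[of ws H] assms by (simp add: ucycle_def)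
    then have "joined m H (hd ws) (last ws)" using joinedI ws(2) by blast
    then show ?thesis using ws(3) joined_sym by (metis doubleton_eq_iff)
  qed
next
  assume "has_cycle m H \<or> joined m H u v"
  then show "has_cycle m (insert {u, v} H)"
  proof
    assume "has_cycle m H"
    then show ?thesis by (auto simp: has_cycle_def)
  next
    assume "joined m H u v"
    then obtain vs where vs: "upath H vs" "length vs = m" "hd vs = u" "last vs = v"
      by (auto simp: joined_def)
    then have "ucycle (insert {u, v} H) vs"
      using upath_mono[OF vs(1)] by (auto simp: ucycle_def insert_commute)
    then show ?thesis using vs(2) assms by (auto simp: has_cycle_iff_ucycle)
  qed
qed

definition unjoined :: "nat \<Rightarrow> 'a set \<Rightarrow> 'a set set \<Rightarrow> 'a set set" where
  "unjoined m V H = {e \<in> [V]\<^bsup>2\<^esup>. e \<notin> H \<and> (\<forall>u v. e = {u, v} \<longrightarrow> \<not> joined m H u v)}"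

lemma doubleton_in_unjoined [simp]:
  "{u, v} \<in> unjoined m V H \<longleftrightarrow> u \<in> V \<and> v \<in> V \<and> u \<noteq> v \<and> {u, v} \<notin> H \<and> \<not> joined m H u v"
  unfolding unjoined_def using joined_sym[of m H u v] by (auto simp: doubleton_eq_iff)

lemma unjoined_subset: "unjoined m V H \<subseteq> [V]\<^bsup>2\<^esup>"
  by (auto simp: unjoined_def)

lemma finite_nbrs_unjoined: "finite V \<Longrightarrow> finite (nbrs (unjoined m V H) v)"
  using finite_subset[OF nbrs_subset[OF unjoined_subset]] .

lemma cycle_saturated_disjoint_unjoined:
  assumes "cycle_saturated m G H" "3 \<le> m"
  shows "G \<inter> unjoined m V H = {}"
proof -
  have False if e: "e \<in> G" "e \<in> unjoined m V H" for e
  proof -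
    obtain u v where uv: "e = {u, v}" using e(2) by (auto simp: unjoined_def elim!: nsets2_E)
    then have "has_cycle m (insert {u, v} H)" "\<not> has_cycle m H"
      using e assms(1) by (auto simp: cycle_saturated_def uv)
    then show False using e(2) has_cycle_insert_iff[OF assms(2)] by (auto simp: uv)
  qed
  then show ?thesis by blast
qed

section \<open>Trees hanging off a core\<close>

locale pendant_trees =
  fixes H :: "'a set set" and C A :: "'a set" and par :: "'a \<Rightarrow> 'a"
  assumes core_subset: "A \<subseteq> C"
    and par_closed: "v \<in> C - A \<Longrightarrow> par v \<in> C"
    and par_edge: "v \<in> C - A \<Longrightarrow> {v, par v} \<in> H"
    and tree_neighbour: "v \<in> C - A \<Longrightarrow> {v, w} \<in> H \<Longrightarrow> w = par v \<or> w \<in> C - A \<and> par w = v"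
    and reaches_core: "v \<in> C \<Longrightarrow> \<exists>i. (par ^^ i) v \<in> A"
begin

definition height :: "'a \<Rightarrow> nat" where
  "height v = (LEAST i. (par ^^ i) v \<in> A)"

definition root :: "'a \<Rightarrow> 'a" where
  "root v = (par ^^ height v) v"

lemma height_core: "v \<in> A \<Longrightarrow> height v = 0"
  unfolding height_def by (intro Least_equality) auto

lemma root_core: "v \<in> A \<Longrightarrow> root v = v"
  by (simp add: root_def height_core)

lemma root_in_core: "v \<in> C \<Longrightarrow> root v \<in> A"
  unfolding root_def height_def by (rule LeastI_ex[OF reaches_core])

lemma height_tree:
  assumes "v \<in> C - A"
  shows "height v = Suc (height (par v))"
proof -
  have "height v = Suc (LEAST i. (par ^^ Suc i) v \<in> A)"
    unfolding height_def
    by (rule Least_Suc[of _ "height v"]) (use assms root_in_core in \<open>auto simp: root_def\<close>)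
  then show ?thesis by (simp add: height_def funpow_swap1)
qed

lemma root_tree: "v \<in> C - A \<Longrightarrow> root v = root (par v)"
  by (simp add: root_def height_tree funpow_swap1)

lemma upath_descending:
  assumes "upath H (u # w # ws)" "w \<in> C - A" "par w = u"
  shows "height (last (w # ws)) = height u + length (w # ws) \<and> root (last (w # ws)) = root u"
  using assms
proof (induction ws arbitrary: u w)
  case Nil
  then show ?case by (simp add: height_tree root_tree)
next
  case (Cons x ws)
  have "{w, x} \<in> H" "x \<noteq> par w" using Cons.prems by (auto simp: upath_Cons)
  then have "x \<in> C - A" "par x = w" using tree_neighbour[OF Cons.prems(2)] by auto
  moreover have "upath H (w # x # ws)" using Cons.prems(1) by (simp add: upath_Cons)
  ultimately have "height (last (x # ws)) = height w + length (x # ws) \<and> root (last (x # ws)) = root w"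
    by (intro Cons.IH)
  then show ?case using Cons.prems by (simp add: height_tree root_tree)
qed

lemma upath_first_step:
  assumes "upath H (u # w # ws)" "u \<in> C - A"
  shows "w = par u \<or> height (last (w # ws)) = height u + length (w # ws) \<and> root (last (w # ws)) = root u"
proof -
  have "{u, w} \<in> H" using assms(1) by (simp add: upath_Cons)
  then show ?thesis using tree_neighbour[OF assms(2)] upath_descending[OF assms(1)] by blast
qed

lemma joined_Suc_Suc_cases:
  assumes "joined (Suc (Suc k)) H u v" "u \<in> C - A"
  shows "joined (Suc k) H (par u) v \<or> height v = height u + Suc k \<and> root v = root u"
proof -
  obtain w ws where ws: "upath H (u # w # ws)" "length ws = k" "last (w # ws) = v"
    using assms(1) by (auto simp: joined_def length_Suc_conv)
  have "joined (Suc k) H w v"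
    using joinedI[of H "w # ws"] ws by (simp add: upath_Cons)
  then show ?thesis using upath_first_step[OF ws(1) assms(2)] ws by auto
qed

theorem joined_heights:
  assumes "joined (Suc k) H u v" "u \<in> C" "v \<in> C"
  shows "if root u = root v then k \<le> height u + height v \<and> even (height u + height v + k)
         else height u + height v < k" (is "?claim k u v")
  using assms
proof (induction k arbitrary: u v)
  case 0
  then have "u = v" by (auto simp: joined_def length_Suc_conv)
  then show ?case by simp
next
  case (Suc k)
  have step: "?claim (Suc k) u v" if joined: "joined (Suc (Suc k)) H u v" and u: "u \<in> C - A" and v: "v \<in> C" for u v
    using joined_Suc_Suc_cases[OF joined u]
  proof
    assume "joined (Suc k) H (par u) v"
    then show ?thesis
      using Suc.IH[of "par u" v] u v par_closed[OF u] by (auto simp: height_tree root_tree split: if_splits)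
  qed auto
  show ?case
  proof (cases "u \<in> A \<and> v \<in> A")
    case True
    then show ?thesis using joined_neq[OF Suc.prems(1)] by (simp add: height_core root_core)
  next
    case False
    then show ?thesis
      using step[of u v] step[of v u] Suc.prems joined_sym[of "Suc (Suc k)" H u v]
      by (auto simp: add.commute eq_commute[of "root u"])
  qed
qed

lemma upath_between_siblings_first_step:
  assumes "upath H (u # ws @ [v])" "ws \<noteq> []" "u \<in> C - A" "height v = height u"
  shows "hd ws = par u"
proof -
  obtain w ws' where ws: "ws = w # ws'" using assms(2) by (cases ws) auto
  show ?thesis using upath_first_step[of u w "ws' @ [v]"] assms by (auto simp: ws)
qed

lemma not_joined_siblings:
  assumes "u \<in> C - A" "v \<in> C - A" "par u = par v" "3 < m"
  shows "\<not> joined m H u v"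
proof
  assume "joined m H u v"
  then obtain vs where vs: "upath H vs" "length vs = m" "hd vs = u" "last vs = v"
    by (auto simp: joined_def)
  define ws where "ws = butlast (tl vs)"
  have vs_eq: "vs = u # ws @ [v]" and len: "2 \<le> length ws"
    using vs assms(4) by (cases vs; auto simp: ws_def)+
  then have "ws \<noteq> []" "upath H (u # ws @ [v])" "upath H (v # rev ws @ [u])"
    using vs(1) upath_rev[of H vs] by auto
  moreover have "height v = height u"
    using assms by (simp add: height_tree)
  ultimately have "hd ws = par u" "hd (rev ws) = par v"
    using assms(1,2) by (metis rev_is_Nil_conv upath_between_siblings_first_step)+
  then have "hd ws = last ws" using assms(3) by (simp add: hd_rev)
  moreover have "distinct ws" using vs(1) by (simp add: vs_eq upath_def)
  ultimately show False
    using len last_in_set[of "tl ws"] by (cases ws) (auto split: if_splits)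
qed

lemma not_adjacent_siblings:
  assumes "u \<in> C - A" "v \<in> C - A" "par u = par v"
  shows "{u, v} \<notin> H"
proof
  assume "{u, v} \<in> H"
  then have "v = par u \<or> par v = u" using tree_neighbour[OF assms(1)] by blast
  moreover have "height u = Suc (height (par u))" "height v = Suc (height (par v))"
    using assms by (simp_all add: height_tree)
  ultimately show False using assms(3) by (metis n_not_Suc_n)
qed

end

section \<open>Breadth-first trees\<close>

fun bfs_level :: "'a set set \<Rightarrow> 'a \<Rightarrow> nat \<Rightarrow> 'a set" where
  "bfs_level H r 0 = {r}"
| "bfs_level H r (Suc i) = {v. \<exists>u\<in>bfs_level H r i. {u, v} \<in> H}"

lemma upath_imp_bfs_level: "upath H vs \<Longrightarrow> last vs \<in> bfs_level H (hd vs) (length vs - 1)"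
proof (induction vs rule: rev_induct)
  case (snoc v vs)
  show ?case
  proof (cases "vs = []")
    case False
    then have "last vs \<in> bfs_level H (hd vs) (length vs - 1)" "{last vs, v} \<in> H"
      using snoc by (auto simp: upath_append)
    then show ?thesis using False by (cases "length vs") auto
  qed simp
qed (simp add: upath_def)

context
  fixes H :: "'a set set" and r :: 'a
begin

definition component :: "'a set" where
  "component = (\<Union>i. bfs_level H r i)"

definition depth :: "'a \<Rightarrow> nat" where
  "depth v = (LEAST i. v \<in> bfs_level H r i)"

definition bfs_parent :: "'a \<Rightarrow> 'a" where
  "bfs_parent v = (SOME u. u \<in> component \<and> depth v = Suc (depth u) \<and> {u, v} \<in> H)"

definition bfs_edges :: "'a set set" where
  "bfs_edges = (\<lambda>v. {bfs_parent v, v}) ` (component - {r})"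

definition surplus_vertices :: "'a set" where
  "surplus_vertices = component \<inter> \<Union>(H - bfs_edges)"

definition bfs_core :: "'a set" where
  "bfs_core = {(bfs_parent ^^ i) v |v i. v \<in> insert r surplus_vertices \<and> i \<le> depth v}"

lemma bfs_level_subset_component: "bfs_level H r i \<subseteq> component"
  by (auto simp: component_def)

lemma root_in_component: "r \<in> component"
  using bfs_level_subset_component[of 0] by simp

lemma component_closed: "v \<in> component \<Longrightarrow> {v, w} \<in> H \<Longrightarrow> w \<in> component"
  unfolding component_def using bfs_level.simps(2)[of H r] by blast

lemma component_subset:
  assumes "H \<subseteq> [V]\<^bsup>2\<^esup>" "r \<in> V"
  shows "component \<subseteq> V"
proof -
  have "bfs_level H r i \<subseteq> V" for i
    using assms by (cases i) auto
  then show ?thesis by (auto simp: component_def)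
qed

lemma depth_le: "v \<in> bfs_level H r i \<Longrightarrow> depth v \<le> i"
  unfolding depth_def by (rule Least_le)

lemma mem_bfs_level_depth: "v \<in> component \<Longrightarrow> v \<in> bfs_level H r (depth v)"
  unfolding component_def depth_def by (auto intro: LeastI)

lemma depth_eq_0_iff: "v \<in> component \<Longrightarrow> depth v = 0 \<longleftrightarrow> v = r"
  using mem_bfs_level_depth[of v] depth_le[of r 0] by auto

lemma bfs_parent:
  assumes "v \<in> component" "v \<noteq> r"
  shows "bfs_parent v \<in> component" "depth v = Suc (depth (bfs_parent v))" "{bfs_parent v, v} \<in> H"
proof -
  obtain i where i: "depth v = Suc i" using depth_eq_0_iff assms by (metis not0_implies_Suc)
  then obtain u where u: "u \<in> bfs_level H r i" "{u, v} \<in> H" using mem_bfs_level_depth[OF assms(1)] by auto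
  have uC: "u \<in> component" using u(1) bfs_level_subset_component by blast
  have "v \<in> bfs_level H r (Suc (depth u))" using mem_bfs_level_depth[OF uC] u by auto
  then have "depth v \<le> Suc (depth u)" by (rule depth_le)
  then have "depth v = Suc (depth u)" using depth_le[OF u(1)] i by simp
  then have "\<exists>u. u \<in> component \<and> depth v = Suc (depth u) \<and> {u, v} \<in> H" using uC u(2) by blast
  from someI_ex[OF this]
  show "bfs_parent v \<in> component" "depth v = Suc (depth (bfs_parent v))" "{bfs_parent v, v} \<in> H"
    unfolding bfs_parent_def by auto
qed

lemma bfs_ancestor:
  assumes "v \<in> component" "i \<le> depth v"
  shows "(bfs_parent ^^ i) v \<in> component \<and> depth ((bfs_parent ^^ i) v) = depth v - i"
  using assms(2)
proof (induction i)
  case (Suc i)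
  then have ancestor: "(bfs_parent ^^ i) v \<in> component" "depth ((bfs_parent ^^ i) v) = depth v - i" by auto
  then have "(bfs_parent ^^ i) v \<noteq> r" using Suc.prems depth_eq_0_iff[OF ancestor(1)] by auto
  then show ?case using bfs_parent[OF ancestor(1)] ancestor(2) by auto
qed (use assms in auto)

lemma bfs_edges_subset: "bfs_edges \<subseteq> H"
  using bfs_parent(3) by (auto simp: bfs_edges_def)

lemma card_bfs_edges:
  assumes "finite component"
  shows "card component = card bfs_edges + 1"
proof -
  have "inj_on (\<lambda>v. {bfs_parent v, v}) (component - {r})"
  proof (rule inj_onI, rule ccontr)
    fix v w assume vw: "v \<in> component - {r}" "w \<in> component - {r}" "{bfs_parent v, v} = {bfs_parent w, w}" "v \<noteq> w"
    then have "v = bfs_parent w" "w = bfs_parent v" by (auto simp: doubleton_eq_iff)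
    then show False using bfs_parent(2)[of v] bfs_parent(2)[of w] vw by auto
  qed
  then have "card bfs_edges = card (component - {r})"
    by (simp add: bfs_edges_def card_image)
  then show ?thesis
    using card.remove[OF assms root_in_component] by simp
qed

lemma insert_surplus_subset_core: "insert r surplus_vertices \<subseteq> bfs_core"
proof
  fix v assume "v \<in> insert r surplus_vertices"
  then show "v \<in> bfs_core" unfolding bfs_core_def by (intro CollectI exI[of _ v] exI[of _ 0]) auto
qed

lemma insert_surplus_subset_component: "insert r surplus_vertices \<subseteq> component"
  using root_in_component by (auto simp: surplus_vertices_def)

lemma bfs_core_subset: "bfs_core \<subseteq> component"
  using bfs_ancestor insert_surplus_subset_component unfolding bfs_core_def by blast

lemma bfs_core_closed:
  assumes "v \<in> bfs_core" "v \<noteq> r"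
  shows "bfs_parent v \<in> bfs_core"
proof -
  obtain x i where x: "x \<in> insert r surplus_vertices" "i \<le> depth x" "v = (bfs_parent ^^ i) x"
    using assms(1) by (auto simp: bfs_core_def)
  then have "v \<in> component" "depth v = depth x - i"
    using bfs_ancestor[of x i] insert_surplus_subset_component by auto
  then have "Suc i \<le> depth x" using depth_eq_0_iff[of v] assms(2) x(2) by auto
  moreover have "bfs_parent v = (bfs_parent ^^ Suc i) x" by (simp add: x(3))
  ultimately show ?thesis unfolding bfs_core_def using x(1) by blast
qed

lemma pendant_trees_bfs: "pendant_trees H component bfs_core bfs_parent"
proof
  show "bfs_core \<subseteq> component" by (rule bfs_core_subset)
next
  fix v assume v: "v \<in> component - bfs_core"
  then have "v \<noteq> r" using insert_surplus_subset_core by auto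
  then show "bfs_parent v \<in> component" "{v, bfs_parent v} \<in> H"
    using bfs_parent[of v] v by (auto simp: insert_commute)
next
  fix v assume "v \<in> component"
  then have "(bfs_parent ^^ depth v) v = r"
    using bfs_ancestor[of v "depth v"] depth_eq_0_iff by auto
  then show "\<exists>i. (bfs_parent ^^ i) v \<in> bfs_core" using insert_surplus_subset_core by (metis insert_subset)
next
  fix v w assume v: "v \<in> component - bfs_core" "{v, w} \<in> H"
  have w: "w \<in> component" using component_closed v by blast
  have "{v, w} \<in> bfs_edges"
  proof (rule ccontr)
    assume "{v, w} \<notin> bfs_edges"
    then have "v \<in> surplus_vertices" using v by (auto simp: surplus_vertices_def)
    then show False using v insert_surplus_subset_core by auto
  qed
  then obtain z where z: "z \<in> component" "z \<noteq> r" "{v, w} = {bfs_parent z, z}" by (auto simp: bfs_edges_def)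
  then consider (parent) "z = v" "w = bfs_parent v" | (child) "z = w" "v = bfs_parent w" by (auto simp: doubleton_eq_iff)
  then show "w = bfs_parent v \<or> w \<in> component - bfs_core \<and> bfs_parent w = v"
  proof cases
    case child
    then have "w \<notin> bfs_core" using bfs_core_closed[of w] z v by auto
    then show ?thesis using child w by auto
  qed auto
qed

lemma card_surplus_vertices_le:
  assumes "finite H" "\<And>e. e \<in> H \<Longrightarrow> card e = 2" "finite component"
  shows "card surplus_vertices \<le> 2 * (card H + 1 - card component)"
proof -
  have "card surplus_vertices \<le> card (\<Union>(H - bfs_edges))"
    using assms(1,2) unfolding surplus_vertices_def
    by (intro card_mono finite_Union) (auto intro: card_ge_0_finite)
  also have "\<dots> \<le> (\<Sum>e\<in>H - bfs_edges. card e)" by (rule card_Union_le_sum_card)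
  also have "\<dots> = 2 * card (H - bfs_edges)" using assms(2) by simp
  also have "card (H - bfs_edges) = card H + 1 - card component"
    using assms(1) bfs_edges_subset card_bfs_edges[OF assms(3)]
    by (simp add: card_Diff_subset finite_subset)
  finally show ?thesis .
qed

lemma bfs_core_subset_near_or_far:
  "bfs_core \<subseteq> {r} \<union> {v \<in> component. m \<le> depth v} \<union>
    (\<lambda>(x, d). (bfs_parent ^^ (depth x - d)) x) ` (surplus_vertices \<times> {1..<m})"
proof
  fix a assume "a \<in> bfs_core"
  then obtain x i where x: "x \<in> insert r surplus_vertices" "i \<le> depth x" "a = (bfs_parent ^^ i) x"
    by (auto simp: bfs_core_def)
  then have a: "a \<in> component" "depth a = depth x - i"
    using bfs_ancestor[of x i] insert_surplus_subset_component by auto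
  consider (root) "depth a = 0" | (far) "m \<le> depth a" | (near) "1 \<le> depth a" "depth a < m" by linarith
  then show "a \<in> {r} \<union> {v \<in> component. m \<le> depth v} \<union>
    (\<lambda>(x, d). (bfs_parent ^^ (depth x - d)) x) ` (surplus_vertices \<times> {1..<m})"
  proof cases
    case near
    then have "x \<in> surplus_vertices" using x(1) a(2) depth_eq_0_iff[OF root_in_component] by auto
    moreover have "i = depth x - depth a" using a(2) x(2) by simp
    ultimately have "a \<in> (\<lambda>(x, d). (bfs_parent ^^ (depth x - d)) x) ` (surplus_vertices \<times> {1..<m})"
      using near x(3) by (intro image_eqI[of _ _ "(x, depth a)"]) auto
    then show ?thesis by blast
  qed (use a(1) depth_eq_0_iff in auto)
qed

lemma card_bfs_core_le:
  assumes "finite H" "\<And>e. e \<in> H \<Longrightarrow> card e = 2" "finite component"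
  shows "card bfs_core \<le> 1 + card {v \<in> component. m \<le> depth v} + 2 * (m - 1) * (card H + 1 - card component)"
proof -
  let ?near = "(\<lambda>(x, d). (bfs_parent ^^ (depth x - d)) x) ` (surplus_vertices \<times> {1..<m})"
  have fin: "finite surplus_vertices" using assms(3) by (simp add: surplus_vertices_def)
  have "card bfs_core \<le> card ({r} \<union> {v \<in> component. m \<le> depth v} \<union> ?near)"
    using fin assms(3) by (intro card_mono bfs_core_subset_near_or_far) auto
  also have "\<dots> \<le> card {r} + card {v \<in> component. m \<le> depth v} + card ?near"
    by (intro order_trans[OF card_Un_le] add_mono order_refl)
  also have "card ?near \<le> card (surplus_vertices \<times> {1..<m})"
    using fin by (intro card_image_le) auto
  also have "\<dots> \<le> 2 * (card H + 1 - card component) * (m - 1)"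
    using card_surplus_vertices_le[OF assms] by (simp add: card_cartesian_product)
  finally show ?thesis by (simp add: mult.commute mult.left_commute)
qed

lemma depth_less_of_not_unjoined:
  assumes "2 \<le> m" "r \<in> V" "v \<in> V" "{r, v} \<notin> unjoined m V H"
  shows "v \<in> component \<and> depth v < m"
proof -
  have "\<exists>i<m. v \<in> bfs_level H r i"
  proof -
    consider (root) "v = r" | (adjacent) "{r, v} \<in> H" | (joined) "joined m H r v" using assms(2-4) by auto
    then show ?thesis
    proof cases
      case root
      then show ?thesis using assms(1) by (intro exI[of _ 0]) auto
    next
      case adjacent
      then show ?thesis using assms(1) by (intro exI[of _ 1]) auto
    next
      case joined
      then have "v \<in> bfs_level H r (m - 1)"
        using upath_imp_bfs_level by (fastforce simp: joined_def)
      then show ?thesis using assms(1) by (intro exI[of _ "m - 1"]) auto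
    qed
  qed
  then show ?thesis using bfs_level_subset_component depth_le by (meson le_less_trans subsetD)
qed

end

section \<open>Counting unjoined pairs\<close>

lemma card_square_le_card_mult_fibres:
  assumes "finite W" "finite A" "f ` W \<subseteq> A"
  shows "(card W)\<^sup>2 \<le> card A * card {(u, v) \<in> W \<times> W. f u = f v}"
proof -
  define s where "s = (\<lambda>c. card {u \<in> W. f u = c})"
  have card_W: "card W = (\<Sum>c\<in>A. s c)"
    unfolding s_def using assms card_eq_sum sum.group[of W A f "\<lambda>_. 1 :: nat"] by simp
  have "card {(u, v) \<in> W \<times> W. f u = f v} = card (\<Union>c\<in>A. {u \<in> W. f u = c} \<times> {u \<in> W. f u = c})"
    using assms by (intro arg_cong[of _ _ card]) auto
  also have "\<dots> = (\<Sum>c\<in>A. (s c)\<^sup>2)"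
    unfolding s_def using assms
    by (subst card_UN_disjoint) (auto simp: card_cartesian_product power2_eq_square)
  finally have card_pairs: "card {(u, v) \<in> W \<times> W. f u = f v} = (\<Sum>c\<in>A. (s c)\<^sup>2)" .
  have "(\<Sum>c\<in>A. 1 * real (s c))\<^sup>2 \<le> (\<Sum>c\<in>A. 1\<^sup>2) * (\<Sum>c\<in>A. (real (s c))\<^sup>2)"
    by (rule Cauchy_Schwarz_ineq_sum)
  then have "real ((card W)\<^sup>2) \<le> real (card A * card {(u, v) \<in> W \<times> W. f u = f v})"
    unfolding card_W card_pairs by simp
  then show ?thesis by (simp only: of_nat_le_iff)
qed

lemma card_Sigma_nbrs:
  assumes "finite V" "F \<subseteq> [V]\<^bsup>2\<^esup>"
  shows "card (SIGMA v:V. nbrs F v) = 2 * card F"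
proof -
  have "finite (nbrs F v)" for v
    using finite_subset[OF nbrs_subset[OF assms(2)] assms(1)] .
  then show ?thesis
    using assms(1) sum_card_nbrs[OF assms] by (subst card_SigmaI) auto
qed

locale pendant_trees_in = pendant_trees H C A par
  for H :: "'a set set" and C A :: "'a set" and par :: "'a \<Rightarrow> 'a" +
  fixes V :: "'a set" and m :: nat
  assumes finite_V: "finite V" and graph: "H \<subseteq> [V]\<^bsup>2\<^esup>" and C_subset: "C \<subseteq> V" and m: "4 < m"
begin

definition shallow :: "'a set" where
  "shallow = {v \<in> C. 2 * height v < m - 1}"

definition deep :: "'a set" where
  "deep = {v \<in> C. m - 1 \<le> 2 * height v}"

abbreviation U :: "'a set set" where
  "U \<equiv> unjoined m V H"

lemma finite_C: "finite C"
  using C_subset finite_V finite_subset by blast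

lemma finite_A: "finite A"
  using core_subset finite_C finite_subset by blast

lemma deep_subset: "deep \<subseteq> V"
  using C_subset by (auto simp: deep_def)

lemma finite_deep: "finite deep"
  using finite_subset[OF deep_subset finite_V] .

lemma deepD: "v \<in> deep \<Longrightarrow> v \<in> C - A"
  using height_core m by (fastforce simp: deep_def)

lemma finite_nbrs_H: "finite (nbrs H v)"
  using finite_subset[OF nbrs_subset[OF graph] finite_V] .

lemma joined_heights_m:
  assumes "joined m H u v" "u \<in> C" "v \<in> C"
  shows "if root u = root v then m - 1 \<le> height u + height v \<and> even (height u + height v + (m - 1))
         else height u + height v < m - 1"
  using joined_heights[of "m - 1" u v] assms m by simp

lemma shallow_same_root:
  assumes "u \<in> shallow" "v \<in> shallow" "root u = root v"
  shows "u = v \<or> v = par u \<or> u = par v \<or> {u, v} \<in> U"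
proof -
  have C: "u \<in> C" "v \<in> C" using assms by (auto simp: shallow_def)
  have "\<not> joined m H u v"
    using joined_heights_m[of u v] assms by (auto simp: shallow_def)
  moreover have "u = v \<or> v = par u \<or> u = par v" if "{u, v} \<in> H"
  proof (cases "u \<in> A \<and> v \<in> A")
    case True
    then show ?thesis using root_core assms(3) by metis
  next
    case False
    then show ?thesis
      using tree_neighbour[of u v] tree_neighbour[of v u] C that by (auto simp: insert_commute)
  qed
  ultimately show ?thesis using C C_subset doubleton_in_unjoined[of u v m V H] by blast
qed

lemma card_shallow: "(card shallow)\<^sup>2 \<le> card A * (2 * card U + 3 * card V)"
proof -
  let ?U = "SIGMA u:V. nbrs U u"
  have finU: "finite ?U" using finite_V by (simp add: finite_nbrs_unjoined)
  let ?S = "?U \<union> (\<lambda>u. (u, u)) ` V \<union> (\<lambda>u. (u, par u)) ` V \<union> (\<lambda>u. (par u, u)) ` V"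
  have "(u, v) \<in> ?S" if "u \<in> shallow" "v \<in> shallow" "root u = root v" for u v
  proof -
    have "u \<in> V" "v \<in> V" using that C_subset by (auto simp: shallow_def)
    then show ?thesis using shallow_same_root[OF that] by auto
  qed
  then have sub: "{(u, v) \<in> shallow \<times> shallow. root u = root v} \<subseteq> ?S"
    by (intro subsetI) (clarify, blast)
  have "(card shallow)\<^sup>2 \<le> card A * card {(u, v) \<in> shallow \<times> shallow. root u = root v}"
    using finite_A finite_C root_in_core
    by (intro card_square_le_card_mult_fibres) (auto simp: shallow_def)
  also have "card {(u, v) \<in> shallow \<times> shallow. root u = root v} \<le> card ?S"
    using finU finite_V sub by (intro card_mono) auto
  also have "\<dots> \<le> 2 * card U + card V + card V + card V"
    unfolding card_Sigma_nbrs[OF finite_V unjoined_subset, symmetric] using finite_V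
    by (intro order_trans[OF card_Un_le] add_mono card_image_le order_refl)
  finally show ?thesis by (simp add: algebra_simps)
qed

text \<open>
  A vertex \<open>v\<close> of \<open>deep\<close> can be joined to other vertices of \<open>deep\<close> only inside its own tree, where the
  parity of the heights prevents its parent from being joined to any of them.
\<close>

lemma deep_subset_nbrs:
  assumes "v \<in> deep"
  shows "deep \<subseteq> nbrs U v \<union> nbrs H v \<union> {v, par (par v)} \<union> nbrs U (par v)"
proof
  fix x assume x: "x \<in> deep"
  note vC = deepD[OF assms] and xC = deepD[OF x]
  have par_v: "par v \<in> C" "root (par v) = root v" "height v = Suc (height (par v))"
    using par_closed root_tree height_tree vC by auto
  have V: "v \<in> V" "x \<in> V" "par v \<in> V" using vC xC par_v(1) C_subset by auto
  show "x \<in> nbrs U v \<union> nbrs H v \<union> {v, par (par v)} \<union> nbrs U (par v)"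
  proof (rule ccontr)
    assume "\<not> ?thesis"
    then have far: "{v, x} \<notin> U" "{v, x} \<notin> H" "x \<noteq> v" "x \<noteq> par (par v)" "{par v, x} \<notin> U" by auto
    then have joined: "joined m H v x" using V by auto
    have "m - 1 \<le> height v + height x" using assms x by (auto simp: deep_def)
    then have same_tree: "root v = root x" "even (height v + height x + (m - 1))"
      using joined_heights_m[OF joined] vC xC by (auto split: if_splits)
    have "\<not> joined m H (par v) x"
    proof
      assume "joined m H (par v) x"
      then have "even (height (par v) + height x + (m - 1))"
        using joined_heights_m[of "par v" x] par_v xC same_tree(1) by auto
      then show False using same_tree(2) par_v(3) by simp
    qed
    moreover have "x \<noteq> par v" using par_edge vC far(2) by auto
    moreover have "{par v, x} \<notin> H"
    proof
      assume "{par v, x} \<in> H"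
      then have "par v = par x"
        using tree_neighbour[OF xC, of "par v"] far(4) by (auto simp: insert_commute)
      then show False using not_joined_siblings[OF vC xC] joined m by auto
    qed
    ultimately show False using far(5) V by auto
  qed
qed

lemma siblings_unjoined:
  assumes "u \<in> C - A" "v \<in> C - A" "par u = par v" "u \<noteq> v"
  shows "{u, v} \<in> U"
  using not_joined_siblings[OF assms(1-3)] not_adjacent_siblings[OF assms(1-3)] assms C_subset m
  by auto

definition lonely :: "'a set" where
  "lonely = {v \<in> deep. 4 * (card (nbrs U v) + card (nbrs H v)) \<le> card deep}"

lemma lonely_subset: "lonely \<subseteq> deep"
  by (auto simp: lonely_def)

lemma finite_lonely: "finite lonely"
  using finite_subset[OF lonely_subset finite_deep] .

lemma card_deep_minus_lonely: "card (deep - lonely) * card deep \<le> 8 * (card U + card H)"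
proof -
  have "card (deep - lonely) * card deep \<le> (\<Sum>v\<in>deep - lonely. 4 * (card (nbrs U v) + card (nbrs H v)))"
    by (rule sum_bounded_below[of _ "card deep", simplified]) (auto simp: lonely_def)
  also have "\<dots> \<le> (\<Sum>v\<in>V. 4 * (card (nbrs U v) + card (nbrs H v)))"
    using finite_V deep_subset by (intro sum_mono2) auto
  also have "\<dots> = 4 * (2 * card U + 2 * card H)"
    using sum_card_nbrs[OF finite_V unjoined_subset, of m H] sum_card_nbrs[OF finite_V graph]
    by (simp add: sum.distrib flip: sum_distrib_left)
  finally show ?thesis by simp
qed

lemma card_deep_le_nbrs_parent:
  assumes "v \<in> lonely" "8 \<le> card deep"
  shows "card deep \<le> 2 * card (nbrs U (par v))"
proof -
  have v: "v \<in> deep" "4 * (card (nbrs U v) + card (nbrs H v)) \<le> card deep"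
    using assms(1) by (auto simp: lonely_def)
  have "card deep \<le> card (nbrs U v \<union> nbrs H v \<union> {v, par (par v)} \<union> nbrs U (par v))"
    using finite_nbrs_H finite_nbrs_unjoined[OF finite_V]
    by (intro card_mono deep_subset_nbrs[OF v(1)]) auto
  also have "\<dots> \<le> card (nbrs U v) + card (nbrs H v) + card {v, par (par v)} + card (nbrs U (par v))"
    by (intro order_trans[OF card_Un_le] add_mono order_refl)
  finally have "card deep \<le> card (nbrs U v) + card (nbrs H v) + card {v, par (par v)} + card (nbrs U (par v))" .
  moreover have "card {v, par (par v)} \<le> 2" by (simp add: card_insert_if)
  ultimately have "card deep \<le> (card (nbrs U v) + card (nbrs H v)) + 2 + card (nbrs U (par v))" by linarith
  then show ?thesis using v(2) assms(2) by arith
qed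

lemma card_parents_lonely:
  assumes "8 \<le> card deep"
  shows "card (par ` lonely) * card deep \<le> 4 * card U"
proof -
  have "par v \<in> V" if "v \<in> lonely" for v
    using that par_closed[OF deepD, of v] lonely_subset C_subset by auto
  then have parents_V: "par ` lonely \<subseteq> V" by auto
  have "card (par ` lonely) * card deep \<le> (\<Sum>q\<in>par ` lonely. 2 * card (nbrs U q))"
    by (rule sum_bounded_below[of _ "card deep", simplified]) (use card_deep_le_nbrs_parent assms in auto)
  also have "\<dots> \<le> (\<Sum>q\<in>V. 2 * card (nbrs U q))"
    using finite_V parents_V by (intro sum_mono2) auto
  also have "\<dots> = 2 * (2 * card U)"
    using sum_card_nbrs[OF finite_V unjoined_subset, of m H] by (simp flip: sum_distrib_left)
  finally show ?thesis by simp
qed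

lemma card_lonely: "(card lonely)\<^sup>2 \<le> card (par ` lonely) * (2 * card U + card V)"
proof -
  let ?U = "SIGMA u:V. nbrs U u"
  have finU: "finite ?U" using finite_V by (simp add: finite_nbrs_unjoined)
  have "(u, v) \<in> ?U \<union> (\<lambda>u. (u, u)) ` V" if "u \<in> lonely" "v \<in> lonely" "par u = par v" for u v
  proof -
    have "u \<in> C - A" "v \<in> C - A" using that deepD lonely_subset by auto
    then show ?thesis using siblings_unjoined[of u v] that(3) C_subset by (cases "u = v") auto
  qed
  then have "{(u, v) \<in> lonely \<times> lonely. par u = par v} \<subseteq> ?U \<union> (\<lambda>u. (u, u)) ` V"
    by (intro subsetI) (clarify, blast)
  then have "card {(u, v) \<in> lonely \<times> lonely. par u = par v} \<le> card (?U \<union> (\<lambda>u. (u, u)) ` V)"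
    using finU finite_V by (intro card_mono) auto
  also have "\<dots> \<le> 2 * card U + card V"
    unfolding card_Sigma_nbrs[OF finite_V unjoined_subset, symmetric] using finite_V
    by (intro order_trans[OF card_Un_le] add_mono card_image_le order_refl)
  finally have siblings: "card {(u, v) \<in> lonely \<times> lonely. par u = par v} \<le> 2 * card U + card V" .
  have "(card lonely)\<^sup>2 \<le> card (par ` lonely) * card {(u, v) \<in> lonely \<times> lonely. par u = par v}"
    using finite_lonely by (intro card_square_le_card_mult_fibres) auto
  also have "\<dots> \<le> card (par ` lonely) * (2 * card U + card V)"
    using siblings by (rule mult_le_mono2)
  finally show ?thesis .
qed

lemma card_deep: "card deep ^ 3 \<le> 16 * (card U + card H + 4) * (2 * card U + card V)"
proof -
  define d u h n where "d = card deep" and "u = card U" and "h = card H" and "n = card V"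
  have d_le: "d \<le> 2 * u + n"
    using card_mono[OF finite_V deep_subset] by (simp add: d_def n_def)
  consider (few_deep) "d < 8" | (few_lonely) "8 \<le> d" "d \<le> 2 * card (deep - lonely)" | (many_lonely) "8 \<le> d" "d \<le> 2 * card lonely"
    using card_Diff_subset[OF finite_lonely lonely_subset] card_mono[OF finite_deep lonely_subset]
    unfolding d_def by linarith
  then have "d ^ 3 \<le> 16 * (u + h + 4) * (2 * u + n)"
  proof cases
    case few_deep
    then have "d * d \<le> 8 * 8" by (intro mult_le_mono) auto
    then have "d * d \<le> 16 * (u + h + 4)" by simp
    then have "d * d * d \<le> 16 * (u + h + 4) * (2 * u + n)"
      using d_le by (rule mult_le_mono)
    then show ?thesis by (simp add: power3_eq_cube)
  next
    case few_lonely
    then have "d * d \<le> 2 * (card (deep - lonely) * d)" by simp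
    also have "\<dots> \<le> 16 * (u + h + 4)"
      using card_deep_minus_lonely by (simp add: d_def u_def h_def)
    finally have "d * d * d \<le> 16 * (u + h + 4) * (2 * u + n)"
      using d_le by (rule mult_le_mono)
    then show ?thesis by (simp add: power3_eq_cube)
  next
    case many_lonely
    have parents: "card (par ` lonely) * d \<le> 4 * u"
      using card_parents_lonely many_lonely(1) by (simp add: d_def u_def)
    have "d\<^sup>2 \<le> (2 * card lonely)\<^sup>2" using many_lonely(2) by (intro power_mono) auto
    also have "\<dots> \<le> 4 * card (par ` lonely) * (2 * u + n)"
      using card_lonely by (simp add: u_def n_def power_mult_distrib)
    finally have "d\<^sup>2 * d \<le> 4 * card (par ` lonely) * (2 * u + n) * d" by simp
    also have "\<dots> = 4 * (card (par ` lonely) * d) * (2 * u + n)" by simp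
    also have "\<dots> \<le> 4 * (4 * u) * (2 * u + n)"
      using parents by (intro mult_le_mono1 mult_le_mono2)
    also have "\<dots> \<le> 16 * (u + h + 4) * (2 * u + n)" by (intro mult_le_mono1) auto
    finally show ?thesis by (simp add: power3_eq_cube power2_eq_square)
  qed
  then show ?thesis by (simp add: d_def u_def h_def n_def)
qed

lemma card_C_le:
  "real (card C) \<le> sqrt (real (card A) * (2 * real (card U) + 3 * real (card V)))
    + (16 * (real (card U) + real (card H) + 4) * (2 * real (card U) + real (card V))) powr (1 / 3)"
proof -
  have "C = shallow \<union> deep" by (auto simp: shallow_def deep_def)
  then have "real (card C) \<le> real (card shallow) + real (card deep)"
    using card_Un_le[of shallow deep] by simp
  also have "real (card shallow) \<le> sqrt (real (card A) * (2 * real (card U) + 3 * real (card V)))"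
    using of_nat_mono[OF card_shallow, where 'a = real] by (intro real_le_rsqrt) simp
  also have "real (card deep) = (real (card deep) powr 3) powr (1 / 3)"
    by (subst powr_powr) simp
  also have "\<dots> \<le> (16 * (real (card U) + real (card H) + 4) * (2 * real (card U) + real (card V))) powr (1 / 3)"
    using of_nat_mono[OF card_deep, where 'a = real] by (intro powr_mono2) (auto simp: powr_numeral)
  finally show ?thesis by simp
qed

end

lemma exists_vertex_few_unjoined:
  assumes "finite V" "V \<noteq> {}" "F \<subseteq> [V]\<^bsup>2\<^esup>"
  obtains r where "r \<in> V" "card V * card (nbrs F r) \<le> 2 * card F"
proof -
  obtain r where r: "r \<in> V" "\<And>v. v \<in> V \<Longrightarrow> card (nbrs F r) \<le> card (nbrs F v)"
    using arg_min_if_finite(1)[OF assms(1,2), of "\<lambda>v. card (nbrs F v)"]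
      arg_min_least[OF assms(1,2), of _ "\<lambda>v. card (nbrs F v)"] by blast
  have "card V * card (nbrs F r) \<le> (\<Sum>v\<in>V. card (nbrs F v))"
    using r(2) by (intro sum_bounded_below[of _ "card (nbrs F r)", simplified])
  then show ?thesis using that r(1) sum_card_nbrs[OF assms(1,3)] by simp
qed

lemma
  fixes H :: "'a set set"
  assumes "finite V" "r \<in> V" "H \<subseteq> [V]\<^bsup>2\<^esup>" "2 \<le> m"
  shows card_le_card_component: "card V \<le> card (component H r) + card (nbrs (unjoined m V H) r)"
    and card_component_le: "card (component H r) \<le> card H + 1"
    and card_bfs_core_le_unjoined: "card (bfs_core H r) \<le> 1 + card (nbrs (unjoined m V H) r)
      + 2 * (m - 1) * (card H + 1 - card (component H r))"
proof -
  define N where "N = nbrs (unjoined m V H) r"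
  have finN: "finite N" unfolding N_def by (rule finite_nbrs_unjoined[OF assms(1)])
  have CV: "component H r \<subseteq> V" by (rule component_subset[OF assms(3,2)])
  have finC: "finite (component H r)" using CV assms(1) finite_subset by blast
  have finH: "finite H" using assms(1,3) finite_imp_finite_nsets finite_subset by blast
  have near: "v \<in> component H r \<and> depth H r v < m" if "v \<in> V" "v \<notin> N" for v
    using depth_less_of_not_unjoined[OF assms(4,2) that(1)] that(2) by (simp add: N_def)
  have "card V \<le> card (component H r \<union> N)"
    using near finC finN by (intro card_mono) auto
  also have "\<dots> \<le> card (component H r) + card N" by (rule card_Un_le)
  finally show "card V \<le> card (component H r) + card (nbrs (unjoined m V H) r)" by (simp add: N_def)
  show "card (component H r) \<le> card H + 1"
    using card_bfs_edges[OF finC] card_mono[OF finH bfs_edges_subset[of H r]] by simp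
  have "card {v \<in> component H r. m \<le> depth H r v} \<le> card N"
    using near CV finN by (intro card_mono) (auto simp: not_less[symmetric])
  moreover have "card e = 2" if "e \<in> H" for e using that assms(3) by (auto simp: nsets_def)
  ultimately show "card (bfs_core H r) \<le> 1 + card (nbrs (unjoined m V H) r)
      + 2 * (m - 1) * (card H + 1 - card (component H r))"
    using card_bfs_core_le[OF finH _ finC, of m] by (simp add: N_def)
qed

theorem unjoined_inequality:
  fixes V :: "'a set" and H :: "'a set set" and m :: nat
  assumes "finite V" "V \<noteq> {}" "H \<subseteq> [V]\<^bsup>2\<^esup>" "4 < m"
  defines "n \<equiv> real (card V)" and "h \<equiv> real (card H)" and "u \<equiv> real (card (unjoined m V H))"
  defines "k \<equiv> 2 * u / n"
  shows "n - k - (16 * (u + h + 4) * (2 * u + n)) powr (1 / 3)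
    \<le> sqrt ((1 + k + 2 * (real m - 1) * (h + 1 - n + k)) * (2 * u + 3 * n))"
proof -
  have n: "0 < n" using assms(1,2) by (simp add: n_def card_gt_0_iff)
  obtain r where r: "r \<in> V" "card V * card (nbrs (unjoined m V H) r) \<le> 2 * card (unjoined m V H)"
    using exists_vertex_few_unjoined[OF assms(1,2) unjoined_subset] by blast
  define C where "C = component H r"
  define A where "A = bfs_core H r"
  define N where "N = nbrs (unjoined m V H) r"
  interpret pendant_trees_in H C A "bfs_parent H r" V m
    using pendant_trees_bfs[of H r] component_subset[OF assms(3) r(1)] assms
    by (auto simp: pendant_trees_in_def pendant_trees_in_axioms_def C_def A_def)
  have "real (card V * card N) \<le> real (2 * card (unjoined m V H))"
    using r(2) unfolding N_def of_nat_le_iff .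
  then have N: "real (card N) \<le> k" using n by (simp add: k_def u_def n_def field_simps)
  have m2: "2 \<le> m" using assms(4) by simp
  note bounds = card_le_card_component[OF assms(1) r(1) assms(3) m2] card_component_le[OF assms(1) r(1) assms(3) m2]
    card_bfs_core_le_unjoined[OF assms(1) r(1) assms(3) m2]
  have C_ge: "n \<le> real (card C) + real (card N)"
    using of_nat_mono[OF bounds(1), where 'a = real] by (simp add: n_def C_def N_def)
  have "real (card A) \<le> real (1 + card N + 2 * (m - 1) * (card H + 1 - card C))"
    using of_nat_mono[OF bounds(3), where 'a = real] by (simp only: A_def C_def N_def)
  also have "\<dots> = 1 + real (card N) + 2 * (real m - 1) * (h + 1 - real (card C))"
    using bounds(2) m2 by (simp add: h_def C_def of_nat_diff)
  also have "\<dots> \<le> 1 + k + 2 * (real m - 1) * (h + 1 - n + k)"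
    using N C_ge assms(4) by (intro add_mono mult_left_mono) auto
  finally have "sqrt (real (card A) * (2 * u + 3 * n))
      \<le> sqrt ((1 + k + 2 * (real m - 1) * (h + 1 - n + k)) * (2 * u + 3 * n))"
    using n by (intro real_sqrt_le_mono mult_right_mono) (auto simp: u_def)
  then show ?thesis using card_C_le C_ge N unfolding u_def h_def n_def by linarith
qed

section \<open>With high probability\<close>

lemma all_pairs_eq_nsets: "all_pairs n = [{1..n}]\<^bsup>2\<^esup>"
proof
  show "all_pairs n \<subseteq> [{1..n}]\<^bsup>2\<^esup>" by (auto simp: all_pairs_def)
  show "[{1..n}]\<^bsup>2\<^esup> \<subseteq> all_pairs n"
  proof
    fix e assume "e \<in> [{1..n}]\<^bsup>2\<^esup>"
    then obtain i j where "e = {i, j}" "i \<in> {1..n}" "j \<in> {1..n}" "i < j"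
      unfolding ordered_nsets_2_eq by blast
    then show "e \<in> all_pairs n" unfolding all_pairs_def by (intro CollectI exI[of _ i] exI[of _ j]) auto
  qed
qed

lemma gnp_eq_random_subset: "gnp n p = random_subset ([{1..n}]\<^bsup>2\<^esup>) p"
  by (simp add: gnp_def random_subset_def all_pairs_eq_nsets)

definition whp :: "real \<Rightarrow> (nat \<Rightarrow> nat set set \<Rightarrow> bool) \<Rightarrow> bool" where
  "whp p P \<longleftrightarrow> (\<lambda>n. measure_pmf.prob (gnp n p) {G. P n G}) \<longlonglongrightarrow> 1"

lemma whp_iff_compl: "whp p P \<longleftrightarrow> (\<lambda>n. measure_pmf.prob (gnp n p) {G. \<not> P n G}) \<longlonglongrightarrow> 0"
proof -
  define x where "x = (\<lambda>n. measure_pmf.prob (gnp n p) {G. P n G})"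
  have "measure_pmf.prob (gnp n p) {G. \<not> P n G} = - (x n - 1)" for n
    using measure_pmf.prob_compl[of "{G. P n G}" "gnp n p"] by (simp add: x_def set_diff_eq)
  then show ?thesis
    using tendsto_minus_cancel_left[of "\<lambda>n. x n - 1" 0 sequentially] LIM_zero_iff[of x 1 sequentially]
    by (simp add: whp_def x_def)
qed

lemma whpI:
  assumes "\<forall>\<^sub>F n in sequentially. measure_pmf.prob (gnp n p) {G. \<not> P n G} \<le> f n" "f \<longlonglongrightarrow> 0"
  shows "whp p P"
  unfolding whp_iff_compl
  by (rule tendsto_sandwich[OF _ assms(1) tendsto_const assms(2)]) simp

lemma whp_mono:
  assumes "whp p P" "\<forall>\<^sub>F n in sequentially. \<forall>G\<subseteq>[{1..n}]\<^bsup>2\<^esup>. P n G \<longrightarrow> Q n G"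
  shows "whp p Q"
proof (rule whpI)
  show "(\<lambda>n. measure_pmf.prob (gnp n p) {G. \<not> P n G}) \<longlonglongrightarrow> 0"
    using assms(1) by (simp add: whp_iff_compl)
  show "\<forall>\<^sub>F n in sequentially. measure_pmf.prob (gnp n p) {G. \<not> Q n G} \<le> measure_pmf.prob (gnp n p) {G. \<not> P n G}"
    using assms(2)
    by eventually_elim (auto simp: gnp_eq_random_subset intro: prob_random_subset_mono)
qed

lemma whp_conj:
  assumes "whp p P" "whp p Q"
  shows "whp p (\<lambda>n G. P n G \<and> Q n G)"
proof (rule whpI)
  show "(\<lambda>n. measure_pmf.prob (gnp n p) {G. \<not> P n G} + measure_pmf.prob (gnp n p) {G. \<not> Q n G}) \<longlonglongrightarrow> 0"
    using tendsto_add[of _ 0 _ _ 0] assms by (simp add: whp_iff_compl)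
  have "{G. \<not> (P n G \<and> Q n G)} = {G. \<not> P n G} \<union> {G. \<not> Q n G}" for n by auto
  then show "\<forall>\<^sub>F n in sequentially. measure_pmf.prob (gnp n p) {G. \<not> (P n G \<and> Q n G)}
      \<le> measure_pmf.prob (gnp n p) {G. \<not> P n G} + measure_pmf.prob (gnp n p) {G. \<not> Q n G}"
    by (simp add: measure_Un_le)
qed

section \<open>Sparse saturated graphs are rare\<close>

lemma sum_power_card_Pow:
  assumes "finite E"
  shows "(\<Sum>H\<in>Pow E. x ^ card H) = (1 + x :: real) ^ card E"
proof -
  have "(1 + x) ^ card E = (\<Prod>e\<in>E. x + 1)" by (simp add: add.commute)
  also have "\<dots> = (\<Sum>H\<in>Pow E. (\<Prod>i\<in>H. x) * (\<Prod>i\<in>E - H. 1))" using assms by (rule prod_add)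
  finally show ?thesis by simp
qed

lemma card_sparse_subsets_le:
  fixes x M :: real
  assumes "finite E" "1 \<le> x"
  shows "real (card {H \<in> Pow E. real (card H) \<le> M}) \<le> x powr M * exp (real (card E) / x)"
proof -
  have "real (card {H \<in> Pow E. real (card H) \<le> M}) = (\<Sum>H\<in>{H \<in> Pow E. real (card H) \<le> M}. 1)"
    by simp
  also have "\<dots> \<le> (\<Sum>H\<in>{H \<in> Pow E. real (card H) \<le> M}. x powr M * (1 / x) ^ card H)"
  proof (rule sum_mono)
    fix H assume "H \<in> {H \<in> Pow E. real (card H) \<le> M}"
    then have "x powr real (card H) \<le> x powr M" using assms(2) by (intro powr_mono) auto
    then show "1 \<le> x powr M * (1 / x) ^ card H"
      using assms(2) by (simp add: powr_realpow power_divide field_simps)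
  qed
  also have "\<dots> \<le> (\<Sum>H\<in>Pow E. x powr M * (1 / x) ^ card H)"
    using assms by (intro sum_mono2) auto
  also have "\<dots> = x powr M * (1 + 1 / x) ^ card E"
    using assms(1) by (simp add: sum_distrib_left[symmetric] sum_power_card_Pow)
  also have "\<dots> \<le> x powr M * exp (1 / x) ^ card E"
    using assms(2) by (intro mult_left_mono power_mono exp_ge_add_one_self) auto
  also have "exp (1 / x) ^ card E = exp (real (card E) / x)"
    by (simp add: exp_of_nat_mult[symmetric])
  finally show ?thesis .
qed

lemma card_sparse_graphs_le:
  fixes V :: "'a set" and M :: real
  assumes "finite V" "V \<noteq> {}"
  defines "n \<equiv> real (card V)"
  shows "real (card {H \<in> Pow ([V]\<^bsup>2\<^esup>). real (card H) \<le> M}) \<le> n powr M * exp n"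
proof -
  have n: "1 \<le> n" using assms(1,2) by (simp add: n_def Suc_le_eq card_gt_0_iff)
  have "card V * (card V - 1) div 2 \<le> card V * card V"
    by (intro order_trans[OF div_le_dividend] mult_le_mono2) simp
  then have "real (card ([V]\<^bsup>2\<^esup>)) \<le> n * n"
    by (simp add: choose_two n_def flip: of_nat_mult)
  then have "exp (real (card ([V]\<^bsup>2\<^esup>)) / n) \<le> exp n"
    using n by (simp add: divide_le_eq)
  then have "n powr M * exp (real (card ([V]\<^bsup>2\<^esup>)) / n) \<le> n powr M * exp n"
    by (intro mult_left_mono) auto
  with card_sparse_subsets_le[OF finite_imp_finite_nsets[OF assms(1)] n, of 2 M] show ?thesis
    by (rule order_trans)
qed

lemma prob_sparse_saturated_le:
  fixes V :: "nat set" and M F :: real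
  assumes "0 < p" "p < 1" "3 \<le> m" "finite V" "V \<noteq> {}"
    and many_unjoined: "\<And>H. H \<subseteq> [V]\<^bsup>2\<^esup> \<Longrightarrow> real (card H) \<le> M \<Longrightarrow> F \<le> real (card (unjoined m V H))"
  defines "n \<equiv> real (card V)"
  shows "measure_pmf.prob (random_subset ([V]\<^bsup>2\<^esup>) p) {G. \<exists>H. cycle_saturated m G H \<and> real (card H) \<le> M}
    \<le> n powr M * exp n * (1 - p) powr F"
proof -
  let ?E = "[V]\<^bsup>2\<^esup>"
  define HH where "HH = {H \<in> Pow ?E. real (card H) \<le> M}"
  have finE: "finite ?E" using assms(4) by (rule finite_imp_finite_nsets)
  have "measure_pmf.prob (random_subset ?E p) {G. \<exists>H. cycle_saturated m G H \<and> real (card H) \<le> M}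
    \<le> measure_pmf.prob (random_subset ?E p) (\<Union>H\<in>HH. {G. G \<inter> unjoined m V H = {}})"
  proof (rule prob_random_subset_mono, elim CollectE exE conjE)
    fix G H
    assume "G \<subseteq> ?E" and H: "cycle_saturated m G H" "real (card H) \<le> M"
    then have "H \<in> HH" by (auto simp: HH_def cycle_saturated_def)
    then show "G \<in> (\<Union>H\<in>HH. {G. G \<inter> unjoined m V H = {}})"
      using cycle_saturated_disjoint_unjoined[OF H(1) assms(3)] by blast
  qed
  also have "\<dots> \<le> real (card HH) * (1 - p) powr F"
  proof (rule prob_UN_le_card_mult)
    fix H assume H: "H \<in> HH"
    have "measure_pmf.prob (random_subset ?E p) {G. G \<inter> unjoined m V H = {}} = (1 - p) ^ card (unjoined m V H)"
      using finE unjoined_subset assms(1,2) by (intro prob_random_subset_disjoint) simp_all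
    also have "\<dots> = (1 - p) powr real (card (unjoined m V H))" using assms by (simp add: powr_realpow)
    also have "\<dots> \<le> (1 - p) powr F"
      using assms(1,2) H by (intro powr_mono' many_unjoined) (auto simp: HH_def)
    finally show "measure_pmf.prob (random_subset ?E p) {G. G \<inter> unjoined m V H = {}} \<le> (1 - p) powr F" .
  qed (use finE in \<open>simp add: HH_def\<close>)
  also have "\<dots> \<le> n powr M * exp n * (1 - p) powr F"
    unfolding HH_def n_def using card_sparse_graphs_le[OF assms(4,5)] by (rule mult_right_mono) simp
  finally show ?thesis .
qed

lemma unjoined_inequality_mono:
  fixes V :: "'a set" and H :: "'a set set" and m :: nat and h u :: real
  assumes "finite V" "V \<noteq> {}" "H \<subseteq> [V]\<^bsup>2\<^esup>" "4 < m"
    and h: "real (card H) \<le> h" "real (card V) \<le> h" and u: "real (card (unjoined m V H)) \<le> u"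
  defines "n \<equiv> real (card V)"
  defines "k \<equiv> 2 * u / n"
  shows "n - k - (16 * (u + h + 4) * (2 * u + n)) powr (1 / 3)
    \<le> sqrt ((1 + k + 2 * (real m - 1) * (h + 1 - n + k)) * (2 * u + 3 * n))"
proof -
  define h' where "h' = real (card H)"
  define u' where "u' = real (card (unjoined m V H))"
  define k' where "k' = 2 * u' / n"
  have "0 \<le> h'" "0 \<le> u'" "0 \<le> n" by (simp_all add: h'_def u'_def n_def)
  moreover have "h' \<le> h" "u' \<le> u" "n \<le> h" using h u by (simp_all add: h'_def u'_def n_def)
  moreover have "k' \<le> k" "0 \<le> k"
    using calculation by (auto simp: k_def k'_def intro!: divide_right_mono divide_nonneg_nonneg)
  ultimately have
    "(16 * (u' + h' + 4) * (2 * u' + n)) powr (1 / 3) \<le> (16 * (u + h + 4) * (2 * u + n)) powr (1 / 3)"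
    "sqrt ((1 + k' + 2 * (real m - 1) * (h' + 1 - n + k')) * (2 * u' + 3 * n))
      \<le> sqrt ((1 + k + 2 * (real m - 1) * (h + 1 - n + k)) * (2 * u + 3 * n))"
    using assms(4)
    by (auto intro!: powr_mono2 real_sqrt_le_mono mult_mono add_mono mult_left_mono add_nonneg_nonneg mult_nonneg_nonneg)
  moreover have "n - k' - (16 * (u' + h' + 4) * (2 * u' + n)) powr (1 / 3)
      \<le> sqrt ((1 + k' + 2 * (real m - 1) * (h' + 1 - n + k')) * (2 * u' + 3 * n))"
    unfolding h'_def u'_def k'_def n_def using assms(1-4) by (rule unjoined_inequality)
  ultimately show ?thesis using \<open>k' \<le> k\<close> by linarith
qed

lemma eventually_unjoined_inequality_fails:
  fixes c e M :: real
  assumes "0 < c" "0 < e" "e < 1" "0 < M"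
  defines "L \<equiv> \<lambda>n::nat. c * ln (real n)"
  defines "h \<equiv> \<lambda>n. real n + real n / (4 * M * L n) * (1 - e)"
  defines "u \<equiv> \<lambda>n. (1 + e / 2) * real n * L n"
  defines "k \<equiv> \<lambda>n. 2 * u n / real n"
  shows "\<forall>\<^sub>F n in sequentially. sqrt ((1 + k n + 2 * M * (h n + 1 - real n + k n)) * (2 * u n + 3 * real n))
    < real n - k n - (16 * (u n + h n + 4) * (2 * u n + real n)) powr (1 / 3)"
proof -
  define lhs where "lhs = (\<lambda>n. sqrt ((1 + k n + 2 * M * (h n + 1 - real n + k n)) * (2 * u n + 3 * real n)))"
  define rhs where "rhs = (\<lambda>n. real n - k n - (16 * (u n + h n + 4) * (2 * u n + real n)) powr (1 / 3))"
  have "(\<lambda>n. lhs n / real n) \<longlonglongrightarrow> sqrt ((1 - e) * (1 + e / 2))"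
    unfolding lhs_def k_def h_def u_def L_def using assms(1-4)
    by real_asymp (simp add: powr_half_sqrt mult.assoc[symmetric])
  moreover have "(\<lambda>n. rhs n / real n) \<longlonglongrightarrow> 1"
    unfolding rhs_def k_def h_def u_def L_def using assms(1-4) by real_asymp
  ultimately have "(\<lambda>n. rhs n / real n - lhs n / real n) \<longlonglongrightarrow> 1 - sqrt ((1 - e) * (1 + e / 2))"
    by (intro tendsto_diff)
  moreover have "sqrt ((1 - e) * (1 + e / 2)) < 1"
  proof -
    have "(1 - e) * (1 + e / 2) = 1 - e / 2 - e\<^sup>2 / 2" by (simp add: field_simps power2_eq_square)
    also have "\<dots> < 1" using assms(2) zero_le_power2[of e] by linarith
    finally show ?thesis by simp
  qed
  ultimately have "\<forall>\<^sub>F n in sequentially. 0 < rhs n / real n - lhs n / real n"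
    by (intro order_tendstoD(1)) auto
  then have "\<forall>\<^sub>F n in sequentially. lhs n < rhs n"
    using eventually_gt_at_top[of 0] by eventually_elim (simp add: divide_less_cancel)
  then show ?thesis by (simp only: lhs_def rhs_def)
qed

lemma eventually_many_unjoined:
  fixes c e :: real and m :: nat
  assumes "0 < c" "0 < e" "e < 1" "5 \<le> m"
  defines "L \<equiv> \<lambda>n::nat. c * ln (real n)"
  shows "\<forall>\<^sub>F n in sequentially. \<forall>(V :: 'a set) H. card V = n \<longrightarrow> H \<subseteq> [V]\<^bsup>2\<^esup> \<longrightarrow>
    real (card H) \<le> real n + real n / (4 * (real m - 1) * L n) * (1 - e) \<longrightarrow>
    (1 + e / 2) * real n * L n \<le> real (card (unjoined m V H))"
proof -
  define h where "h = (\<lambda>n. real n + real n / (4 * (real m - 1) * L n) * (1 - e))"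
  define u where "u = (\<lambda>n. (1 + e / 2) * real n * L n)"
  define k where "k = (\<lambda>n. 2 * u n / real n)"
  have "\<forall>\<^sub>F n in sequentially. 0 < L n \<and> 0 < real n"
    unfolding L_def using assms(1) by (intro eventually_conj) real_asymp+
  moreover have "\<forall>\<^sub>F n in sequentially.
      sqrt ((1 + k n + 2 * (real m - 1) * (h n + 1 - real n + k n)) * (2 * u n + 3 * real n))
      < real n - k n - (16 * (u n + h n + 4) * (2 * u n + real n)) powr (1 / 3)"
    using eventually_unjoined_inequality_fails[of c e "real m - 1"] assms(1-4)
    unfolding h_def u_def k_def L_def by simp
  ultimately have "\<forall>\<^sub>F n in sequentially. \<forall>(V :: 'a set) H. card V = n \<longrightarrow> H \<subseteq> [V]\<^bsup>2\<^esup> \<longrightarrow>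
    real (card H) \<le> h n \<longrightarrow> u n \<le> real (card (unjoined m V H))"
  proof eventually_elim
    case (elim n)
    have "u n \<le> real (card (unjoined m V H))"
      if V: "card V = n" "H \<subseteq> [V]\<^bsup>2\<^esup>" and few: "real (card H) \<le> h n" for V :: "'a set" and H
    proof (rule ccontr)
      assume "\<not> ?thesis"
      moreover have "finite V" "V \<noteq> {}" using V(1) elim(1) by (auto intro: card_ge_0_finite)
      moreover have "real n \<le> h n" unfolding h_def using elim(1) assms(2-4) by simp
      ultimately show False
        using unjoined_inequality_mono[of V H m "h n" "u n"] V few elim(2) assms(4) by (simp add: k_def)
    qed
    then show ?case by blast
  qed
  then show ?thesis by (simp only: h_def u_def)
qed

theorem whp_saturated_card_ge:
  fixes p e :: real and m :: nat
  assumes p: "0 < p" "p < 1" and m: "5 \<le> m" and e: "0 < e" "e < 1"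
  shows "whp p (\<lambda>n G. \<forall>H. cycle_saturated m G H \<longrightarrow>
    real n + real n / (4 * (real m - 1) * log (1 / (1 - p)) (real n)) * (1 - e) \<le> real (card H))"
proof -
  define c where "c = 1 / ln (1 / (1 - p))"
  define M where "M = real m - 1"
  define h where "h = (\<lambda>n. real n + real n / (4 * M * (c * ln (real n))) * (1 - e))"
  define u where "u = (\<lambda>n. (1 + e / 2) * real n * (c * ln (real n)))"
  have c: "0 < c" "ln (1 - p) = - 1 / c" using p by (simp_all add: c_def ln_div)
  have "whp p (\<lambda>n G. \<forall>H. cycle_saturated m G H \<longrightarrow> h n \<le> real (card H))"
  proof (rule whpI)
    show "(\<lambda>n. exp (real n * ((1 - e) / (4 * M * c) + 1 - e / 2 * ln (real n)))) \<longlonglongrightarrow> 0"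
      using e by real_asymp
    have "\<forall>\<^sub>F n in sequentially. 0 < ln (real n) \<and> 0 < real n"
      by (intro eventually_conj) real_asymp+
    then show "\<forall>\<^sub>F n in sequentially.
        measure_pmf.prob (gnp n p) {G. \<not> (\<forall>H. cycle_saturated m G H \<longrightarrow> h n \<le> real (card H))}
        \<le> exp (real n * ((1 - e) / (4 * M * c) + 1 - e / 2 * ln (real n)))"
      using eventually_many_unjoined[OF c(1) e m, where 'a = nat]
    proof eventually_elim
      case (elim n)
      have many: "u n \<le> real (card (unjoined m {1..n} H))" if "H \<subseteq> [{1..n}]\<^bsup>2\<^esup>" "real (card H) \<le> h n" for H
        using elim(2)[rule_format, of "{1..n}" H] that by (simp add: u_def h_def M_def)
      have "measure_pmf.prob (gnp n p) {G. \<not> (\<forall>H. cycle_saturated m G H \<longrightarrow> h n \<le> real (card H))}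
        \<le> measure_pmf.prob (gnp n p) {G. \<exists>H. cycle_saturated m G H \<and> real (card H) \<le> h n}"
        by (intro measure_pmf.finite_measure_mono) auto
      also have "\<dots> \<le> real n powr h n * exp (real n) * (1 - p) powr u n"
        unfolding gnp_eq_random_subset
        using prob_sparse_saturated_le[of p m "{1..n}" "h n" "u n"] many p m elim(1) by simp
      also have "\<dots> = exp (h n * ln (real n) + real n + u n * ln (1 - p))"
        using elim(1) p by (simp add: powr_def exp_add)
      also have "h n * ln (real n) + real n + u n * ln (1 - p)
          = real n * ((1 - e) / (4 * M * c) + 1 - e / 2 * ln (real n))"
      proof -
        have "real n / (4 * M * (c * ln (real n))) * (1 - e) * ln (real n) = real n * ((1 - e) / (4 * M * c))"
          using elim(1) by auto
        moreover have "u n * ln (1 - p) = - ((1 + e / 2) * real n * ln (real n))"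
          using c by (simp add: u_def)
        ultimately show ?thesis by (simp add: h_def algebra_simps)
      qed
      finally show ?case .
    qed
  qed
  then show ?thesis by (simp add: h_def M_def c_def log_def)
qed

section \<open>A sparse saturated graph\<close>

lemma distinct_list_between:
  assumes "finite B" "u \<in> B" "v \<in> B" "u \<noteq> v" "2 \<le> k" "k \<le> card B"
  shows "\<exists>ws. set ws \<subseteq> B \<and> distinct ws \<and> ws \<noteq> [] \<and> length ws = k \<and> hd ws = u \<and> last ws = v"
proof -
  have "k - 2 \<le> card (B - {u, v})"
    using assms by (simp add: card_Diff_subset)
  then obtain S where S: "S \<subseteq> B - {u, v}" "card S = k - 2" "finite S"
    using obtain_subset_with_card_n by metis
  then obtain xs where xs: "set xs = S" "distinct xs" using finite_distinct_list by blast
  then have "Suc (Suc (length xs)) = k" using S(2) assms(5) distinct_card[of xs] by simp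
  then show ?thesis
    using xs S(1) assms(2-4) by (intro exI[of _ "u # xs @ [v]"]) auto
qed

lemma upath_clique:
  assumes "[set ws]\<^bsup>2\<^esup> \<subseteq> H" "distinct ws" "ws \<noteq> []"
  shows "upath H ws"
proof -
  have "{ws ! i, ws ! Suc i} \<in> [set ws]\<^bsup>2\<^esup>" if "Suc i < length ws" for i
    using that assms(2) by (simp add: nth_eq_iff_index_eq)
  then show ?thesis using assms by (auto simp: upath_def successively_conv_nth)
qed

lemma ucycle_Cons_neighbours:
  assumes "ucycle H (v # ws)" "2 \<le> length ws"
  shows "{v, hd ws} \<in> H" "{v, last ws} \<in> H" "hd ws \<noteq> last ws"
proof -
  have ws: "ws \<noteq> []" "upath H ws" using assms by (auto simp: ucycle_def upath_Cons)
  then show "{v, hd ws} \<in> H" "{v, last ws} \<in> H"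
    using assms(1) by (auto simp: ucycle_def upath_Cons insert_commute)
  show "hd ws \<noteq> last ws"
    using ws(2) assms(2) last_in_set[of "tl ws"] by (cases ws) (auto simp: upath_def split: if_splits)
qed

definition indep_set :: "'a set set \<Rightarrow> 'a set \<Rightarrow> bool" where
  "indep_set G I \<longleftrightarrow> G \<inter> [I]\<^bsup>2\<^esup> = {}"

lemma indep_set_subset: "indep_set G I \<Longrightarrow> J \<subseteq> I \<Longrightarrow> indep_set G J"
  unfolding indep_set_def using nsets_mono[of J I 2] by blast

lemma indep_setD: "indep_set G I \<Longrightarrow> u \<in> I \<Longrightarrow> v \<in> I \<Longrightarrow> u \<noteq> v \<Longrightarrow> {u, v} \<notin> G"
  unfolding indep_set_def using doubleton_in_nsets_2[of u v I] by blast

definition star_assignment :: "'a set set \<Rightarrow> 'a set \<Rightarrow> 'a set \<Rightarrow> ('a \<Rightarrow> 'a) \<Rightarrow> bool" where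
  "star_assignment G R X c \<longleftrightarrow>
    (\<forall>v\<in>R. c v \<in> X \<and> {v, c v} \<in> G) \<and> (\<forall>x. indep_set G {v \<in> R. c v = x})"

locale hub_graph =
  fixes m :: nat and V :: "nat set" and G :: "nat set set"
    and B :: "nat set" and h1 h2 :: nat and X :: "nat set" and c :: "nat \<Rightarrow> nat"
  assumes m: "5 \<le> m" and finite_V: "finite V" and G: "G \<subseteq> [V]\<^bsup>2\<^esup>"
    and B_subset: "B \<subseteq> V" and card_B: "card B = m - 2" and clique: "[B]\<^bsup>2\<^esup> \<subseteq> G"
    and hubs: "h1 \<in> B" "h2 \<in> B" "h1 \<noteq> h2"
    and X_subset: "X \<subseteq> V - B" and card_X: "2 \<le> card X"
    and centre_adjacent: "x \<in> X \<Longrightarrow> h \<in> {h1, h2} \<Longrightarrow> {x, h} \<in> G"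
    and leaves: "star_assignment G (V - B - X) X c"
begin

definition leaf :: "nat set" where
  "leaf = V - B - X"

definition H :: "nat set set" where
  "H = [B]\<^bsup>2\<^esup> \<union> (\<lambda>(x, h). {x, h}) ` (X \<times> {h1, h2}) \<union> (\<lambda>l. {l, c l}) ` leaf"

lemma finite_B: "finite B"
  using B_subset finite_V finite_subset by blast

lemma finite_X: "finite X"
  using X_subset finite_V by (auto intro: finite_subset)

lemma centre_notin: "x \<in> X \<Longrightarrow> x \<notin> B" "x \<in> X \<Longrightarrow> x \<notin> leaf"
  using X_subset by (auto simp: leaf_def)

lemma leaf_notin: "l \<in> leaf \<Longrightarrow> l \<notin> B" "l \<in> leaf \<Longrightarrow> l \<notin> X"
  by (auto simp: leaf_def)

lemma centre_of_leaf: "l \<in> leaf \<Longrightarrow> c l \<in> X"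
  using leaves by (auto simp: star_assignment_def leaf_def)

lemma hub_edge: "[B]\<^bsup>2\<^esup> \<subseteq> H"
  by (auto simp: H_def)

lemma centre_edge: "x \<in> X \<Longrightarrow> h \<in> {h1, h2} \<Longrightarrow> {x, h} \<in> H"
  unfolding H_def by blast

lemma leaf_edge: "l \<in> leaf \<Longrightarrow> {l, c l} \<in> H"
  by (auto simp: H_def)

lemma leaf_neighbour: "l \<in> leaf \<Longrightarrow> {l, w} \<in> H \<Longrightarrow> w = c l"
  using leaf_notin[of l] centre_of_leaf[of w] hubs by (auto simp: H_def doubleton_eq_iff)

lemma centre_neighbour: "x \<in> X \<Longrightarrow> {x, w} \<in> H \<Longrightarrow> w \<in> {h1, h2} \<union> leaf"
  using centre_notin[of x] hubs by (auto simp: H_def doubleton_eq_iff)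

lemma edge_vertex: "{u, v} \<in> H \<Longrightarrow> u \<in> B \<union> X \<union> leaf"
  using centre_of_leaf hubs by (auto simp: H_def doubleton_eq_iff)

lemma H_subset: "H \<subseteq> G"
  using clique centre_adjacent leaves by (auto simp: H_def leaf_def star_assignment_def)

lemma leaf_not_on_cycle:
  assumes "ucycle H vs" "3 \<le> length vs" "l \<in> leaf"
  shows "l \<notin> set vs"
proof
  assume "l \<in> set vs"
  then obtain ws where ws: "ucycle H (l # ws)" "length (l # ws) = length vs"
    using ucycle_rotate_to[OF assms(1)] by blast
  then have "2 \<le> length ws" using assms(2) by simp
  from ucycle_Cons_neighbours[OF ws(1) this] show False
    using leaf_neighbour[OF assms(3)] by metis
qed

lemma cycle_vertices:
  assumes "ucycle H vs" "3 \<le> length vs"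
  shows "set vs \<subseteq> B \<union> X"
proof
  fix v assume v: "v \<in> set vs"
  then obtain ws where ws: "ucycle H (v # ws)" "length (v # ws) = length vs"
    using ucycle_rotate_to[OF assms(1)] by blast
  then have "{v, hd ws} \<in> H" using ucycle_Cons_neighbours(1)[of H v ws] assms(2) by simp
  then show "v \<in> B \<union> X" using edge_vertex leaf_not_on_cycle[OF assms] v by blast
qed

lemma centre_on_cycle:
  assumes "ucycle H (x # ws)" "2 \<le> length ws" "x \<in> X"
  shows "{hd ws, last ws} = {h1, h2}"
proof -
  have "hd ws \<in> set ws" "last ws \<in> set ws" using assms(2) by (cases ws; simp)+
  then have "hd ws \<notin> leaf" "last ws \<notin> leaf"
    using leaf_not_on_cycle[OF assms(1)] assms(2) by auto
  then show ?thesis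
    using ucycle_Cons_neighbours[OF assms(1,2)] centre_neighbour[OF assms(3)] by blast
qed

lemma cycle_through_two_centres:
  assumes "ucycle H vs" "3 \<le> length vs" "x \<in> X" "y \<in> X" "x \<noteq> y" "x \<in> set vs" "y \<in> set vs"
  shows "length vs = 4"
proof -
  obtain ws where ws: "ucycle H (x # ws)" "set (x # ws) = set vs" "length (x # ws) = length vs"
    using ucycle_rotate_to[OF assms(1,6)] by blast
  then have len: "2 \<le> length ws" and "y \<in> set ws" using assms(2,5,7) by auto
  then obtain as bs where split: "ws = as @ y # bs" using split_list by metis
  have nbrs_x: "{hd ws, last ws} = {h1, h2}" by (rule centre_on_cycle[OF ws(1) len assms(3)])
  have "ucycle H (y # bs @ x # as)"
    using ucycle_rotate[of H "x # as" "y # bs"] ws(1) by (simp add: split)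
  then have nbrs_y: "{hd (bs @ x # as), last (bs @ x # as)} = {h1, h2}"
    using len assms(4) by (intro centre_on_cycle) (auto simp: split)
  have "hd ws \<in> {h1, h2}" "last ws \<in> {h1, h2}" using nbrs_x by blast+
  moreover have "y \<notin> {h1, h2}" using centre_notin(1)[OF assms(4)] hubs by blast
  ultimately have nonempty: "as \<noteq> []" "bs \<noteq> []" by (auto simp: split)
  then have eq: "{hd as, last bs} = {hd bs, last as}"
    using nbrs_x nbrs_y by (simp add: split)
  have dist: "distinct as" "distinct bs" "set as \<inter> set bs = {}"
    using ws(1) by (auto simp: split ucycle_def upath_def)
  then have "hd as \<noteq> hd bs" "last bs \<noteq> last as"
    using nonempty by (metis disjoint_iff hd_in_set last_in_set)+
  then have "hd as = last as" "hd bs = last bs" using eq by (auto simp: doubleton_eq_iff)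
  then have "length as = 1" "length bs = 1"
    using dist(1,2) nonempty by (cases as; cases bs; auto split: if_splits)+
  then show ?thesis using ws(3) by (simp add: split)
qed

lemma no_cycle: "\<not> has_cycle m H"
proof
  assume "has_cycle m H"
  then obtain vs where vs: "length vs = m" "ucycle H vs"
    using m by (auto simp: has_cycle_iff_ucycle)
  have "card (set vs) = m" using vs by (simp add: ucycle_def upath_def distinct_card)
  then have "2 \<le> card (set vs - B)"
    using diff_card_le_card_Diff[of B "set vs"] card_B finite_B m by simp
  then obtain x y where "x \<in> set vs - B" "y \<in> set vs - B" "x \<noteq> y"
    using card_le_Suc0_iff_eq[of "set vs - B"] by fastforce
  moreover have "set vs \<subseteq> B \<union> X" using cycle_vertices vs m by simp
  ultimately have "length vs = 4" using cycle_through_two_centres[OF vs(2), of x y] vs(1) m by auto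
  then show False using vs(1) m by simp
qed

lemma upath_hubs: "set ws \<subseteq> B \<Longrightarrow> distinct ws \<Longrightarrow> ws \<noteq> [] \<Longrightarrow> upath H ws"
  using upath_clique nsets_mono hub_edge by (metis subset_trans)

lemma upath_between_centres:
  assumes "x \<in> X" "y \<in> X" "x \<noteq> y" "0 < k" "k \<le> m - 2"
  shows "\<exists>ws. upath H (x # ws @ [y]) \<and> set ws \<subseteq> B \<and> length ws = k"
proof -
  have "\<exists>ws. set ws \<subseteq> B \<and> distinct ws \<and> ws \<noteq> [] \<and> length ws = k \<and> hd ws = h1 \<and> last ws \<in> {h1, h2}"
  proof (cases "k = 1")
    case True
    then show ?thesis using hubs by (intro exI[of _ "[h1]"]) auto
  next
    case False
    then have "2 \<le> k" "k \<le> card B" using assms(4,5) card_B by auto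
    then show ?thesis using distinct_list_between[OF finite_B hubs] by blast
  qed
  then obtain ws where ws: "set ws \<subseteq> B" "distinct ws" "ws \<noteq> []" "length ws = k" "hd ws = h1" "last ws \<in> {h1, h2}"
    by blast
  have "upath H (x # ws @ [y])"
    using upath_hubs[OF ws(1-3)] ws assms(1-3) centre_notin(1) centre_edge
    by (auto simp: upath_Cons upath_append insert_commute)
  then show ?thesis using ws by blast
qed

lemma joined_centre_centre:
  assumes "x \<in> X" "y \<in> X" "x \<noteq> y"
  shows "joined m H x y"
proof -
  have "0 < m - 2" using m by linarith
  then obtain ws where "upath H (x # ws @ [y])" "length ws = m - 2"
    using upath_between_centres[OF assms _ order_refl] by blast
  then show ?thesis using m unfolding joined_def by (intro exI[of _ "x # ws @ [y]"]) auto
qed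

lemma joined_leaf_centre:
  assumes "l \<in> leaf" "y \<in> X" "c l \<noteq> y"
  shows "joined m H l y"
proof -
  have "0 < m - 3" "m - 3 \<le> m - 2" using m by linarith+
  then obtain ws where ws: "upath H (c l # ws @ [y])" "set ws \<subseteq> B" "length ws = m - 3"
    using upath_between_centres[OF centre_of_leaf[OF assms(1)] assms(2,3)] by blast
  have "upath H (l # c l # ws @ [y])"
    using ws leaf_notin[OF assms(1)] leaf_edge[OF assms(1)] centre_of_leaf[OF assms(1)] assms(2)
    by (subst upath_Cons) auto
  then show ?thesis using ws(3) m unfolding joined_def
    by (intro exI[of _ "l # c l # ws @ [y]"]) auto
qed

lemma joined_leaf_leaf:
  assumes "l \<in> leaf" "l' \<in> leaf" "c l \<noteq> c l'"
  shows "joined m H l l'"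
proof -
  note centres = centre_of_leaf[OF assms(1)] centre_of_leaf[OF assms(2)]
  have "0 < m - 4" "m - 4 \<le> m - 2" using m by linarith+
  then obtain ws where ws: "upath H (c l # ws @ [c l'])" "set ws \<subseteq> B" "length ws = m - 4"
    using upath_between_centres[OF centres assms(3)] by blast
  have "upath H ((c l # ws @ [c l']) @ [l'])"
    using ws leaf_notin[OF assms(2)] leaf_edge[OF assms(2)] centres
    by (subst upath_append) (auto simp: insert_commute)
  then have "upath H (l # (c l # ws @ [c l']) @ [l'])"
    using ws(2) leaf_notin[OF assms(1)] leaf_edge[OF assms(1)] centres assms(3)
    by (subst upath_Cons) auto
  then show ?thesis using ws(3) m unfolding joined_def
    by (intro exI[of _ "l # (c l # ws @ [c l']) @ [l']"]) auto
qed

lemma joined_leaf_hub: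
  assumes "l \<in> leaf" "u \<in> B"
  shows "joined m H l u"
proof -
  obtain h where h: "h \<in> {h1, h2}" "h \<noteq> u" using hubs(3) by blast
  have "h \<in> B" "2 \<le> m - 2" "m - 2 \<le> card B" using h(1) hubs card_B m by auto
  then obtain ws where ws: "set ws \<subseteq> B" "distinct ws" "ws \<noteq> []" "length ws = m - 2" "hd ws = h" "last ws = u"
    using distinct_list_between[OF finite_B _ assms(2) h(2)] by blast
  have "upath H (l # c l # ws)"
    using upath_hubs[OF ws(1-3)] ws h(1) leaf_notin[OF assms(1)] leaf_edge[OF assms(1)]
      centre_of_leaf[OF assms(1)] centre_notin(1) centre_edge
    by (auto simp: upath_Cons)
  then show ?thesis using ws m unfolding joined_def
    by (intro exI[of _ "l # c l # ws"]) auto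
qed

lemma joined_centre_hub:
  assumes "x \<in> X" "u \<in> B" "{x, u} \<notin> H"
  shows "joined m H x u"
proof -
  have u: "u \<noteq> h1" "u \<noteq> h2" using centre_edge assms by auto
  have "card (X - {x}) \<noteq> 0" using card_X assms(1) finite_X by simp
  then obtain z where z: "z \<in> X" "z \<noteq> x" by (metis DiffD1 DiffD2 all_not_in_conv card.empty singletonI)
  have "finite (B - {h1})" "h2 \<in> B - {h1}" "u \<in> B - {h1}" "h2 \<noteq> u" "2 \<le> m - 3" "m - 3 \<le> card (B - {h1})"
    using finite_B hubs assms(2) u card_B m by auto
  from distinct_list_between[OF this] obtain ws where ws:
    "set ws \<subseteq> B - {h1}" "distinct ws" "ws \<noteq> []" "length ws = m - 3" "hd ws = h2" "last ws = u"
    by blast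
  have "upath H ws" using upath_hubs ws by blast
  moreover have "x \<notin> B" "z \<notin> B" "x \<noteq> h1" "z \<noteq> h1" using centre_notin(1) assms(1) z(1) hubs by auto
  ultimately have "upath H (x # h1 # z # ws)"
    using ws z assms(1) centre_edge[of x h1] centre_edge[of z h1] centre_edge[of z h2]
    by (auto simp: upath_Cons insert_commute)
  then show ?thesis using ws m unfolding joined_def
    by (intro exI[of _ "x # h1 # z # ws"]) auto
qed

lemma joined_of_nonedge:
  assumes "{u, v} \<in> G" "{u, v} \<notin> H"
  shows "joined m H u v"
proof -
  have uv: "u \<noteq> v" "u \<in> V" "v \<in> V"
    using assms(1) G doubleton_in_nsets_2[of u v V] by blast+
  have ordered: "joined m H a b"
    if "{a, b} \<in> G" "{a, b} \<notin> H" "a \<noteq> b" "a \<in> leaf \<and> b \<in> V \<or> a \<in> X \<and> b \<in> X \<union> B" for a b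
    using that(4)
  proof (elim disjE conjE)
    assume a: "a \<in> leaf" and b: "b \<in> V"
    consider (leaf) "b \<in> leaf" | (centre) "b \<in> X" | (hub) "b \<in> B" using b by (auto simp: leaf_def)
    then show ?thesis
    proof cases
      case leaf
      have "c a \<noteq> c b"
      proof
        assume "c a = c b"
        moreover have "indep_set G {v \<in> leaf. c v = c b}"
          using leaves by (simp add: star_assignment_def leaf_def)
        ultimately show False using indep_setD[of G _ a b] that(1,3) a leaf by blast
      qed
      then show ?thesis using joined_leaf_leaf a leaf by blast
    next
      case centre
      have "c a \<noteq> b" using leaf_edge[OF a] that(2) by auto
      then show ?thesis using joined_leaf_centre a centre by blast
    qed (use joined_leaf_hub a in blast)
  next
    assume "a \<in> X" "b \<in> X \<union> B"
    then show ?thesis using joined_centre_centre joined_centre_hub that(2,3) by blast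
  qed
  have "\<not> (u \<in> B \<and> v \<in> B)" using hub_edge assms(2) uv(1) doubleton_in_nsets_2[of u v B] by blast
  then have "u \<in> leaf \<and> v \<in> V \<or> u \<in> X \<and> v \<in> X \<union> B \<or> v \<in> leaf \<and> u \<in> V \<or> v \<in> X \<and> u \<in> X \<union> B"
    using uv(2,3) by (auto simp: leaf_def)
  then show ?thesis
    using ordered[of u v] ordered[of v u] assms uv(1) joined_sym[of m H u v] by (auto simp: insert_commute)
qed

theorem cycle_saturated_H: "cycle_saturated m G H"
  unfolding cycle_saturated_def
proof (intro conjI ballI)
  show "H \<subseteq> G" by (rule H_subset)
  show "\<not> has_cycle m H" by (rule no_cycle)
  fix e assume e: "e \<in> G - H"
  then obtain u v where uv: "e = {u, v}" using G by (meson DiffD1 nsets2_E subsetD)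
  then have "joined m H u v" using joined_of_nonedge e by blast
  then show "has_cycle m (insert e H)" using has_cycle_insert_iff[of m u v H] m by (simp add: uv)
qed

lemma card_H_le: "card H \<le> card V + card X + m\<^sup>2"
proof -
  have "card X \<le> card V" using X_subset finite_V by (intro card_mono) auto
  have "card ([B]\<^bsup>2\<^esup>) \<le> m\<^sup>2"
  proof -
    have "(m - 2) * (m - 2 - 1) div 2 \<le> m * m"
      by (intro order_trans[OF div_le_dividend] mult_le_mono) auto
    then show ?thesis by (simp add: card_B choose_two power2_eq_square)
  qed
  moreover have "card ((\<lambda>(x, h). {x, h}) ` (X \<times> {h1, h2})) \<le> card (X \<times> {h1, h2})"
    using finite_X by (intro card_image_le) auto
  moreover have "card ((\<lambda>l. {l, c l}) ` leaf) \<le> card leaf"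
    using finite_V by (intro card_image_le) (auto simp: leaf_def)
  moreover have "card leaf \<le> card (V - X)" using finite_V by (intro card_mono) (auto simp: leaf_def)
  moreover have "card (V - X) = card V - card X"
    using X_subset finite_X by (intro card_Diff_subset) auto
  ultimately have "card H \<le> m\<^sup>2 + 2 * card X + (card V - card X)"
    unfolding H_def using hubs(3)
    by (intro order_trans[OF card_Un_le] add_mono) (auto simp: card_cartesian_product)
  then show ?thesis using \<open>card X \<le> card V\<close> by linarith
qed

end

section \<open>Large independent sets\<close>

lemma nsets_Int: "[A]\<^bsup>k\<^esup> \<inter> [B]\<^bsup>k\<^esup> = [A \<inter> B]\<^bsup>k\<^esup>"
  by (auto simp: nsets_def)

lemma card_nsets_superset:
  assumes "finite W" "J \<subseteq> W" "card J \<le> k"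
  shows "card {I \<in> [W]\<^bsup>k\<^esup>. J \<subseteq> I} = (card W - card J) choose (k - card J)"
proof -
  have finJ: "finite J" using assms(1,2) finite_subset by blast
  have "bij_betw (\<lambda>K. K \<union> J) ([W - J]\<^bsup>(k - card J)\<^esup>) {I \<in> [W]\<^bsup>k\<^esup>. J \<subseteq> I}"
  proof (rule bij_betw_byWitness[where f' = "\<lambda>I. I - J"])
    show "(\<lambda>K. K \<union> J) ` [W - J]\<^bsup>(k - card J)\<^esup> \<subseteq> {I \<in> [W]\<^bsup>k\<^esup>. J \<subseteq> I}"
    proof (rule image_subsetI)
      fix K assume K: "K \<in> [W - J]\<^bsup>(k - card J)\<^esup>"
      then have "card (K \<union> J) = k"
        using finJ assms(3) by (subst card_Un_disjoint) (auto simp: nsets_def)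
      then show "K \<union> J \<in> {I \<in> [W]\<^bsup>k\<^esup>. J \<subseteq> I}"
        using K assms(2) finJ by (auto simp: nsets_def)
    qed
    show "(\<lambda>I. I - J) ` {I \<in> [W]\<^bsup>k\<^esup>. J \<subseteq> I} \<subseteq> [W - J]\<^bsup>(k - card J)\<^esup>"
      using finJ by (auto simp: nsets_def card_Diff_subset)
  qed (auto simp: nsets_def)
  from bij_betw_same_card[OF this] show ?thesis
    by (simp add: card_Diff_subset[OF finJ assms(2)])
qed

lemma binomial_diff_mult_power_le:
  assumes "j \<le> k" "k \<le> n"
  shows "((n - j) choose (k - j)) * n ^ j \<le> (n choose k) * k ^ j"
  using assms(1)
proof (induction j)
  case (Suc j)
  define N K where "N = n - j" and "K = k - j"
  have pos: "0 < N" "0 < K" using Suc.prems assms(2) by (auto simp: N_def K_def)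
  have pred: "n - Suc j = N - 1" "k - Suc j = K - 1" by (auto simp: N_def K_def)
  have "int (K * n) \<le> int (N * k)"
    using Suc.prems assms(2) by (simp add: N_def K_def of_nat_diff algebra_simps mult_left_mono)
  then have Kn: "K * n \<le> N * k" by (simp only: of_nat_le_iff)
  have step: "(N choose K) * n ^ j \<le> (n choose k) * k ^ j"
    using Suc by (simp add: N_def K_def)
  have "N * (((N - 1) choose (K - 1)) * n ^ Suc j) = K * n * ((N choose K) * n ^ j)"
    using times_binomial_minus1_eq[OF pos(2), of N] by (simp add: mult.assoc mult.left_commute)
  also have "\<dots> \<le> N * k * ((n choose k) * k ^ j)"
    using Kn step by (rule mult_le_mono)
  also have "\<dots> = N * ((n choose k) * k ^ Suc j)" by simp
  finally show ?case using pos(1) by (simp only: pred mult_le_cancel1)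
qed simp

lemma one_plus_inverse_power_le_3: "(1 + 1 / real g) ^ g \<le> 3"
proof -
  have "(1 + 1 / real g) ^ g \<le> exp (1 / real g) ^ g"
    by (intro power_mono exp_ge_add_one_self) auto
  also have "\<dots> \<le> exp 1" by (simp add: exp_of_nat_mult[symmetric])
  also have "\<dots> \<le> 3" using exp_le by simp
  finally show ?thesis .
qed

locale random_graph_subset =
  fixes E :: "'a set set" and W :: "'a set" and g :: nat and p :: real
  assumes finite_E: "finite E" and W_pairs: "[W]\<^bsup>2\<^esup> \<subseteq> E"
    and finite_W: "finite W" and W_nonempty: "W \<noteq> {}"
    and g: "2 \<le> g" and p: "0 < p" "p < 1"
    and small: "(real g)\<^sup>2 / real (card W) * (1 / (1 - p)) powr (real (g + 1) / 2) \<le> 1"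
begin

definition b :: real where
  "b = 1 / (1 - p)"

definition N :: real where
  "N = real (card W)"

definition \<mu> :: real where
  "\<mu> = real (card W choose g) * (1 - p) ^ (g choose 2)"

definition overlapping :: "('a set \<times> 'a set) set" where
  "overlapping = {(I, J) \<in> [W]\<^bsup>g\<^esup> \<times> [W]\<^bsup>g\<^esup>. 2 \<le> card (I \<inter> J)}"

definition \<Delta> :: real where
  "\<Delta> = (\<Sum>(I, J)\<in>overlapping. measure_pmf.prob (random_subset E p) {G. indep_set G I \<and> indep_set G J})"

lemma b_gt_1: "1 < b"
  using p by (simp add: b_def field_simps)

lemma N_pos: "0 < N"
  using finite_W W_nonempty by (simp add: N_def card_gt_0_iff)

lemma g_le_card_W: "g \<le> card W"
proof -
  have "(real g)\<^sup>2 / N * 1 \<le> (real g)\<^sup>2 / N * b powr (real (g + 1) / 2)"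
    using b_gt_1 N_pos by (intro mult_left_mono ge_one_powr_ge_zero) auto
  also have "\<dots> \<le> 1" using small by (simp add: b_def N_def)
  finally have "g * g \<le> card W" using N_pos by (simp add: N_def power2_eq_square flip: of_nat_mult)
  then show ?thesis using g by (meson le_square le_trans)
qed

lemma finite_subsets: "finite ([W]\<^bsup>g\<^esup>)"
  using finite_W by (rule finite_imp_finite_nsets)

lemma finite_overlapping: "finite overlapping"
  by (rule finite_subset[of _ "[W]\<^bsup>g\<^esup> \<times> [W]\<^bsup>g\<^esup>"]) (auto simp: overlapping_def finite_subsets)

lemma pairs_subset: "I \<in> [W]\<^bsup>g\<^esup> \<Longrightarrow> [I]\<^bsup>2\<^esup> \<subseteq> E"
  using W_pairs nsets_mono[of I W 2] by (auto simp: nsets_def)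

lemma prob_indep_set:
  assumes "I \<in> [W]\<^bsup>g\<^esup>"
  shows "measure_pmf.prob (random_subset E p) {G. indep_set G I} = (1 - p) ^ (g choose 2)"
proof -
  have "card ([I]\<^bsup>2\<^esup>) = g choose 2" using assms by (auto simp: nsets_def[of W])
  then show ?thesis
    using prob_random_subset_disjoint[OF finite_E pairs_subset[OF assms], of p] p
    by (simp add: indep_set_def)
qed

lemma prob_indep_set_pair:
  assumes "I \<in> [W]\<^bsup>g\<^esup>" "J \<in> [W]\<^bsup>g\<^esup>"
  shows "measure_pmf.prob (random_subset E p) {G. indep_set G I \<and> indep_set G J}
    = (1 - p) ^ (2 * (g choose 2)) * b ^ (card (I \<inter> J) choose 2)"
proof -
  have fin: "finite I" "finite J" "card I = g" "card J = g" using assms by (auto simp: nsets_def)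
  have union: "card ([I]\<^bsup>2\<^esup> \<union> [J]\<^bsup>2\<^esup>) + (card (I \<inter> J) choose 2) = 2 * (g choose 2)"
    using card_Un_Int[of "[I]\<^bsup>2\<^esup>" "[J]\<^bsup>2\<^esup>"] fin by (simp add: nsets_Int finite_imp_finite_nsets)
  have "{G. indep_set G I \<and> indep_set G J} = {G. G \<inter> ([I]\<^bsup>2\<^esup> \<union> [J]\<^bsup>2\<^esup>) = {}}"
    by (auto simp: indep_set_def)
  then have "measure_pmf.prob (random_subset E p) {G. indep_set G I \<and> indep_set G J}
      = (1 - p) ^ card ([I]\<^bsup>2\<^esup> \<union> [J]\<^bsup>2\<^esup>)"
    using prob_random_subset_disjoint[OF finite_E, of "[I]\<^bsup>2\<^esup> \<union> [J]\<^bsup>2\<^esup>" p] pairs_subset assms p by simp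
  also have "\<dots> = (1 - p) ^ (2 * (g choose 2)) * b ^ (card (I \<inter> J) choose 2)"
    unfolding union[symmetric] power_add b_def using p by (simp add: power_divide)
  finally show ?thesis .
qed

lemma overlap_weight_le:
  assumes "2 \<le> j" "j \<le> g"
  shows "b ^ (j choose 2) * ((real g)\<^sup>2 / N) ^ j \<le> ((real g)\<^sup>2 / N)\<^sup>2 * b"
proof -
  define r where "r = (real g)\<^sup>2 / N"
  have r_pos: "0 < r" using g N_pos by (simp add: r_def)
  define w where "w = b powr (real (j + 1) / 2)"
  have "real (j choose 2) = real j * (real j - 1) / 2"
    using assms by (simp add: choose_two real_of_nat_div of_nat_diff)
  also have "\<dots> = 1 + (real (j + 1) / 2) * real (j - 2)"
    using assms by (simp add: of_nat_diff field_simps)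
  finally have "b powr real (j choose 2) = b * w powr real (j - 2)"
    using b_gt_1 by (simp add: w_def powr_add powr_powr)
  then have split: "b ^ (j choose 2) = b * w ^ (j - 2)"
    using b_gt_1 by (simp add: w_def powr_realpow)
  have "w * r \<le> b powr (real (g + 1) / 2) * r"
    unfolding w_def using b_gt_1 r_pos assms by (intro mult_right_mono powr_mono) auto
  also have "\<dots> \<le> 1" using small by (simp add: b_def r_def N_def mult.commute)
  finally have "(w * r) ^ (j - 2) \<le> 1"
    using r_pos by (intro power_le_one) (auto simp: w_def)
  then have "b * r\<^sup>2 * (w * r) ^ (j - 2) \<le> b * r\<^sup>2 * 1"
    using b_gt_1 by (intro mult_left_mono) auto
  moreover have "r ^ j = r\<^sup>2 * r ^ (j - 2)" using assms by (metis le_add_diff_inverse power_add)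
  ultimately show ?thesis unfolding split r_def[symmetric] by (simp add: power_mult_distrib mult_ac)
qed

lemma card_supersets_le:
  assumes "K \<subseteq> W" "card K \<le> g"
  shows "real (card {J \<in> [W]\<^bsup>g\<^esup>. K \<subseteq> J}) \<le> real (card W choose g) * (real g / N) ^ card K"
proof -
  have "real (((card W - card K) choose (g - card K)) * card W ^ card K)
      \<le> real ((card W choose g) * g ^ card K)"
    using binomial_diff_mult_power_le[OF assms(2) g_le_card_W] by (simp only: of_nat_le_iff)
  then show ?thesis
    unfolding card_nsets_superset[OF finite_W assms] using N_pos
    by (simp add: N_def power_divide field_simps)
qed

lemma sum_overlap_eq_weights_le:
  assumes "K \<subseteq> W" "2 \<le> card K" "card K \<le> g"
  shows "(\<Sum>J\<in>{J \<in> [W]\<^bsup>g\<^esup>. I \<inter> J = K}. b ^ (card (I \<inter> J) choose 2))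
    \<le> real (card W choose g) * (((real g)\<^sup>2 / N)\<^sup>2 * b) * (1 / real g) ^ card K"
proof -
  have "(\<Sum>J\<in>{J \<in> [W]\<^bsup>g\<^esup>. I \<inter> J = K}. b ^ (card (I \<inter> J) choose 2))
      = (\<Sum>J\<in>{J \<in> [W]\<^bsup>g\<^esup>. I \<inter> J = K}. b ^ (card K choose 2))"
    by (intro sum.cong) auto
  also have "\<dots> \<le> (\<Sum>J\<in>{J \<in> [W]\<^bsup>g\<^esup>. K \<subseteq> J}. b ^ (card K choose 2))"
    using finite_subsets b_gt_1 by (intro sum_mono2) auto
  also have "\<dots> \<le> real (card W choose g) * (real g / N) ^ card K * b ^ (card K choose 2)"
    using card_supersets_le[OF assms(1,3)] b_gt_1 by (simp add: mult_right_mono)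
  also have "\<dots> = real (card W choose g) * (1 / real g) ^ card K
      * (b ^ (card K choose 2) * ((real g)\<^sup>2 / N) ^ card K)"
    using g by (simp add: power_divide power2_eq_square power_mult_distrib)
  also have "\<dots> \<le> real (card W choose g) * (1 / real g) ^ card K * (((real g)\<^sup>2 / N)\<^sup>2 * b)"
    using overlap_weight_le[OF assms(2,3)] by (intro mult_left_mono) auto
  finally show ?thesis by (simp add: mult_ac)
qed

lemma sum_overlap_weights_le:
  assumes "I \<in> [W]\<^bsup>g\<^esup>"
  shows "(\<Sum>J\<in>{J \<in> [W]\<^bsup>g\<^esup>. 2 \<le> card (I \<inter> J)}. b ^ (card (I \<inter> J) choose 2))
    \<le> 3 * real (card W choose g) * (((real g)\<^sup>2 / N)\<^sup>2 * b)"
proof -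
  define R where "R = ((real g)\<^sup>2 / N)\<^sup>2 * b"
  have "0 \<le> R" using b_gt_1 by (simp add: R_def)
  define \<K> where "\<K> = {K. K \<subseteq> I \<and> 2 \<le> card K}"
  have I: "finite I" "card I = g" "I \<subseteq> W" using assms by (auto simp: nsets_def)
  have "finite \<K>" using I(1) by (simp add: \<K>_def)
  then have "(\<Sum>J\<in>{J \<in> [W]\<^bsup>g\<^esup>. 2 \<le> card (I \<inter> J)}. b ^ (card (I \<inter> J) choose 2))
     = (\<Sum>K\<in>\<K>. \<Sum>J\<in>{J \<in> {J \<in> [W]\<^bsup>g\<^esup>. 2 \<le> card (I \<inter> J)}. I \<inter> J = K}. b ^ (card (I \<inter> J) choose 2))"
    using finite_subsets by (intro sum.group[symmetric]) (auto simp: \<K>_def)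
  also have "\<dots> = (\<Sum>K\<in>\<K>. \<Sum>J\<in>{J \<in> [W]\<^bsup>g\<^esup>. I \<inter> J = K}. b ^ (card (I \<inter> J) choose 2))"
    by (intro sum.cong) (auto simp: \<K>_def)
  also have "\<dots> \<le> (\<Sum>K\<in>\<K>. real (card W choose g) * R * (1 / real g) ^ card K)"
    unfolding R_def using I card_mono[OF I(1)]
    by (intro sum_mono sum_overlap_eq_weights_le) (auto simp: \<K>_def)
  also have "\<dots> \<le> (\<Sum>K\<in>Pow I. real (card W choose g) * R * (1 / real g) ^ card K)"
    using \<open>0 \<le> R\<close> I(1) by (intro sum_mono2) (auto simp: \<K>_def)
  also have "\<dots> = real (card W choose g) * R * (1 + 1 / real g) ^ g"
    using I(1,2) by (simp add: sum_distrib_left[symmetric] sum_power_card_Pow)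
  also have "\<dots> \<le> real (card W choose g) * R * 3"
    using \<open>0 \<le> R\<close> by (intro mult_left_mono one_plus_inverse_power_le_3) auto
  finally show ?thesis by (simp add: R_def mult_ac)
qed

lemma \<Delta>_le: "\<Delta> \<le> \<mu>\<^sup>2 * (3 * (((real g)\<^sup>2 / N)\<^sup>2 * b))"
proof -
  define C where "C = g choose 2"
  define R where "R = ((real g)\<^sup>2 / N)\<^sup>2 * b"
  have overlapping_eq: "overlapping = (SIGMA I:[W]\<^bsup>g\<^esup>. {J \<in> [W]\<^bsup>g\<^esup>. 2 \<le> card (I \<inter> J)})"
    by (auto simp: overlapping_def)
  have "\<Delta> = (\<Sum>(I, J)\<in>overlapping. (1 - p) ^ (2 * C) * b ^ (card (I \<inter> J) choose 2))"
    unfolding \<Delta>_def by (intro sum.cong) (auto simp: overlapping_def prob_indep_set_pair C_def)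
  also have "\<dots> = (\<Sum>I\<in>[W]\<^bsup>g\<^esup>. \<Sum>J\<in>{J \<in> [W]\<^bsup>g\<^esup>. 2 \<le> card (I \<inter> J)}. (1 - p) ^ (2 * C) * b ^ (card (I \<inter> J) choose 2))"
    unfolding overlapping_eq using finite_subsets by (subst sum.Sigma) auto
  also have "\<dots> \<le> (\<Sum>I\<in>[W]\<^bsup>g\<^esup>. (1 - p) ^ (2 * C) * (3 * real (card W choose g) * R))"
  proof (rule sum_mono)
    fix I assume "I \<in> [W]\<^bsup>g\<^esup>"
    then show "(\<Sum>J\<in>{J \<in> [W]\<^bsup>g\<^esup>. 2 \<le> card (I \<inter> J)}. (1 - p) ^ (2 * C) * b ^ (card (I \<inter> J) choose 2))
        \<le> (1 - p) ^ (2 * C) * (3 * real (card W choose g) * R)"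
      unfolding R_def sum_distrib_left[symmetric] using p
      by (intro mult_left_mono sum_overlap_weights_le) auto
  qed
  also have "\<dots> = \<mu>\<^sup>2 * (3 * R)"
    by (simp add: \<mu>_def C_def power_mult_distrib power2_eq_square power_add mult_2)
  finally show ?thesis by (simp add: R_def)
qed

lemma \<mu>_pos: "0 < \<mu>"
  using p g_le_card_W by (simp add: \<mu>_def)

lemma \<mu>_le_\<Delta>: "\<mu> \<le> \<Delta>"
proof -
  have diagonal: "(\<lambda>I. (I, I)) ` [W]\<^bsup>g\<^esup> \<subseteq> overlapping"
    using g by (auto simp: overlapping_def nsets_def)
  have "\<mu> = (\<Sum>I\<in>[W]\<^bsup>g\<^esup>. measure_pmf.prob (random_subset E p) {G. indep_set G I})"
    by (simp add: \<mu>_def prob_indep_set)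
  also have "\<dots> = (\<Sum>(I, J)\<in>(\<lambda>I. (I, I)) ` [W]\<^bsup>g\<^esup>.
      measure_pmf.prob (random_subset E p) {G. indep_set G I \<and> indep_set G J})"
    by (subst sum.reindex) (auto simp: inj_on_def)
  also have "\<dots> \<le> \<Delta>"
    unfolding \<Delta>_def using finite_overlapping diagonal by (intro sum_mono2) auto
  finally show ?thesis .
qed

text \<open>
  The largest number of edge-disjoint independent sets changes by at most one when an edge is added,
  so it obeys the bounded difference inequality, unlike the number of all independent sets.
\<close>

definition packings :: "'a set set \<Rightarrow> 'a set set set" where
  "packings G = {F. F \<subseteq> [W]\<^bsup>g\<^esup> \<and> (\<forall>I\<in>F. indep_set G I) \<and> pairwise (\<lambda>I J. [I]\<^bsup>2\<^esup> \<inter> [J]\<^bsup>2\<^esup> = {}) F}"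

definition packing_number :: "'a set set \<Rightarrow> real" where
  "packing_number G = real (Max (card ` packings G))"

lemma finite_packings: "finite (packings G)"
  unfolding packings_def by (rule finite_subset[of _ "Pow ([W]\<^bsup>g\<^esup>)"]) (use finite_subsets in auto)

lemma card_le_packing_number: "F \<in> packings G \<Longrightarrow> real (card F) \<le> packing_number G"
  unfolding packing_number_def using finite_packings by (intro of_nat_mono Max_ge) auto

lemma packing_number_attained: obtains F where "F \<in> packings G" "packing_number G = real (card F)"
proof -
  have "{} \<in> packings G" by (simp add: packings_def)
  then have "Max (card ` packings G) \<in> card ` packings G"
    using finite_packings by (intro Max_in) auto
  then show ?thesis using that by (auto simp: packing_number_def)
qed

lemma bounded_differences_packing_number: "bounded_differences E (indicator ([W]\<^bsup>2\<^esup>)) packing_number"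
proof (rule bounded_differencesI)
  fix e S
  obtain F\<^sub>1 where "F\<^sub>1 \<in> packings (insert e S)" "packing_number (insert e S) = real (card F\<^sub>1)"
    by (rule packing_number_attained)
  moreover from this have "F\<^sub>1 \<in> packings S" by (auto simp: packings_def indep_set_def)
  ultimately have decreasing: "packing_number (insert e S) \<le> packing_number S"
    using card_le_packing_number by simp
  obtain F where F: "F \<in> packings S" "packing_number S = real (card F)"
    by (rule packing_number_attained)
  define F' where "F' = {I \<in> F. e \<in> [I]\<^bsup>2\<^esup>}"
  have finF: "finite F" using F(1) finite_subsets finite_subset by (auto simp: packings_def)
  have "card F = card (F - F') + card F'"
    using finF by (simp add: F'_def card_Diff_subset card_mono)
  moreover have "F - F' \<in> packings (insert e S)"
    using F(1) by (auto simp: packings_def F'_def indep_set_def pairwise_def)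
  ultimately have lower: "packing_number S - real (card F') \<le> packing_number (insert e S)"
    using card_le_packing_number[of "F - F'" "insert e S"] F(2) by simp
  have "real (card F') \<le> indicator ([W]\<^bsup>2\<^esup>) e"
  proof (cases "F' = {}")
    case False
    then obtain I where I: "I \<in> F'" by blast
    have "J = I" if "J \<in> F'" for J
      using that I F(1) unfolding F'_def packings_def pairwise_def by blast
    then have "F' = {I}" using I by blast
    moreover have "e \<in> [W]\<^bsup>2\<^esup>"
      using I F(1) by (auto simp: F'_def packings_def nsets_def)
    ultimately show ?thesis by simp
  qed simp
  then show "\<bar>packing_number (insert e S) - packing_number S\<bar> \<le> indicator ([W]\<^bsup>2\<^esup>) e"
    using decreasing lower by linarith
qed

definition conflicts :: "'a set set \<Rightarrow> 'a set set set" where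
  "conflicts G = {{I, J} |I J. I \<in> [W]\<^bsup>g\<^esup> \<and> J \<in> [W]\<^bsup>g\<^esup> \<and> indep_set G I \<and> indep_set G J \<and>
    I \<noteq> J \<and> [I]\<^bsup>2\<^esup> \<inter> [J]\<^bsup>2\<^esup> \<noteq> {}}"

lemma conflict_free_in_packings:
  assumes "F \<subseteq> {I \<in> [W]\<^bsup>g\<^esup>. indep_set G I}" "\<forall>e\<in>conflicts G. \<not> e \<subseteq> F"
  shows "F \<in> packings G"
proof -
  have "[I]\<^bsup>2\<^esup> \<inter> [J]\<^bsup>2\<^esup> = {}" if "I \<in> F" "J \<in> F" "I \<noteq> J" for I J
  proof (rule ccontr)
    assume "[I]\<^bsup>2\<^esup> \<inter> [J]\<^bsup>2\<^esup> \<noteq> {}"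
    then have "{I, J} \<in> conflicts G" using that assms(1) unfolding conflicts_def by blast
    then show False using assms(2) that by auto
  qed
  then show ?thesis using assms(1) by (auto simp: packings_def pairwise_def)
qed

lemma card_conflicts_le:
  "card (conflicts G) \<le> card {(I, J) \<in> overlapping. indep_set G I \<and> indep_set G J}" (is "_ \<le> card ?D")
proof -
  have "conflicts G \<subseteq> (\<lambda>(I, J). {I, J}) ` ?D"
  proof
    fix e assume "e \<in> conflicts G"
    then obtain I J where IJ: "e = {I, J}" "I \<in> [W]\<^bsup>g\<^esup>" "J \<in> [W]\<^bsup>g\<^esup>" "indep_set G I" "indep_set G J"
        "[I \<inter> J]\<^bsup>2\<^esup> \<noteq> {}"
      by (auto simp: conflicts_def nsets_Int)
    moreover have "finite (I \<inter> J)" using IJ(2) by (auto simp: nsets_def)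
    ultimately have "(I, J) \<in> ?D"
      by (auto simp: overlapping_def nsets_eq_empty_iff)
    then show "e \<in> (\<lambda>(I, J). {I, J}) ` ?D" using IJ(1) by (intro image_eqI[of _ _ "(I, J)"]) auto
  qed
  then show ?thesis
    by (rule surj_card_le[rotated]) (rule finite_subset[OF _ finite_overlapping], auto)
qed

lemma packing_number_ge:
  assumes "0 \<le> q" "q \<le> 1"
  shows "q * real (card {I \<in> [W]\<^bsup>g\<^esup>. indep_set G I})
    - q\<^sup>2 * real (card {(I, J) \<in> overlapping. indep_set G I \<and> indep_set G J}) \<le> packing_number G"
proof -
  define T where "T = {I \<in> [W]\<^bsup>g\<^esup>. indep_set G I}"
  have "finite T" using finite_subsets by (simp add: T_def)
  moreover have conflict: "e \<subseteq> T \<and> e \<noteq> {} \<and> card e = 2" if "e \<in> conflicts G" for e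
  proof -
    obtain I J where "e = {I, J}" "I \<in> T" "J \<in> T" "I \<noteq> J"
      using \<open>e \<in> conflicts G\<close> unfolding conflicts_def T_def by blast
    then show ?thesis by simp
  qed
  ultimately obtain F where F: "F \<subseteq> T" "\<forall>e\<in>conflicts G. \<not> e \<subseteq> F"
      "q * real (card T) - (\<Sum>e\<in>conflicts G. q ^ card e) \<le> real (card F)"
    using hypergraph_independent_set_random[OF _ _ assms, of T "conflicts G"] by metis
  have "real (card F) \<le> packing_number G"
    using F(1,2) unfolding T_def by (intro card_le_packing_number conflict_free_in_packings)
  moreover have "(\<Sum>e\<in>conflicts G. q ^ card e) = (\<Sum>e\<in>conflicts G. q\<^sup>2)"
    using conflict by (intro sum.cong) auto
  moreover have "q\<^sup>2 * real (card (conflicts G))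
      \<le> q\<^sup>2 * real (card {(I, J) \<in> overlapping. indep_set G I \<and> indep_set G J})"
    using card_conflicts_le by (intro mult_left_mono) auto
  ultimately show ?thesis using F(3) by (simp add: T_def mult.commute)
qed

lemma expec_packing_number_ge: "N\<^sup>2 / (12 * b * real g ^ 4) \<le> expec E p packing_number"
proof -
  define q where "q = \<mu> / (2 * \<Delta>)"
  have \<Delta>_pos: "0 < \<Delta>" using \<mu>_pos \<mu>_le_\<Delta> by linarith
  have q: "0 \<le> q" "q \<le> 1" using \<mu>_pos \<mu>_le_\<Delta> \<Delta>_pos by (auto simp: q_def field_simps)
  let ?indep = "\<lambda>G. real (card {I \<in> [W]\<^bsup>g\<^esup>. indep_set G I})"
  let ?overlap = "\<lambda>G. real (card {(I, J) \<in> overlapping. indep_set G I \<and> indep_set G J})"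
  have "expec E p ?indep = \<mu>"
    using expec_card_Collect[OF finite_E finite_subsets, of p "\<lambda>I G. indep_set G I"]
    by (simp add: prob_indep_set \<mu>_def)
  moreover have "expec E p ?overlap = \<Delta>"
    using expec_card_Collect[OF finite_E finite_overlapping, of p "\<lambda>(I, J) G. indep_set G I \<and> indep_set G J"]
    by (simp add: \<Delta>_def case_prod_unfold)
  ultimately have "q * \<mu> - q\<^sup>2 * \<Delta> = expec E p (\<lambda>G. q * ?indep G - q\<^sup>2 * ?overlap G)"
    using finite_E by simp
  also have "\<dots> \<le> expec E p packing_number"
    using finite_E packing_number_ge[OF q] by (intro expec_mono) auto
  also have "q * \<mu> - q\<^sup>2 * \<Delta> = \<mu>\<^sup>2 / (4 * \<Delta>)"
    unfolding q_def using \<Delta>_pos by (simp add: field_simps power2_eq_square)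
  finally have mean: "\<mu>\<^sup>2 / (4 * \<Delta>) \<le> expec E p packing_number" .
  have "N\<^sup>2 / (12 * b * real g ^ 4) = \<mu>\<^sup>2 / (4 * (\<mu>\<^sup>2 * (3 * (((real g)\<^sup>2 / N)\<^sup>2 * b))))"
    using \<mu>_pos N_pos b_gt_1 g by (simp add: field_simps eval_nat_numeral)
  also have "\<dots> \<le> \<mu>\<^sup>2 / (4 * \<Delta>)"
    using \<Delta>_pos \<mu>_pos b_gt_1 N_pos g by (intro divide_left_mono mult_pos_pos mult_left_mono \<Delta>_le) auto
  finally show ?thesis using mean by linarith
qed

theorem prob_no_indep_set:
  "measure_pmf.prob (random_subset E p) {G. \<forall>I\<in>[W]\<^bsup>g\<^esup>. \<not> indep_set G I}
     \<le> exp (- (N\<^sup>2 / (72 * b\<^sup>2 * real g ^ 8)))"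
proof -
  define t where "t = expec E p packing_number"
  have t: "N\<^sup>2 / (12 * b * real g ^ 4) \<le> t" "0 \<le> N\<^sup>2 / (12 * b * real g ^ 4)"
    using expec_packing_number_ge b_gt_1 by (simp_all add: t_def)
  have "packing_number G = 0" if "\<forall>I\<in>[W]\<^bsup>g\<^esup>. \<not> indep_set G I" for G
  proof -
    obtain F where F: "F \<in> packings G" "packing_number G = real (card F)" by (rule packing_number_attained)
    then have "F = {}" using that by (auto simp: packings_def)
    then show ?thesis using F(2) by simp
  qed
  then have "measure_pmf.prob (random_subset E p) {G. \<forall>I\<in>[W]\<^bsup>g\<^esup>. \<not> indep_set G I}
      \<le> measure_pmf.prob (random_subset E p) {G. packing_number G \<le> expec E p packing_number - t}"
    by (intro measure_pmf.finite_measure_mono) (auto simp: t_def)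
  also have "\<dots> \<le> exp (- 2 * t\<^sup>2 / N\<^sup>2)"
  proof (rule bounded_differences_lower_tail[OF finite_E _ _ bounded_differences_packing_number])
    have "(\<Sum>e\<in>E. (indicator ([W]\<^bsup>2\<^esup>) e)\<^sup>2) = (\<Sum>e\<in>[W]\<^bsup>2\<^esup>. 1 :: real)"
      using finite_E W_pairs by (intro sum.mono_neutral_cong_right) auto
    also have "\<dots> = real (card W * (card W - 1) div 2)" by (simp add: choose_two)
    also have "\<dots> \<le> real (card W * card W)"
      by (intro of_nat_mono order_trans[OF div_le_dividend] mult_le_mono2) simp
    finally show "(\<Sum>e\<in>E. (indicator ([W]\<^bsup>2\<^esup>) e)\<^sup>2) \<le> N\<^sup>2" by (simp add: N_def power2_eq_square)
  qed (use p N_pos t in auto)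
  also have "\<dots> \<le> exp (- (N\<^sup>2 / (72 * b\<^sup>2 * real g ^ 8)))"
  proof -
    have "N\<^sup>2 / (72 * b\<^sup>2 * real g ^ 8) = 2 * (N\<^sup>2 / (12 * b * real g ^ 4))\<^sup>2 / N\<^sup>2"
      using N_pos b_gt_1 g by (simp add: power_divide power_mult_distrib field_simps flip: power_mult power_add)
    also have "\<dots> \<le> 2 * t\<^sup>2 / N\<^sup>2"
      using t by (intro divide_right_mono mult_left_mono power_mono) auto
    finally show ?thesis by simp
  qed
  finally show ?thesis .
qed

end

definition has_indep_sets :: "'a set \<Rightarrow> nat \<Rightarrow> nat \<Rightarrow> 'a set set \<Rightarrow> bool" where
  "has_indep_sets V N g G \<longleftrightarrow> (\<forall>W\<in>[V]\<^bsup>N\<^esup>. \<exists>I\<in>[W]\<^bsup>g\<^esup>. indep_set G I)"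

lemma prob_not_has_indep_sets:
  assumes "finite V" "0 < p" "p < 1" "2 \<le> g" "1 \<le> N"
    and "(real g)\<^sup>2 / real N * (1 / (1 - p)) powr (real (g + 1) / 2) \<le> 1"
  shows "measure_pmf.prob (random_subset ([V]\<^bsup>2\<^esup>) p) {G. \<not> has_indep_sets V N g G}
    \<le> 2 ^ card V * exp (- ((real N)\<^sup>2 / (72 * (1 / (1 - p))\<^sup>2 * real g ^ 8)))"
proof -
  define \<eta> where "\<eta> = exp (- ((real N)\<^sup>2 / (72 * (1 / (1 - p))\<^sup>2 * real g ^ 8)))"
  have fin: "finite ([V]\<^bsup>N\<^esup>)" "finite ([V]\<^bsup>2\<^esup>)" using assms(1) by (auto intro: finite_imp_finite_nsets)
  have "{G. \<not> has_indep_sets V N g G} = (\<Union>W\<in>[V]\<^bsup>N\<^esup>. {G. \<forall>I\<in>[W]\<^bsup>g\<^esup>. \<not> indep_set G I})"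
    by (auto simp: has_indep_sets_def)
  then have "measure_pmf.prob (random_subset ([V]\<^bsup>2\<^esup>) p) {G. \<not> has_indep_sets V N g G}
      = measure_pmf.prob (random_subset ([V]\<^bsup>2\<^esup>) p) (\<Union>W\<in>[V]\<^bsup>N\<^esup>. {G. \<forall>I\<in>[W]\<^bsup>g\<^esup>. \<not> indep_set G I})"
    by simp
  also have "\<dots> \<le> real (card ([V]\<^bsup>N\<^esup>)) * \<eta>"
  proof (rule prob_UN_le_card_mult[OF fin(1)])
    fix W assume "W \<in> [V]\<^bsup>N\<^esup>"
    then have W: "W \<subseteq> V" "finite W" "card W = N" by (auto simp: nsets_def)
    interpret random_graph_subset "[V]\<^bsup>2\<^esup>" W g p
      using assms W fin(2) nsets_mono[OF W(1)] by unfold_locales auto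
    show "measure_pmf.prob (random_subset ([V]\<^bsup>2\<^esup>) p) {G. \<forall>I\<in>[W]\<^bsup>g\<^esup>. \<not> indep_set G I} \<le> \<eta>"
      using prob_no_indep_set by (simp add: \<eta>_def b_def N_def W(3))
  qed
  also have "\<dots> \<le> 2 ^ card V * \<eta>"
  proof (rule mult_right_mono)
    have "card V choose N \<le> 2 ^ card V" by (rule binomial_le_pow2)
    then show "real (card ([V]\<^bsup>N\<^esup>)) \<le> 2 ^ card V" by (simp flip: of_nat_le_iff)
  qed (simp add: \<eta>_def)
  finally show ?thesis by (simp add: \<eta>_def)
qed

section \<open>Edge density and common neighbours\<close>

definition edge_dense :: "'a set \<Rightarrow> nat \<Rightarrow> nat \<Rightarrow> real \<Rightarrow> 'a set set \<Rightarrow> bool" where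
  "edge_dense V s r p G \<longleftrightarrow> (\<forall>A\<in>[V]\<^bsup>s\<^esup>. \<forall>R\<in>[V - A]\<^bsup>r\<^esup>. \<exists>x\<in>A. p / 2 * real r \<le> real (card (nbrs G x \<inter> R)))"

lemma prob_few_edges_between:
  assumes "finite V" "0 \<le> p" "p \<le> 1"
    and AR: "A \<subseteq> V" "R \<subseteq> V - A" "A \<noteq> {}" "R \<noteq> {}"
  shows "measure_pmf.prob (random_subset ([V]\<^bsup>2\<^esup>) p) {G. \<forall>x\<in>A. real (card (nbrs G x \<inter> R)) \<le> p / 2 * real (card R)}
    \<le> exp (- (p\<^sup>2 * real (card A) * real (card R) / 2))"
proof -
  have fin: "finite A" "finite R" using AR assms(1) by (auto intro: finite_subset)
  have disj: "disjoint_family_on (\<lambda>(x, v). {{x, v}}) (A \<times> R)"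
    using AR(2) by (auto simp: disjoint_family_on_def doubleton_eq_iff)
  have "measure_pmf.prob (random_subset ([V]\<^bsup>2\<^esup>) p) {G. \<forall>x\<in>A. real (card (nbrs G x \<inter> R)) \<le> p / 2 * real (card R)}
    \<le> measure_pmf.prob (random_subset ([V]\<^bsup>2\<^esup>) p)
        {G. real (card {w \<in> A \<times> R. (\<lambda>(x, v). {{x, v}}) w \<subseteq> G}) \<le> p ^ 1 / 2 * real (card (A \<times> R))}"
  proof (rule prob_random_subset_mono, elim CollectE, rule CollectI)
    fix G assume sparse: "\<forall>x\<in>A. real (card (nbrs G x \<inter> R)) \<le> p / 2 * real (card R)"
    have "{w \<in> A \<times> R. (\<lambda>(x, v). {{x, v}}) w \<subseteq> G} = (SIGMA x:A. nbrs G x \<inter> R)" by auto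
    then have "real (card {w \<in> A \<times> R. (\<lambda>(x, v). {{x, v}}) w \<subseteq> G}) = (\<Sum>x\<in>A. real (card (nbrs G x \<inter> R)))"
      using fin by (simp add: card_SigmaI)
    also have "\<dots> \<le> (\<Sum>x\<in>A. p / 2 * real (card R))" using sparse by (intro sum_mono) auto
    finally show "real (card {w \<in> A \<times> R. (\<lambda>(x, v). {{x, v}}) w \<subseteq> G}) \<le> p ^ 1 / 2 * real (card (A \<times> R))"
      by (simp add: card_cartesian_product mult_ac)
  qed
  also have "\<dots> \<le> exp (- (p ^ (2 * 1) * real (card (A \<times> R)) / (2 * real 1)))"
    by (rule prob_few_contained[OF _ assms(2,3) _ _ _ disj])
      (use assms(1) fin AR in \<open>auto intro: finite_imp_finite_nsets\<close>)
  finally show ?thesis by (simp add: card_cartesian_product mult_ac)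
qed

lemma prob_not_edge_dense:
  assumes "finite V" "0 \<le> p" "p \<le> 1" "1 \<le> s" "1 \<le> r"
  shows "measure_pmf.prob (random_subset ([V]\<^bsup>2\<^esup>) p) {G. \<not> edge_dense V s r p G}
    \<le> 4 ^ card V * exp (- (p\<^sup>2 * real s * real r / 2))"
proof -
  let ?AR = "SIGMA A:[V]\<^bsup>s\<^esup>. [V - A]\<^bsup>r\<^esup>"
  let ?bad = "\<lambda>(A, R). {G. \<forall>x\<in>A. real (card (nbrs G x \<inter> R)) \<le> p / 2 * real (card R)}"
  have sub: "?AR \<subseteq> Pow V \<times> Pow V" by (auto simp: nsets_def)
  have fin: "finite ?AR" using finite_subset[OF sub] assms(1) by auto
  have "measure_pmf.prob (random_subset ([V]\<^bsup>2\<^esup>) p) {G. \<not> edge_dense V s r p G}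
      \<le> measure_pmf.prob (random_subset ([V]\<^bsup>2\<^esup>) p) (\<Union>AR\<in>?AR. ?bad AR)"
  proof (rule measure_pmf.finite_measure_mono)
    show "{G. \<not> edge_dense V s r p G} \<subseteq> (\<Union>AR\<in>?AR. ?bad AR)"
    proof
      fix G assume "G \<in> {G. \<not> edge_dense V s r p G}"
      then obtain A R where AR: "A \<in> [V]\<^bsup>s\<^esup>" "R \<in> [V - A]\<^bsup>r\<^esup>"
        "\<forall>x\<in>A. real (card (nbrs G x \<inter> R)) < p / 2 * real r"
        by (auto simp: edge_dense_def not_le)
      then have "(A, R) \<in> ?AR" "G \<in> ?bad (A, R)" by (auto simp: nsets_def less_imp_le)
      then show "G \<in> (\<Union>AR\<in>?AR. ?bad AR)" by blast
    qed
  qed simp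
  also have "\<dots> \<le> real (card ?AR) * exp (- (p\<^sup>2 * real s * real r / 2))"
  proof (rule prob_UN_le_card_mult[OF fin])
    fix AR assume "AR \<in> ?AR"
    then obtain A R where AR: "AR = (A, R)" "A \<subseteq> V" "R \<subseteq> V - A" "card A = s" "card R = r"
      by (auto simp: nsets_def)
    moreover have "A \<noteq> {}" "R \<noteq> {}" using AR assms(4,5) by auto
    ultimately show "measure_pmf.prob (random_subset ([V]\<^bsup>2\<^esup>) p) (?bad AR) \<le> exp (- (p\<^sup>2 * real s * real r / 2))"
      using prob_few_edges_between[OF assms(1-3), of A R] by simp
  qed
  also have "\<dots> \<le> 4 ^ card V * exp (- (p\<^sup>2 * real s * real r / 2))"
  proof (rule mult_right_mono)
    have "card ?AR \<le> card (Pow V \<times> Pow V)" using sub assms(1) by (intro card_mono) auto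
    also have "\<dots> = 4 ^ card V"
      using assms(1) by (simp add: card_cartesian_product card_Pow power_mult_distrib[symmetric])
    finally show "real (card ?AR) \<le> 4 ^ card V" by (simp flip: of_nat_le_iff)
  qed simp
  finally show ?thesis .
qed

definition common_nbrs :: "'a set set \<Rightarrow> 'a set \<Rightarrow> 'a set" where
  "common_nbrs G S = {w. w \<notin> S \<and> (\<forall>v\<in>S. {w, v} \<in> G)}"

definition many_common_nbrs :: "'a set \<Rightarrow> nat \<Rightarrow> real \<Rightarrow> 'a set \<Rightarrow> 'a set set \<Rightarrow> bool" where
  "many_common_nbrs V q p J G \<longleftrightarrow>
    (\<forall>S\<in>[V]\<^bsup>q\<^esup>. p ^ q / 2 * (real (card J) - real q) \<le> real (card (common_nbrs G S \<inter> J)))"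

lemma prob_few_common_nbrs:
  assumes "finite V" "0 \<le> p" "p \<le> 1" "1 \<le> q" "S \<in> [V]\<^bsup>q\<^esup>" "J \<subseteq> V" "q < card J"
  shows "measure_pmf.prob (random_subset ([V]\<^bsup>2\<^esup>) p)
      {G. real (card (common_nbrs G S \<inter> J)) \<le> p ^ q / 2 * (real (card J) - real q)}
    \<le> exp (- (p ^ (2 * q) * (real (card J) - real q) / (2 * real q)))"
proof -
  define F where "F = (\<lambda>w. (\<lambda>v. {w, v}) ` S)"
  have S: "S \<subseteq> V" "finite S" "card S = q" using assms(5) by (auto simp: nsets_def)
  have finJ: "finite J" using assms(1,6) finite_subset by blast
  have "card J - card S \<le> card (J - S)" using S(2) by (rule diff_card_le_card_Diff)
  then have card_J: "real (card J) - real q \<le> real (card (J - S))" using S(3) by simp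
  have "0 < card (J - S)" using card_J assms(7) by linarith
  then have "J - S \<noteq> {}" unfolding card_gt_0_iff by blast
  have F: "F w \<subseteq> [V]\<^bsup>2\<^esup> \<and> card (F w) = q" if "w \<in> J - S" for w
  proof -
    have "inj_on (\<lambda>v. {w, v}) S" by (auto simp: inj_on_def doubleton_eq_iff)
    then show ?thesis using that S assms(6) by (auto simp: F_def card_image)
  qed
  have disj: "disjoint_family_on F (J - S)"
    by (auto simp: disjoint_family_on_def F_def doubleton_eq_iff)
  have "measure_pmf.prob (random_subset ([V]\<^bsup>2\<^esup>) p)
      {G. real (card (common_nbrs G S \<inter> J)) \<le> p ^ q / 2 * (real (card J) - real q)}
    \<le> measure_pmf.prob (random_subset ([V]\<^bsup>2\<^esup>) p)
      {G. real (card {w \<in> J - S. F w \<subseteq> G}) \<le> p ^ q / 2 * real (card (J - S))}"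
  proof (rule prob_random_subset_mono, elim CollectE, rule CollectI)
    fix G assume "real (card (common_nbrs G S \<inter> J)) \<le> p ^ q / 2 * (real (card J) - real q)"
    also have "\<dots> \<le> p ^ q / 2 * real (card (J - S))"
      using card_J assms(2) by (intro mult_left_mono) auto
    also have "common_nbrs G S \<inter> J = {w \<in> J - S. F w \<subseteq> G}" by (auto simp: common_nbrs_def F_def)
    finally show "real (card {w \<in> J - S. F w \<subseteq> G}) \<le> p ^ q / 2 * real (card (J - S))" .
  qed
  also have "\<dots> \<le> exp (- (p ^ (2 * q) * real (card (J - S)) / (2 * real q)))"
    using assms(1) finJ \<open>J - S \<noteq> {}\<close> F
    by (intro prob_few_contained[OF _ assms(2-4) _ _ disj]) (auto intro: finite_imp_finite_nsets)
  also have "\<dots> \<le> exp (- (p ^ (2 * q) * (real (card J) - real q) / (2 * real q)))"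
    using card_J assms(2) by (simp add: divide_right_mono mult_left_mono)
  finally show ?thesis .
qed

lemma prob_not_many_common_nbrs:
  assumes "finite V" "0 \<le> p" "p \<le> 1" "1 \<le> q" "J \<subseteq> V" "q < card J"
  shows "measure_pmf.prob (random_subset ([V]\<^bsup>2\<^esup>) p) {G. \<not> many_common_nbrs V q p J G}
    \<le> real (card V) ^ q * exp (- (p ^ (2 * q) * (real (card J) - real q) / (2 * real q)))"
proof -
  let ?bad = "\<lambda>S. {G. real (card (common_nbrs G S \<inter> J)) \<le> p ^ q / 2 * (real (card J) - real q)}"
  have "measure_pmf.prob (random_subset ([V]\<^bsup>2\<^esup>) p) {G. \<not> many_common_nbrs V q p J G}
      \<le> measure_pmf.prob (random_subset ([V]\<^bsup>2\<^esup>) p) (\<Union>S\<in>[V]\<^bsup>q\<^esup>. ?bad S)"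
    by (intro measure_pmf.finite_measure_mono) (auto simp: many_common_nbrs_def not_le less_imp_le)
  also have "\<dots> \<le> real (card ([V]\<^bsup>q\<^esup>)) * exp (- (p ^ (2 * q) * (real (card J) - real q) / (2 * real q)))"
    using assms by (intro prob_UN_le_card_mult prob_few_common_nbrs finite_imp_finite_nsets)
  also have "\<dots> \<le> real (card V) ^ q * exp (- (p ^ (2 * q) * (real (card J) - real q) / (2 * real q)))"
  proof (rule mult_right_mono)
    have "q \<le> card V" using card_mono[OF assms(1,5)] assms(6) by simp
    then have "card V choose q \<le> card V ^ q" by (rule binomial_le_pow)
    then show "real (card ([V]\<^bsup>q\<^esup>)) \<le> real (card V) ^ q" by (simp flip: of_nat_le_iff)
  qed simp
  finally show ?thesis .
qed

section \<open>Distributing the leaves\<close>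

lemma star_assignment_singleton:
  assumes "indep_set G I" "\<And>v. v \<in> I \<Longrightarrow> {v, x} \<in> G"
  shows "star_assignment G I {x} (\<lambda>_. x)"
  using assms by (auto simp: star_assignment_def intro: indep_set_subset)

lemma star_assignment_inj:
  assumes "inj_on c R" "\<And>v. v \<in> R \<Longrightarrow> c v \<in> X \<and> {v, c v} \<in> G"
  shows "star_assignment G R X c"
proof -
  have "[{v \<in> R. c v = x}]\<^bsup>2\<^esup> = {}" for x
    using assms(1) by (auto simp: inj_on_def elim!: nsets2_E)
  then show ?thesis using assms(2) by (auto simp: star_assignment_def indep_set_def)
qed

lemma star_assignment_Un:
  assumes "star_assignment G R X c" "star_assignment G R' X' c'" "X \<inter> X' = {}"
  shows "star_assignment G (R \<union> R') (X \<union> X') (\<lambda>v. if v \<in> R then c v else c' v)"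
proof -
  have in_X: "c v \<in> X" if "v \<in> R" for v using assms(1) that by (auto simp: star_assignment_def)
  have in_X': "c' v \<in> X'" if "v \<in> R'" for v using assms(2) that by (auto simp: star_assignment_def)
  have "indep_set G {v \<in> R \<union> R'. (if v \<in> R then c v else c' v) = x}" for x
  proof (cases "x \<in> X")
    case True
    have "v \<in> R \<and> c v = x" if "v \<in> R \<union> R'" "(if v \<in> R then c v else c' v) = x" for v
      using that True in_X'[of v] assms(3) by (auto split: if_splits)
    then have "{v \<in> R \<union> R'. (if v \<in> R then c v else c' v) = x} \<subseteq> {v \<in> R. c v = x}" by blast
    then show ?thesis using assms(1) indep_set_subset unfolding star_assignment_def by blast
  next
    case False
    then have "{v \<in> R \<union> R'. (if v \<in> R then c v else c' v) = x} \<subseteq> {v \<in> R'. c' v = x}"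
      using in_X by auto
    then show ?thesis using assms(2) indep_set_subset unfolding star_assignment_def by blast
  qed
  then show ?thesis using assms(1,2) by (auto simp: star_assignment_def)
qed

lemma greedy_star_assignment:
  assumes "finite R" "finite X" "1 \<le> g" "g * s + card R \<le> g * card X"
    and "\<And>R' X'. R' \<subseteq> R \<Longrightarrow> X' \<subseteq> X \<Longrightarrow> r \<le> card R' \<Longrightarrow> s \<le> card X' \<Longrightarrow>
      \<exists>x\<in>X'. \<exists>I\<in>[R']\<^bsup>g\<^esup>. indep_set G I \<and> (\<forall>v\<in>I. {v, x} \<in> G)"
  shows "\<exists>R'\<subseteq>R. card R' < r \<and> (\<exists>c. star_assignment G (R - R') X c)"
  using assms(1,2,4,5)
proof (induction "card R" arbitrary: R X rule: less_induct)
  case less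
  show ?case
  proof (cases "card R < r")
    case True
    then show ?thesis by (intro exI[of _ R]) (auto simp: star_assignment_def indep_set_def nsets_empty_iff)
  next
    case False
    have "g * s \<le> g * card X" using less.prems(3) by linarith
    then have "s \<le> card X" using assms(3) by simp
    then obtain x I where x: "x \<in> X" and I: "I \<in> [R]\<^bsup>g\<^esup>" "indep_set G I" "\<And>v. v \<in> I \<Longrightarrow> {v, x} \<in> G"
      using less.prems(4)[of R X] False by auto
    have I': "I \<subseteq> R" "finite I" "card I = g" using I(1) by (auto simp: nsets_def)
    have card_R: "card R = card (R - I) + g"
      using I' card_mono[OF less.prems(1) I'(1)] by (simp add: card_Diff_subset)
    have card_X: "card X = Suc (card (X - {x}))"
      using card.remove[OF less.prems(2) x] .
    have "\<exists>R'\<subseteq>R - I. card R' < r \<and> (\<exists>c. star_assignment G (R - I - R') (X - {x}) c)"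
    proof (rule less.hyps)
      show "card (R - I) < card R" using card_R assms(3) by simp
      show "g * s + card (R - I) \<le> g * card (X - {x})" using less.prems(3) card_R card_X by simp
    next
      fix R' X' assume "R' \<subseteq> R - I" "X' \<subseteq> X - {x}" "r \<le> card R'" "s \<le> card X'"
      then show "\<exists>x\<in>X'. \<exists>I\<in>[R']\<^bsup>g\<^esup>. indep_set G I \<and> (\<forall>v\<in>I. {v, x} \<in> G)"
        using less.prems(4)[of R' X'] by blast
    qed (use less.prems in auto)
    then obtain R' c where R': "R' \<subseteq> R - I" "card R' < r" "star_assignment G (R - I - R') (X - {x}) c"
      by blast
    have "star_assignment G (I \<union> (R - I - R')) ({x} \<union> (X - {x})) (\<lambda>v. if v \<in> I then x else c v)"
      using star_assignment_Un[OF star_assignment_singleton[OF I(2,3)] R'(3)] by blast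
    moreover have "I \<union> (R - I - R') = R - R'" "{x} \<union> (X - {x}) = X" using I'(1) R'(1) x by auto
    ultimately show ?thesis using R'(1,2) by auto
  qed
qed

lemma exists_injective_choice:
  assumes "finite R" "\<And>v. v \<in> R \<Longrightarrow> finite (N v) \<and> k \<le> card (N v)" "card R \<le> k"
  shows "\<exists>c. inj_on c R \<and> (\<forall>v\<in>R. c v \<in> N v)"
  using assms
proof (induction R rule: finite_induct)
  case (insert v R)
  then obtain c where c: "inj_on c R" "\<forall>u\<in>R. c u \<in> N u" by auto
  have "card (c ` R) < card (N v)"
    using card_image_le[OF insert.hyps(1), of c] insert by force
  then have "\<not> N v \<subseteq> c ` R" using card_mono[of "c ` R" "N v"] insert.hyps by auto
  then obtain z where z: "z \<in> N v" "z \<notin> c ` R" by blast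
  have "inj_on (c(v := z)) (insert v R)"
    using c(1) z(2) insert.hyps(2) by (auto simp: inj_on_def)
  moreover have "\<forall>u\<in>insert v R. (c(v := z)) u \<in> N u" using c(2) z by auto
  ultimately show ?case by blast
qed auto

lemma star_assignment_exists:
  assumes "finite X" "finite R" "\<And>v. v \<in> R \<Longrightarrow> card R \<le> card (nbrs G v \<inter> X)"
  shows "\<exists>c. star_assignment G R X c"
proof -
  obtain c where "inj_on c R" "\<forall>v\<in>R. c v \<in> nbrs G v \<inter> X"
    using exists_injective_choice[of R "\<lambda>v. nbrs G v \<inter> X" "card R"] assms by auto
  then show ?thesis using star_assignment_inj[of c R X G] by auto
qed

lemma edge_dense_indep_star:
  assumes "edge_dense V s r p G" "has_indep_sets V N g G" "real N \<le> p / 2 * real r"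
    and "R \<subseteq> V" "X \<subseteq> V" "R \<inter> X = {}" "r \<le> card R" "s \<le> card X"
  shows "\<exists>x\<in>X. \<exists>I\<in>[R]\<^bsup>g\<^esup>. indep_set G I \<and> (\<forall>v\<in>I. {v, x} \<in> G)"
proof -
  obtain R' where R': "R' \<subseteq> R" "card R' = r" "finite R'" using obtain_subset_with_card_n[OF assms(7)] by metis
  obtain X' where X': "X' \<subseteq> X" "card X' = s" "finite X'" using obtain_subset_with_card_n[OF assms(8)] by metis
  have "X' \<in> [V]\<^bsup>s\<^esup>" "R' \<in> [V - X']\<^bsup>r\<^esup>" using R' X' assms(4-6) by (auto simp: nsets_def)
  then obtain x where x: "x \<in> X'" "p / 2 * real r \<le> real (card (nbrs G x \<inter> R'))"
    using assms(1) unfolding edge_dense_def by blast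
  then have "N \<le> card (nbrs G x \<inter> R')" using assms(3) by linarith
  then obtain W where W: "W \<subseteq> nbrs G x \<inter> R'" "card W = N" "finite W"
    using obtain_subset_with_card_n by metis
  then have "W \<in> [V]\<^bsup>N\<^esup>" using R'(1) assms(4) by (auto simp: nsets_def)
  then obtain I where I: "I \<in> [W]\<^bsup>g\<^esup>" "indep_set G I"
    using assms(2) unfolding has_indep_sets_def by blast
  have "I \<in> [R]\<^bsup>g\<^esup>" using I(1) W(1) R'(1) by (auto simp: nsets_def)
  moreover have "{v, x} \<in> G" if "v \<in> I" for v
    using that I(1) W(1) by (auto simp: nsets_def insert_commute)
  ultimately show ?thesis using x(1) X'(1) I(2) by blast
qed

lemma star_assignment_Un_exists:
  assumes "finite V" "R \<subseteq> V" "X \<subseteq> V" "R \<inter> X = {}" "X \<inter> X' = {}" "finite X'" "1 \<le> g"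
    and "edge_dense V s r p G" "has_indep_sets V N g G" "real N \<le> p / 2 * real r"
    and "g * s + card R \<le> g * card X" and remaining: "\<And>v. v \<in> R \<Longrightarrow> r \<le> card (nbrs G v \<inter> X')"
  shows "\<exists>c. star_assignment G R (X \<union> X') c"
proof -
  have fin: "finite R" "finite X" using assms(1-3) finite_subset by blast+
  have "\<exists>R'\<subseteq>R. card R' < r \<and> (\<exists>c. star_assignment G (R - R') X c)"
  proof (rule greedy_star_assignment[OF fin assms(7,11)])
    fix S Y assume SY: "S \<subseteq> R" "Y \<subseteq> X" "r \<le> card S" "s \<le> card Y"
    then have "S \<subseteq> V" "Y \<subseteq> V" "S \<inter> Y = {}" using assms(2-4) by auto
    then show "\<exists>x\<in>Y. \<exists>I\<in>[S]\<^bsup>g\<^esup>. indep_set G I \<and> (\<forall>v\<in>I. {v, x} \<in> G)"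
      using edge_dense_indep_star[OF assms(8-10)] SY(3,4) by blast
  qed
  then obtain R' c where R': "R' \<subseteq> R" "card R' < r" and c: "star_assignment G (R - R') X c" by blast
  have "card R' \<le> card (nbrs G v \<inter> X')" if "v \<in> R'" for v
    using remaining[of v] R' that by auto
  then obtain c' where "star_assignment G R' X' c'"
    using star_assignment_exists[of X' R' G] assms(6) finite_subset[OF R'(1) fin(1)] by blast
  from star_assignment_Un[OF c this assms(5)] show ?thesis using R'(1) by (auto simp: Un_absorb2)
qed

lemma many_common_nbrs_card_le:
  assumes "many_common_nbrs V q p J G" "finite V" "S \<subseteq> V" "card S \<le> q" "q \<le> card V" "finite J"
  shows "p ^ q / 2 * (real (card J) - real q) \<le> real (card (common_nbrs G S \<inter> J))"
proof -
  obtain S' where S': "S \<subseteq> S'" "S' \<subseteq> V" "card S' = q"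
    using exists_subset_between[of S q V] assms(2-5) by auto
  then have "S' \<in> [V]\<^bsup>q\<^esup>" using assms(2) by (auto simp: nsets_def finite_subset)
  then have "p ^ q / 2 * (real (card J) - real q) \<le> real (card (common_nbrs G S' \<inter> J))"
    using assms(1) by (auto simp: many_common_nbrs_def)
  also have "\<dots> \<le> real (card (common_nbrs G S \<inter> J))"
    using S'(1) assms(6) by (intro of_nat_mono card_mono) (auto simp: common_nbrs_def)
  finally show ?thesis .
qed

lemma many_common_nbrs_imp_clique:
  assumes "many_common_nbrs V q p V G" "finite V" "q < card V" "0 < p" "k \<le> q"
  shows "\<exists>B\<in>[V]\<^bsup>k\<^esup>. [B]\<^bsup>2\<^esup> \<subseteq> G"
  using assms(5)
proof (induction k)
  case (Suc k)
  then obtain B where B: "B \<subseteq> V" "finite B" "card B = k" "[B]\<^bsup>2\<^esup> \<subseteq> G" by (auto simp: nsets_def)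
  have "p ^ q / 2 * (real (card V) - real q) \<le> real (card (common_nbrs G B \<inter> V))"
    using assms(1-3) B(1,3) Suc.prems by (intro many_common_nbrs_card_le) auto
  moreover have "0 < p ^ q / 2 * (real (card V) - real q)" using assms(3,4) by simp
  ultimately have "common_nbrs G B \<inter> V \<noteq> {}" by auto
  then obtain w where w: "w \<in> V" "w \<notin> B" "\<forall>v\<in>B. {w, v} \<in> G" by (auto simp: common_nbrs_def)
  have "[insert w B]\<^bsup>2\<^esup> \<subseteq> G"
    using nsets_disjoint_2[of "{w}" B] w(2,3) B(4) by (auto simp: nsets_singleton_iff)
  moreover have "insert w B \<in> [V]\<^bsup>Suc k\<^esup>" using w B by (auto simp: nsets_def)
  ultimately show ?case by blast
qed (simp add: nsets_empty_iff)

lemma cycle_saturated_of_star_assignment: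
  fixes V :: "nat set"
  assumes "5 \<le> m" "finite V" "G \<subseteq> [V]\<^bsup>2\<^esup>" "B \<subseteq> V" "card B = m - 2" "[B]\<^bsup>2\<^esup> \<subseteq> G"
    and X: "X \<subseteq> common_nbrs G B \<inter> V" "2 \<le> card X" and "star_assignment G (V - B - X) X c"
  shows "\<exists>H. cycle_saturated m G H \<and> card H \<le> card V + card X + m\<^sup>2"
proof -
  have "finite B" using assms(2,4) finite_subset by blast
  then obtain h1 h2 where h: "h1 \<in> B" "h2 \<in> B" "h1 \<noteq> h2"
    using card_le_Suc0_iff_eq[of B] assms(1,5) by fastforce
  interpret hub_graph m V G B h1 h2 X c
  proof
    show "{x, h} \<in> G" if "x \<in> X" "h \<in> {h1, h2}" for x h
      using that X(1) h by (auto simp: common_nbrs_def)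
    show "X \<subseteq> V - B" using X(1) by (auto simp: common_nbrs_def)
  qed (use assms h in auto)
  show ?thesis using cycle_saturated_H card_H_le by blast
qed

lemma card_nbrs_common_nbrs_ge:
  assumes "many_common_nbrs V q p J G" "finite V" "finite J" "q \<le> card V"
    and "B \<subseteq> V" "card B < q" "v \<in> V"
  shows "p ^ q / 2 * (real (card J) - real q) \<le> real (card (nbrs G v \<inter> (common_nbrs G B \<inter> J)))"
proof -
  have "finite B" using assms(2,5) finite_subset by blast
  then have "insert v B \<subseteq> V" "card (insert v B) \<le> q" using assms(5-7) by (auto simp: card_insert_if)
  then have "p ^ q / 2 * (real (card J) - real q) \<le> real (card (common_nbrs G (insert v B) \<inter> J))"
    using assms by (intro many_common_nbrs_card_le) auto
  also have "\<dots> \<le> real (card (nbrs G v \<inter> (common_nbrs G B \<inter> J)))"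
    using assms(3) by (intro of_nat_mono card_mono) (auto simp: common_nbrs_def insert_commute)
  finally show ?thesis .
qed

theorem sparse_saturated_exists:
  fixes V :: "nat set" and p :: real
  assumes p: "0 < p" and m: "5 \<le> m" "m < card V" and V: "finite V" "G \<subseteq> [V]\<^bsup>2\<^esup>" "J \<subseteq> V"
    and common: "many_common_nbrs V m p V G" "many_common_nbrs V m p J G"
    and dense: "edge_dense V s r p G" and indep: "has_indep_sets V N g G"
    and N: "real N \<le> p / 2 * real r" and r: "real r \<le> p ^ m / 2 * (real (card J) - real m)"
    and k: "real (k + card J) \<le> p ^ m / 2 * (real (card V) - real m)" "2 \<le> k" "g * s + card V \<le> g * k"
    and g: "1 \<le> g"
  shows "\<exists>H. cycle_saturated m G H \<and> card H \<le> card V + k + card J + m\<^sup>2"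
proof -
  obtain B where B: "B \<subseteq> V" "card B = m - 2" "[B]\<^bsup>2\<^esup> \<subseteq> G"
    using many_common_nbrs_imp_clique[OF common(1) V(1) m(2) p, of "m - 2"] by (auto simp: nsets_def)
  have finJ: "finite J" using V(1,3) finite_subset by blast
  define Y where "Y = common_nbrs G B \<inter> V"
  have "p ^ m / 2 * (real (card V) - real m) \<le> real (card Y)"
    unfolding Y_def using common(1) V(1) B m by (intro many_common_nbrs_card_le) auto
  then have "k + card J \<le> card Y" using k(1) by linarith
  then have "k \<le> card (Y - J)" using diff_card_le_card_Diff[OF finJ, of Y] by linarith
  then obtain X1 where X1: "X1 \<subseteq> Y - J" "card X1 = k" "finite X1"
    using obtain_subset_with_card_n by metis
  define X2 where "X2 = common_nbrs G B \<inter> J"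
  have X2: "finite X2" "X2 \<subseteq> Y" "card X2 \<le> card J"
    using V(3) finJ by (auto simp: X2_def Y_def intro: card_mono)
  have disj: "X1 \<inter> X2 = {}" using X1(1) by (auto simp: X2_def)
  have X: "X1 \<union> X2 \<subseteq> common_nbrs G B \<inter> V" using X1(1) X2(2) by (auto simp: Y_def)
  define R where "R = V - B - (X1 \<union> X2)"
  have R: "R \<subseteq> V" "card R \<le> card V" using V(1) by (auto simp: R_def intro: card_mono)
  have "\<exists>c. star_assignment G R (X1 \<union> X2) c"
  proof (rule star_assignment_Un_exists[OF V(1) R(1) _ _ disj X2(1) g dense indep N])
    show "X1 \<subseteq> V" "R \<inter> X1 = {}" using X by (auto simp: R_def)
    show "g * s + card R \<le> g * card X1" using k(3) X1(2) R(2) by simp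
    fix v assume "v \<in> R"
    then have "p ^ m / 2 * (real (card J) - real m) \<le> real (card (nbrs G v \<inter> X2))"
      unfolding X2_def using common(2) V(1) finJ m B R(1) by (intro card_nbrs_common_nbrs_ge[where V = V]) auto
    then show "r \<le> card (nbrs G v \<inter> X2)" using r by linarith
  qed
  then obtain c where "star_assignment G (V - B - (X1 \<union> X2)) (X1 \<union> X2) c"
    by (auto simp: R_def)
  moreover have "2 \<le> card (X1 \<union> X2)"
    using card_mono[of "X1 \<union> X2" X1] X1 X2(1) k(2) by auto
  ultimately obtain H where "cycle_saturated m G H" "card H \<le> card V + card (X1 \<union> X2) + m\<^sup>2"
    using cycle_saturated_of_star_assignment[OF m(1) V(1,2) B X] by blast
  moreover have "card (X1 \<union> X2) \<le> k + card J" using card_Un_le[of X1 X2] X1(2) X2(3) by linarith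
  ultimately show ?thesis by (intro exI[of _ H]) simp
qed

section \<open>Choosing the parameters\<close>

locale hub_graph_parameters =
  fixes p e :: real and m :: nat
  assumes p: "0 < p" "p < 1" and m: "5 \<le> m" and e: "0 < e" "e < 1 / 2"
begin

definition c :: real where
  "c = 1 / ln (1 / (1 - p))"

definition L :: "nat \<Rightarrow> real" where
  "L n = c * ln (real n)"

definition star_size :: "nat \<Rightarrow> nat" where
  "star_size n = nat \<lfloor>(2 - e) * L n\<rfloor>"

definition reserve :: "nat \<Rightarrow> nat" where
  "reserve n = nat \<lfloor>e * real n / L n\<rfloor>"

definition remainder :: "nat \<Rightarrow> nat" where
  "remainder n = nat \<lfloor>p ^ m / 4 * real (reserve n)\<rfloor>"

definition sample :: "nat \<Rightarrow> nat" where
  "sample n = nat \<lfloor>p / 2 * real (remainder n)\<rfloor>"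

definition slack :: "nat \<Rightarrow> nat" where
  "slack n = nat \<lceil>(L n)\<^sup>2\<rceil>"

definition centres :: "nat \<Rightarrow> nat" where
  "centres n = slack n + n div star_size n + 1"

lemmas parameter_defs =
  L_def star_size_def reserve_def remainder_def sample_def slack_def centres_def

lemma c_pos: "0 < c"
  using p by (simp add: c_def)

lemma pm_pos: "0 < p ^ m"
  using p by simp

lemma log_eq_L: "log (1 / (1 - p)) (real n) = L n"
  by (simp add: L_def c_def log_def)

lemma eventually_indep_set_weight_le_1: "\<forall>\<^sub>F n in sequentially.
  (real (star_size n))\<^sup>2 / real (sample n) * (1 / (1 - p)) powr (real (star_size n + 1) / 2) \<le> 1"
proof -
  define b where "b = 1 / (1 - p)"
  have b: "1 < b" "c * ln b = 1" using p by (simp_all add: b_def c_def)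
  then have "0 < b powr (1 / 2)" by simp
  then have "\<forall>\<^sub>F n in sequentially.
      (real (star_size n))\<^sup>2 / real (sample n) * (real n powr (1 - e / 2) * b powr (1 / 2)) \<le> 1"
    unfolding parameter_defs using c_pos e pm_pos p by real_asymp
  moreover have "\<forall>\<^sub>F n in sequentially. 0 < L n \<and> 0 < real n"
    unfolding L_def using c_pos by (intro eventually_conj) real_asymp+
  ultimately show ?thesis
  proof eventually_elim
    case (elim n)
    have "real (star_size n) \<le> (2 - e) * L n" unfolding star_size_def using elim(2) e by simp
    then have "b powr (real (star_size n + 1) / 2) \<le> b powr (((2 - e) * L n + 1) / 2)"
      using b(1) by (intro powr_mono) auto
    also have "((2 - e) * L n + 1) / 2 = (1 - e / 2) * L n + 1 / 2" by (simp add: field_simps)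
    also have "b powr \<dots> = real n powr (1 - e / 2) * b powr (1 / 2)"
    proof -
      have "b powr L n = exp (c * ln b * ln (real n))" using b(1) by (simp add: powr_def L_def)
      also have "\<dots> = real n" using elim(2) by (simp only: b(2)) simp
      finally show ?thesis by (simp add: powr_add powr_powr[symmetric] mult.commute[of "1 - e / 2"])
    qed
    finally have "(real (star_size n))\<^sup>2 / real (sample n) * b powr (real (star_size n + 1) / 2)
        \<le> (real (star_size n))\<^sup>2 / real (sample n) * (real n powr (1 - e / 2) * b powr (1 / 2))"
      by (intro mult_left_mono) auto
    then show ?case using elim(1) by (simp add: b_def)
  qed
qed

lemma whp_has_indep_sets: "whp p (\<lambda>n. has_indep_sets {1..n} (sample n) (star_size n))"
proof (rule whpI)
  define b where "b = 1 / (1 - p)"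
  have b: "1 < b" using p by (simp add: b_def)
  show "(\<lambda>n. 2 ^ n * exp (- ((real (sample n))\<^sup>2 / (72 * b\<^sup>2 * real (star_size n) ^ 8)))) \<longlonglongrightarrow> 0"
    unfolding parameter_defs using c_pos e pm_pos p b by real_asymp
  have "\<forall>\<^sub>F n in sequentially. 2 \<le> star_size n \<and> 1 \<le> sample n"
    unfolding parameter_defs using c_pos e pm_pos p by (intro eventually_conj) real_asymp+
  then show "\<forall>\<^sub>F n in sequentially. measure_pmf.prob (gnp n p) {G. \<not> has_indep_sets {1..n} (sample n) (star_size n) G}
      \<le> 2 ^ n * exp (- ((real (sample n))\<^sup>2 / (72 * b\<^sup>2 * real (star_size n) ^ 8)))"
    using eventually_indep_set_weight_le_1
  proof eventually_elim
    case (elim n)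
    then show ?case
      using prob_not_has_indep_sets[of "{1..n}" p "star_size n" "sample n"] p
      by (simp add: gnp_eq_random_subset b_def)
  qed
qed

lemma whp_edge_dense: "whp p (\<lambda>n. edge_dense {1..n} (slack n) (remainder n) p)"
proof (rule whpI)
  show "(\<lambda>n. 4 ^ n * exp (- (p\<^sup>2 * real (slack n) * real (remainder n) / 2))) \<longlonglongrightarrow> 0"
    unfolding parameter_defs using c_pos e pm_pos p by real_asymp
  have "\<forall>\<^sub>F n in sequentially. 1 \<le> slack n \<and> 1 \<le> remainder n"
    unfolding parameter_defs using c_pos e pm_pos p by (intro eventually_conj) real_asymp+
  then show "\<forall>\<^sub>F n in sequentially. measure_pmf.prob (gnp n p) {G. \<not> edge_dense {1..n} (slack n) (remainder n) p G}
      \<le> 4 ^ n * exp (- (p\<^sup>2 * real (slack n) * real (remainder n) / 2))"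
  proof eventually_elim
    case (elim n)
    then show ?case
      using prob_not_edge_dense[of "{1..n}" p "slack n" "remainder n"] p by (simp add: gnp_eq_random_subset)
  qed
qed

lemma whp_many_common_nbrs:
  assumes "\<forall>\<^sub>F n in sequentially. J n \<subseteq> {1..n} \<and> m < card (J n)"
    and "(\<lambda>n. real n powr real m * exp (- (p ^ (2 * m) * (real (card (J n)) - real m) / (2 * real m)))) \<longlonglongrightarrow> 0"
  shows "whp p (\<lambda>n. many_common_nbrs {1..n} m p (J n))"
proof (rule whpI[OF _ assms(2)])
  show "\<forall>\<^sub>F n in sequentially. measure_pmf.prob (gnp n p) {G. \<not> many_common_nbrs {1..n} m p (J n) G}
      \<le> real n powr real m * exp (- (p ^ (2 * m) * (real (card (J n)) - real m) / (2 * real m)))"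
    using assms(1) eventually_gt_at_top[of 0]
  proof eventually_elim
    case (elim n)
    then show ?case
      using prob_not_many_common_nbrs[of "{1..n}" p m "J n"] p m
      by (simp add: gnp_eq_random_subset powr_realpow)
  qed
qed

lemma whp_many_common_nbrs_all: "whp p (\<lambda>n. many_common_nbrs {1..n} m p {1..n})"
proof (rule whp_many_common_nbrs)
  define Q where "Q = p ^ (2 * m)"
  define M where "M = real m"
  have "0 < Q" "0 < M" using p m by (simp_all add: Q_def M_def)
  then have "(\<lambda>n. real n powr M * exp (- (Q * (real n - M) / (2 * M)))) \<longlonglongrightarrow> 0" by real_asymp
  then show "(\<lambda>n. real n powr real m * exp (- (p ^ (2 * m) * (real (card {1..n}) - real m) / (2 * real m)))) \<longlonglongrightarrow> 0"
    by (simp add: Q_def M_def)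
qed (use eventually_gt_at_top[of m] in simp)

lemma whp_many_common_nbrs_reserve: "whp p (\<lambda>n. many_common_nbrs {1..n} m p {1..reserve n})"
proof (rule whp_many_common_nbrs)
  define Q where "Q = p ^ (2 * m)"
  define M where "M = real m"
  have "0 < Q" "0 < M" using p m by (simp_all add: Q_def M_def)
  then have "(\<lambda>n. real n powr M * exp (- (Q * (real (reserve n) - M) / (2 * M)))) \<longlonglongrightarrow> 0"
    unfolding parameter_defs using c_pos e by real_asymp
  then show "(\<lambda>n. real n powr real m * exp (- (p ^ (2 * m) * (real (card {1..reserve n}) - real m) / (2 * real m)))) \<longlonglongrightarrow> 0"
    by (simp add: Q_def M_def)
  have "\<forall>\<^sub>F n in sequentially. reserve n \<le> n \<and> m < reserve n"
    unfolding parameter_defs using c_pos e by (intro eventually_conj) real_asymp+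
  then show "\<forall>\<^sub>F n in sequentially. {1..reserve n} \<subseteq> {1..n} \<and> m < card {1..reserve n}"
    by eventually_elim auto
qed

lemma eventually_parameters_feasible: "\<forall>\<^sub>F n in sequentially. m < n \<and> reserve n \<le> n \<and> 1 \<le> star_size n
  \<and> real (remainder n) \<le> p ^ m / 2 * (real (reserve n) - real m)
  \<and> real (centres n + reserve n) \<le> p ^ m / 2 * (real n - real m)"
  using eventually_gt_at_top[of m] c_pos e pm_pos unfolding parameter_defs
  by (intro eventually_conj) (assumption | real_asymp)+

lemma eventually_hub_graph_sparse: "\<forall>\<^sub>F n in sequentially.
  real (centres n + reserve n + m\<^sup>2) \<le> real n / (2 * L n) * (1 + 4 * e)"
proof -
  have "(\<lambda>n. real (centres n + reserve n + m\<^sup>2) * L n / real n) \<longlonglongrightarrow> 1 / (2 - e) + e"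
    unfolding parameter_defs using c_pos e by real_asymp (simp add: field_simps)
  moreover have "1 / (2 - e) + e < (1 + 4 * e) / 2"
  proof -
    have "2 < (1 + 2 * e) * (2 - e)" using e by (simp add: algebra_simps)
    then show ?thesis using e by (simp add: field_simps)
  qed
  ultimately have "\<forall>\<^sub>F n in sequentially. real (centres n + reserve n + m\<^sup>2) * L n / real n < (1 + 4 * e) / 2"
    by (rule order_tendstoD(2))
  moreover have "\<forall>\<^sub>F n in sequentially. 0 < L n \<and> 0 < real n"
    unfolding L_def using c_pos by (intro eventually_conj) real_asymp+
  ultimately show ?thesis
    by eventually_elim (simp add: field_simps)
qed

lemma leaves_fit:
  assumes "1 \<le> star_size n"
  shows "star_size n * slack n + n \<le> star_size n * centres n"
proof -
  have "n \<le> star_size n * (n div star_size n) + star_size n"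
    using mod_less_divisor[of "star_size n" n] mult_div_mod_eq[of "star_size n" n] assms by linarith
  then show ?thesis by (simp add: centres_def distrib_left)
qed

theorem whp_sparse_saturated_exists:
  "whp p (\<lambda>n G. \<exists>H. cycle_saturated m G H \<and> real (card H) \<le> real n + real n / (2 * L n) * (1 + 4 * e))"
proof (rule whp_mono)
  show "whp p (\<lambda>n G. (has_indep_sets {1..n} (sample n) (star_size n) G
      \<and> edge_dense {1..n} (slack n) (remainder n) p G)
      \<and> many_common_nbrs {1..n} m p {1..n} G \<and> many_common_nbrs {1..n} m p {1..reserve n} G)"
    by (intro whp_conj whp_has_indep_sets whp_edge_dense whp_many_common_nbrs_all whp_many_common_nbrs_reserve)
  have "\<forall>\<^sub>F n in sequentially. 2 \<le> centres n"
    unfolding parameter_defs using c_pos e by real_asymp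
  then show "\<forall>\<^sub>F n in sequentially. \<forall>G\<subseteq>[{1..n}]\<^bsup>2\<^esup>.
      (has_indep_sets {1..n} (sample n) (star_size n) G \<and> edge_dense {1..n} (slack n) (remainder n) p G)
      \<and> many_common_nbrs {1..n} m p {1..n} G \<and> many_common_nbrs {1..n} m p {1..reserve n} G \<longrightarrow>
      (\<exists>H. cycle_saturated m G H \<and> real (card H) \<le> real n + real n / (2 * L n) * (1 + 4 * e))"
    using eventually_parameters_feasible eventually_hub_graph_sparse
  proof eventually_elim
    case (elim n)
    have "\<exists>H. cycle_saturated m G H \<and> real (card H) \<le> real n + real n / (2 * L n) * (1 + 4 * e)"
      if G: "G \<subseteq> [{1..n}]\<^bsup>2\<^esup>" "has_indep_sets {1..n} (sample n) (star_size n) G"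
        "edge_dense {1..n} (slack n) (remainder n) p G"
        "many_common_nbrs {1..n} m p {1..n} G" "many_common_nbrs {1..n} m p {1..reserve n} G" for G
    proof -
      have "real (sample n) \<le> p / 2 * real (remainder n)"
        unfolding sample_def using p by (intro of_nat_floor) simp
      then obtain H where "cycle_saturated m G H" "card H \<le> n + centres n + reserve n + m\<^sup>2"
        using sparse_saturated_exists[of p m "{1..n}" G "{1..reserve n}" "slack n" "remainder n" "sample n"
            "star_size n" "centres n"] leaves_fit[of n] G elim p m by auto
      then show ?thesis using elim(3) by (intro exI[of _ H]) (simp flip: of_nat_le_iff[where 'a = real])
    qed
    then show ?case by blast
  qed
qed

end

section \<open>The saturation number\<close>

lemma
  assumes "finite G" "cycle_saturated m G H"
  shows sat_cycle_le: "sat_cycle G m \<le> card H"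
    and sat_cycle_attained: "\<exists>H'. cycle_saturated m G H' \<and> card H' = sat_cycle G m"
proof -
  have "finite {H. cycle_saturated m G H}"
    using assms(1) by (auto simp: cycle_saturated_def intro: finite_subset[of _ "Pow G"])
  then have fin: "finite (card ` {H. cycle_saturated m G H})" by simp
  show "sat_cycle G m \<le> card H"
    unfolding sat_cycle_def using fin assms(2) by (intro Min_le) auto
  have "sat_cycle G m \<in> card ` {H. cycle_saturated m G H}"
    unfolding sat_cycle_def using fin assms(2) by (intro Min_in) auto
  then show "\<exists>H'. cycle_saturated m G H' \<and> card H' = sat_cycle G m" by auto
qed

theorem whp_sat_cycle_bounds:
  fixes p e :: real and m :: nat
  assumes "0 < p" "p < 1" "5 \<le> m" "0 < e" "e < 1 / 2"
  shows "whp p (\<lambda>n G.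
    real n + real n / (4 * (real m - 1) * log (1 / (1 - p)) (real n)) * (1 - e) \<le> real (sat_cycle G m) \<and>
    real (sat_cycle G m) \<le> real n + real n / (2 * log (1 / (1 - p)) (real n)) * (1 + 4 * e))"
proof -
  interpret hub_graph_parameters p e m using assms by unfold_locales
  have "e < 1" using assms(5) by simp
  show ?thesis
    unfolding log_eq_L
  proof (rule whp_mono[OF whp_conj[OF whp_saturated_card_ge[OF assms(1-4) \<open>e < 1\<close>] whp_sparse_saturated_exists]],
      intro always_eventually allI impI, elim conjE exE)
    fix n G H
    assume G: "G \<subseteq> [{1..n}]\<^bsup>2\<^esup>" and H: "cycle_saturated m G H" "real (card H) \<le> real n + real n / (2 * L n) * (1 + 4 * e)"
      and lower: "\<forall>H. cycle_saturated m G H \<longrightarrow>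
        real n + real n / (4 * (real m - 1) * log (1 / (1 - p)) (real n)) * (1 - e) \<le> real (card H)"
    have "finite G" using G finite_subset finite_imp_finite_nsets by blast
    then obtain H' where "cycle_saturated m G H'" "card H' = sat_cycle G m" "sat_cycle G m \<le> card H"
      using sat_cycle_le[OF _ H(1)] sat_cycle_attained[OF _ H(1)] by blast
    then show "real n + real n / (4 * (real m - 1) * L n) * (1 - e) \<le> real (sat_cycle G m) \<and>
        real (sat_cycle G m) \<le> real n + real n / (2 * L n) * (1 + 4 * e)"
      using lower H(2) by (auto simp: log_eq_L)
  qed
qed

lemma eventually_sequentially_diagonal:
  fixes P :: "nat \<Rightarrow> nat \<Rightarrow> bool"
  assumes "\<And>k. \<forall>\<^sub>F n in sequentially. P k n"
  obtains K :: "nat \<Rightarrow> nat" where "filterlim K at_top sequentially" "\<forall>\<^sub>F n in sequentially. P (K n) n"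
proof -
  obtain N where N: "\<And>k n. N k \<le> n \<Longrightarrow> P k n"
    using assms unfolding eventually_sequentially by metis
  define A where "A = (\<lambda>n. {k. k \<le> n \<and> N k \<le> n})"
  define K where "K = (\<lambda>n. Max (A n))"
  have finA: "finite (A n)" for n by (rule finite_subset[of _ "{..n}"]) (auto simp: A_def)
  have "\<forall>\<^sub>F n in sequentially. k \<le> K n" for k
    unfolding eventually_sequentially K_def using finA
    by (intro exI[of _ "max k (N k)"]) (auto simp: A_def intro!: Max_ge)
  then have "filterlim K at_top sequentially" by (simp add: filterlim_at_top)
  moreover have "P (K n) n" if "N 0 \<le> n" for n
  proof -
    have "K n \<in> A n" unfolding K_def using finA that by (intro Max_in) (auto simp: A_def)
    then show ?thesis using N by (simp add: A_def)
  qed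
  then have "\<forall>\<^sub>F n in sequentially. P (K n) n" unfolding eventually_sequentially by blast
  ultimately show ?thesis using that by blast
qed

lemma tendsto_diagonal:
  fixes Q :: "real \<Rightarrow> nat \<Rightarrow> 'a :: metric_space"
  assumes "0 < r" "\<And>e. 0 < e \<Longrightarrow> e < r \<Longrightarrow> Q e \<longlonglongrightarrow> l"
  obtains \<delta> where "\<delta> \<longlonglongrightarrow> 0" "(\<lambda>n. Q (\<delta> n) n) \<longlonglongrightarrow> l"
proof -
  define d where "d = (\<lambda>k::nat. r / (real k + 2))"
  have d: "0 < d k" "d k < r" for k using assms(1) by (auto simp: d_def field_simps intro: add_pos_nonneg)
  have "d \<longlonglongrightarrow> 0" unfolding d_def by real_asymp
  have "\<forall>\<^sub>F n in sequentially. dist (Q (d k) n) l < d k" for k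
    using tendstoD[OF assms(2)[OF d]] d(1) by blast
  then obtain K where K: "filterlim K at_top sequentially"
    "\<forall>\<^sub>F n in sequentially. dist (Q (d (K n)) n) l < d (K n)"
    by (rule eventually_sequentially_diagonal)
  have "(\<lambda>n. d (K n)) \<longlonglongrightarrow> 0" using \<open>d \<longlonglongrightarrow> 0\<close> K(1) by (rule filterlim_compose)
  moreover have "(\<lambda>n. dist (Q (d (K n)) n) l) \<longlonglongrightarrow> 0"
    by (rule tendsto_sandwich[OF _ _ tendsto_const \<open>(\<lambda>n. d (K n)) \<longlonglongrightarrow> 0\<close>])
      (use K(2) in \<open>auto elim: eventually_mono\<close>)
  then have "(\<lambda>n. Q (d (K n)) n) \<longlonglongrightarrow> l" by (rule tendsto_dist_iff[THEN iffD2])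
  ultimately show ?thesis by (rule that)
qed

theorem theorem1:
  fixes p :: real and m :: nat
  assumes "0 < p" and "p < 1" and "m \<ge> 5"
  shows "\<exists>\<epsilon>1 \<epsilon>2 :: nat \<Rightarrow> real. \<epsilon>1 \<longlonglongrightarrow> 0 \<and> \<epsilon>2 \<longlonglongrightarrow> 0 \<and>
    (\<lambda>n. measure_pmf.prob (gnp n p)
        {G. real n + real n / (4 * (real m - 1) * log (1 / (1 - p)) (real n)) * (1 - \<epsilon>1 n)
              \<le> real (sat_cycle G m) \<and>
            real (sat_cycle G m)
              \<le> real n + real n / (2 * log (1 / (1 - p)) (real n)) * (1 + \<epsilon>2 n)})
    \<longlonglongrightarrow> 1"
proof -
  define Q where "Q = (\<lambda>e n. measure_pmf.prob (gnp n p)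
        {G. real n + real n / (4 * (real m - 1) * log (1 / (1 - p)) (real n)) * (1 - e)
              \<le> real (sat_cycle G m) \<and>
            real (sat_cycle G m)
              \<le> real n + real n / (2 * log (1 / (1 - p)) (real n)) * (1 + 4 * e)})"
  have "Q e \<longlonglongrightarrow> 1" if "0 < e" "e < 1 / 2" for e
    using whp_sat_cycle_bounds[OF assms that] by (simp add: whp_def Q_def)
  then obtain \<delta> where \<delta>: "\<delta> \<longlonglongrightarrow> 0" "(\<lambda>n. Q (\<delta> n) n) \<longlonglongrightarrow> 1"
    using tendsto_diagonal[of "1 / 2" Q 1] by auto
  have "(\<lambda>n. 4 * \<delta> n) \<longlonglongrightarrow> 0" using tendsto_mult_right_zero[OF \<delta>(1)] by simp
  then show ?thesis using \<delta> unfolding Q_def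
    by (intro exI[of _ \<delta>] exI[of _ "\<lambda>n. 4 * \<delta> n"]) simp
qed

end
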